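(* Suppose that $M$ is a closed Riemannian $SC$-manifold. Then $M$ has bounded geodesic combinatorics.
   Context: A closed (compact, without boundary) Riemannian manifold is an $SC$-manifold if all its (non-constant, unit speed) geodesics are simple, periodic and of common least period. Let $M$ be a complete Riemannian manifold with distance function $\mathrm{d}$. For a finite subset $X\subset M$ with $|X|\ge 2$ and $x\in X$, define $\operatorname{nnd}(x,X)=\min_{y\in X\setminus\{x\}}\mathrm{d}(x,y)$ and $\operatorname{NND}(X)=\{\operatorname{nnd}(x,X)\mid x\in X\}$. Bounds on $|\operatorname{NND}(X)|$ are understood to concern only sets with at least two points (one may set $\operatorname{NND}(X)=\emptyset$ when $|X|\le 1$). For $K\in\mathbb{N}$, a complete Riemannian manifold $M$ has $K$-bounded geodesic combinatorics if for every geodesic $\gamma:\mathbb{R}\to M$, every $T\in\mathbb{R}$, and every $n\in\mathbb{N}$, $|\operatorname{NND}(\{\gamma(iT)\mid i=0,\ldots,n\})|\le K$. $M$ has bounded geodesic combinatorics if it has $K$-bounded geodesic combinatorics for some $K\in\mathbb{N}$. Manifolds are connected. *)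

theory Defs
  imports "HOL-Analysis.Analysis"
begin

text \<open>Intended for open sets \<open>S\<close>.\<close>

fun Ck_on :: "nat \<Rightarrow> 'a::real_normed_vector set \<Rightarrow> ('a \<Rightarrow> 'b::real_normed_vector) \<Rightarrow> bool" where
  "Ck_on 0 S f \<longleftrightarrow> continuous_on S f"
| "Ck_on (Suc k) S f \<longleftrightarrow>
     (\<forall>x\<in>S. f differentiable (at x)) \<and> (\<forall>v. Ck_on k S (\<lambda>x. frechet_derivative f (at x) v))"

definition smooth_on :: "'a::real_normed_vector set \<Rightarrow> ('a \<Rightarrow> 'b::real_normed_vector) \<Rightarrow> bool" where
  "smooth_on S f \<longleftrightarrow> (\<forall>k. Ck_on k S f)"

datatype ('m, 'e) chart = Chart (chart_dom: "'m set") (chart_map: "'m \<Rightarrow> 'e")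

definition chart_codom :: "('m, 'e) chart \<Rightarrow> 'e set" where
  "chart_codom c = chart_map c ` chart_dom c"

definition chart_inv :: "('m, 'e) chart \<Rightarrow> 'e \<Rightarrow> 'm" where
  "chart_inv c = inv_into (chart_dom c) (chart_map c)"

definition is_chart :: "('m::topological_space, 'e::euclidean_space) chart \<Rightarrow> bool" where
  "is_chart c \<longleftrightarrow> open (chart_dom c) \<and> open (chart_codom c) \<and>
     homeomorphism (chart_dom c) (chart_codom c) (chart_map c) (chart_inv c)"

definition transition :: "('m, 'e) chart \<Rightarrow> ('m, 'e) chart \<Rightarrow> 'e \<Rightarrow> 'e" where
  "transition c c' = chart_map c' \<circ> chart_inv c"

definition velocity ::
  "('m, 'e::real_normed_vector) chart \<Rightarrow> (real \<Rightarrow> 'm) \<Rightarrow> real set \<Rightarrow> real \<Rightarrow> 'e" where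
  "velocity c \<gamma> S t = vector_derivative (chart_map c \<circ> \<gamma>) (at t within S)"

text \<open>
  The manifold is the whole type \<open>'m\<close>, modelled on \<open>'e\<close>, with a smooth atlas \<open>A\<close>.
  The metric tensor is given by its local representatives: \<open>G c x\<close> is the inner product on
  tangent vectors at the point with coordinates \<open>x\<close> in the chart \<open>c\<close>, and the
  representatives obey the transformation law of a covariant 2-tensor.
\<close>

locale riemannian_manifold =
  fixes A :: "('m::{t2_space, second_countable_topology}, 'e::euclidean_space) chart set"
    and G :: "('m, 'e) chart \<Rightarrow> 'e \<Rightarrow> 'e \<Rightarrow> 'e \<Rightarrow> real"
  assumes charts: "\<And>c. c \<in> A \<Longrightarrow> is_chart c"
    and cover: "(\<Union>c\<in>A. chart_dom c) = UNIV"
    and transition_smooth: "\<And>c c'. c \<in> A \<Longrightarrow> c' \<in> A \<Longrightarrow>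
          smooth_on (chart_map c ` (chart_dom c \<inter> chart_dom c')) (transition c c')"
    and connected_manifold: "connected (UNIV :: 'm set)"
    and metric_bilinear: "\<And>c x. c \<in> A \<Longrightarrow> x \<in> chart_codom c \<Longrightarrow> bilinear (G c x)"
    and metric_sym: "\<And>c x v w. c \<in> A \<Longrightarrow> x \<in> chart_codom c \<Longrightarrow> G c x v w = G c x w v"
    and metric_pos: "\<And>c x v. c \<in> A \<Longrightarrow> x \<in> chart_codom c \<Longrightarrow> v \<noteq> 0 \<Longrightarrow> G c x v v > 0"
    and metric_smooth: "\<And>c v w. c \<in> A \<Longrightarrow> smooth_on (chart_codom c) (\<lambda>x. G c x v w)"
    and metric_transition: "\<And>c c' p v w. c \<in> A \<Longrightarrow> c' \<in> A \<Longrightarrow>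
          p \<in> chart_dom c \<Longrightarrow> p \<in> chart_dom c' \<Longrightarrow>
          G c (chart_map c p) v w =
          G c' (chart_map c' p)
            (frechet_derivative (transition c c') (at (chart_map c p)) v)
            (frechet_derivative (transition c c') (at (chart_map c p)) w)"
begin

definition christoffel1 :: "('m, 'e) chart \<Rightarrow> 'e \<Rightarrow> 'e \<Rightarrow> 'e \<Rightarrow> 'e \<Rightarrow> real" where
  "christoffel1 c x v w u =
     (frechet_derivative (\<lambda>y. G c y w u) (at x) v
      + frechet_derivative (\<lambda>y. G c y v u) (at x) w
      - frechet_derivative (\<lambda>y. G c y v w) (at x) u) / 2"

text \<open>Christoffel symbols of the second kind, as a vector-valued bilinear map: the index
  of \<open>christoffel1\<close> is raised with the metric.\<close>

definition christoffel :: "('m, 'e) chart \<Rightarrow> 'e \<Rightarrow> 'e \<Rightarrow> 'e \<Rightarrow> 'e" where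
  "christoffel c x v w = (THE z. \<forall>u. G c x z u = christoffel1 c x v w u)"

text \<open>Geodesics are affinely parametrised; constant curves are included.\<close>

definition geodesic :: "(real \<Rightarrow> 'm) \<Rightarrow> bool" where
  "geodesic \<gamma> \<longleftrightarrow> continuous_on UNIV \<gamma> \<and>
     (\<forall>c\<in>A. \<forall>t. \<gamma> t \<in> chart_dom c \<longrightarrow>
        ((chart_map c \<circ> \<gamma>) has_vector_derivative velocity c \<gamma> UNIV t) (at t) \<and>
        (velocity c \<gamma> UNIV has_vector_derivative
           - christoffel c (chart_map c (\<gamma> t)) (velocity c \<gamma> UNIV t) (velocity c \<gamma> UNIV t)) (at t))"

definition chart_at :: "'m \<Rightarrow> ('m, 'e) chart" where
  "chart_at p = (SOME c. c \<in> A \<and> p \<in> chart_dom c)"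

text \<open>The value does not depend on the chosen chart, by the transformation law.\<close>

definition speed :: "(real \<Rightarrow> 'm) \<Rightarrow> real set \<Rightarrow> real \<Rightarrow> real" where
  "speed \<gamma> S t =
     (let c = chart_at (\<gamma> t); v = velocity c \<gamma> S t in sqrt (G c (chart_map c (\<gamma> t)) v v))"

text \<open>Continuous differentiability on a closed interval, one-sided at the endpoints.\<close>

definition C1_curve :: "(real \<Rightarrow> 'm) \<Rightarrow> real \<Rightarrow> real \<Rightarrow> bool" where
  "C1_curve \<gamma> a b \<longleftrightarrow> continuous_on {a..b} \<gamma> \<and>
     (\<forall>c\<in>A. (\<forall>t\<in>{a..b} \<inter> \<gamma> -` chart_dom c.
               ((chart_map c \<circ> \<gamma>) has_vector_derivative velocity c \<gamma> {a..b} t)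
                 (at t within {a..b})) \<and>
             continuous_on ({a..b} \<inter> \<gamma> -` chart_dom c) (velocity c \<gamma> {a..b}))"

definition piecewise_C1_curve :: "(real \<Rightarrow> 'm) \<Rightarrow> real \<Rightarrow> real \<Rightarrow> bool" where
  "piecewise_C1_curve \<gamma> a b \<longleftrightarrow>
     (\<exists>(k::nat) (\<tau> :: nat \<Rightarrow> real). \<tau> 0 = a \<and> \<tau> k = b \<and>
        (\<forall>i<k. \<tau> i < \<tau> (Suc i) \<and> C1_curve \<gamma> (\<tau> i) (\<tau> (Suc i))))"

definition curve_length :: "(real \<Rightarrow> 'm) \<Rightarrow> real \<Rightarrow> real \<Rightarrow> real" where
  "curve_length \<gamma> a b = integral {a..b} (speed \<gamma> {a..b})"

definition riem_dist :: "'m \<Rightarrow> 'm \<Rightarrow> real" where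
  "riem_dist p q =
     Inf {curve_length \<gamma> 0 1 |\<gamma>. piecewise_C1_curve \<gamma> 0 1 \<and> \<gamma> 0 = p \<and> \<gamma> 1 = q}"

definition nnd :: "'m \<Rightarrow> 'm set \<Rightarrow> real" where
  "nnd x X = Min (riem_dist x ` (X - {x}))"

definition NND :: "'m set \<Rightarrow> real set" where
  "NND X = (if 2 \<le> card X then (\<lambda>x. nnd x X) ` X else {})"

definition K_bounded_geodesic_combinatorics :: "nat \<Rightarrow> bool" where
  "K_bounded_geodesic_combinatorics K \<longleftrightarrow>
     (\<forall>\<gamma>. geodesic \<gamma> \<longrightarrow>
        (\<forall>(T::real) (n::nat). card (NND ((\<lambda>i. \<gamma> (real i * T)) ` {0..n})) \<le> K))"

definition bounded_geodesic_combinatorics :: bool where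
  "bounded_geodesic_combinatorics \<longleftrightarrow> (\<exists>K. K_bounded_geodesic_combinatorics K)"

end

definition least_period :: "(real \<Rightarrow> 'm) \<Rightarrow> real \<Rightarrow> bool" where
  "least_period \<gamma> L \<longleftrightarrow>
     L > 0 \<and> (\<forall>t. \<gamma> (t + L) = \<gamma> t) \<and> (\<forall>p. 0 < p \<and> p < L \<longrightarrow> \<not> (\<forall>t. \<gamma> (t + p) = \<gamma> t))"

locale closed_riemannian_manifold = riemannian_manifold A G
  for A :: "('m::{t2_space, second_countable_topology}, 'e::euclidean_space) chart set"
    and G :: "('m, 'e) chart \<Rightarrow> 'e \<Rightarrow> 'e \<Rightarrow> 'e \<Rightarrow> real" +
  assumes compact_manifold: "compact (UNIV :: 'm set)"

locale SC_manifold = closed_riemannian_manifold A G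
  for A :: "('m::{t2_space, second_countable_topology}, 'e::euclidean_space) chart set"
    and G :: "('m, 'e) chart \<Rightarrow> 'e \<Rightarrow> 'e \<Rightarrow> 'e \<Rightarrow> real" +
  assumes geodesics_simple_periodic:
    "\<exists>L. \<forall>\<gamma>. geodesic \<gamma> \<and> (\<forall>t. speed \<gamma> UNIV t = 1) \<longrightarrow>
       least_period \<gamma> L \<and> inj_on \<gamma> {0..<L}"

end

theory Submission
  imports Defs
begin

text \<open>
  Let \<open>L\<close> be the common period. A geodesic of speed zero is constant, and any other one can be
  reparametrised, so only unit speed geodesics \<open>\<gamma>\<close> matter. Such a \<open>\<gamma>\<close> winds around a simple
  closed curve of length \<open>L\<close>; let \<open>\<parallel>t - s\<parallel>\<close> be the length of the shorter arc between \<open>\<gamma> s\<close> and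
  \<open>\<gamma> t\<close>. The heart of the proof is a number \<open>\<delta> > 0\<close>, the same for all \<open>\<gamma>\<close>, such that the
  distance of \<open>\<gamma> s\<close> and \<open>\<gamma> t\<close> in the manifold equals \<open>\<parallel>t - s\<parallel>\<close> if \<open>\<parallel>t - s\<parallel> < \<delta>\<close> and is at least
  \<open>\<delta>\<close> otherwise.

  Given \<open>\<delta>\<close>, the theorem is combinatorial (\<open>nearest_neighbour_values_bound\<close>). Points whose
  nearest neighbour is at distance at least \<open>\<delta>\<close> are \<open>\<delta>\<close>-separated along the circle, so there are
  at most \<open>L / \<delta> + 1\<close> of them. All other nearest neighbour distances are nearest neighbour
  distances of the arithmetic progression \<open>i T\<close> on a circle, and by a three-distance argument
  (\<open>record_values_bound\<close>) these take at most three values.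

  The number \<open>\<delta>\<close> comes from two compactness arguments. First, geodesics minimize length on a
  scale \<open>e\<close> that does not depend on the geodesic (\<open>unit_geodesic_minimizing_uniform\<close>). The local
  statement \<open>short_geodesic_minimizes_length\<close> is proved in a chart: there the second variation
  of the energy is positive, by the Poincare inequality on a short interval. Second, pairs of
  points of a geodesic that are at least \<open>e / 2\<close> apart along it have distance at least some \<open>d >
  0\<close> (\<open>simple_geodesics_uniformly_separated\<close>). Otherwise there are geodesics almost returning to
  their starting point. By Tychonoff's theorem they accumulate pointwise at some curve, which is
  again a geodesic (\<open>unit_geodesic_pointwise_limit\<close>) and which does return before time \<open>L\<close>,
  contradicting simplicity.
\<close>

section \<open>Smooth functions and multilinear forms\<close>

lemma smooth_on_differentiable:
  "smooth_on S f \<Longrightarrow> x \<in> S \<Longrightarrow> f differentiable (at x)"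
  unfolding smooth_on_def by (metis Ck_on.simps(2))

lemma smooth_on_continuous_on: "smooth_on S f \<Longrightarrow> continuous_on S f"
  unfolding smooth_on_def by (metis Ck_on.simps(1))

lemma smooth_on_directional:
  "smooth_on S f \<Longrightarrow> smooth_on S (\<lambda>x. frechet_derivative f (at x) v)"
  unfolding smooth_on_def by (metis Ck_on.simps(2))

lemma continuous_on_compact_upper_bound:
  fixes f :: "'a::topological_space \<Rightarrow> real"
  assumes "continuous_on K f" "compact K"
  shows "\<exists>B>0. \<forall>x\<in>K. f x \<le> B"
proof -
  have "bounded (f ` K)" using assms by (intro compact_imp_bounded compact_continuous_image)
  then obtain B where "B > 0" "\<And>y. y \<in> f ` K \<Longrightarrow> norm y \<le> B" unfolding bounded_pos by blast
  then show ?thesis by (intro exI[of _ B]) force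
qed

lemma abs_linear_le:
  fixes f :: "'e::euclidean_space \<Rightarrow> real"
  assumes "linear f"
  shows "\<bar>f u\<bar> \<le> (\<Sum>i\<in>Basis. \<bar>f i\<bar>) * norm u"
proof -
  have "f u = f (\<Sum>i\<in>Basis. (u \<bullet> i) *\<^sub>R i)" by (simp add: euclidean_representation)
  also have "\<dots> = (\<Sum>i\<in>Basis. (u \<bullet> i) * f i)"
    using assms by (simp add: linear_sum linear_cmul)
  finally have "\<bar>f u\<bar> \<le> \<bar>\<Sum>i\<in>Basis. (u \<bullet> i) * f i\<bar>" by simp
  also have "\<dots> \<le> (\<Sum>i\<in>Basis. norm u * \<bar>f i\<bar>)"
    by (rule order_trans[OF sum_abs sum_mono])
      (simp add: abs_mult Basis_le_norm mult_right_mono)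
  finally show ?thesis by (simp add: sum_distrib_left mult.commute)
qed

lemma abs_bilinear_le:
  fixes T :: "'e::euclidean_space \<Rightarrow> 'e \<Rightarrow> real"
  assumes "bilinear T"
  shows "\<bar>T v w\<bar> \<le> (\<Sum>i\<in>Basis. \<Sum>j\<in>Basis. \<bar>T i j\<bar>) * norm v * norm w"
proof -
  have "\<bar>T v w\<bar> \<le> (\<Sum>i\<in>Basis. \<bar>T i w\<bar>) * norm v"
    using assms abs_linear_le[of "\<lambda>v. T v w" v] by (simp add: bilinear_def)
  also have "\<dots> \<le> (\<Sum>i\<in>Basis. (\<Sum>j\<in>Basis. \<bar>T i j\<bar>) * norm w) * norm v"
    using assms abs_linear_le[of "T _" w] by (intro mult_right_mono sum_mono) (auto simp: bilinear_def)
  finally show ?thesis by (simp only: sum_distrib_right[symmetric]) (simp only: mult_ac)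
qed

lemma abs_trilinear_le:
  fixes T :: "'e::euclidean_space \<Rightarrow> 'e \<Rightarrow> 'e \<Rightarrow> real"
  assumes "\<And>v w. linear (\<lambda>u. T u v w)" "\<And>u. bilinear (T u)"
  shows "\<bar>T u v w\<bar> \<le> (\<Sum>k\<in>Basis. \<Sum>i\<in>Basis. \<Sum>j\<in>Basis. \<bar>T k i j\<bar>) * norm u * norm v * norm w"
proof -
  have "\<bar>T u v w\<bar> \<le> (\<Sum>k\<in>Basis. \<bar>T k v w\<bar>) * norm u"
    using assms abs_linear_le[of "\<lambda>u. T u v w" u] by simp
  also have "\<dots> \<le> (\<Sum>k\<in>Basis. (\<Sum>i\<in>Basis. \<Sum>j\<in>Basis. \<bar>T k i j\<bar>) * norm v * norm w) * norm u"
    by (intro mult_right_mono sum_mono abs_bilinear_le assms) auto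
  finally show ?thesis by (simp only: sum_distrib_right[symmetric]) (simp only: mult_ac)
qed

lemma smooth_on_lipschitz_on_compact:
  fixes f :: "'e::euclidean_space \<Rightarrow> real"
  assumes f: "smooth_on U f" and K: "compact K" "convex K" "K \<subseteq> U"
  shows "\<exists>B\<ge>0. \<forall>x\<in>K. \<forall>y\<in>K. \<bar>f x - f y\<bar> \<le> B * norm (x - y)"
proof -
  let ?D = "\<lambda>x. frechet_derivative f (at x)"
  have "continuous_on K (\<lambda>x. \<Sum>i\<in>Basis. \<bar>?D x i\<bar>)"
    by (intro continuous_intros continuous_on_subset[OF smooth_on_continuous_on K(3)]
        smooth_on_directional f)
  then obtain B where B: "B > 0" "\<And>x. x \<in> K \<Longrightarrow> (\<Sum>i\<in>Basis. \<bar>?D x i\<bar>) \<le> B"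
    using continuous_on_compact_upper_bound[OF _ K(1)] by blast
  have der: "(f has_derivative ?D x) (at x)" if "x \<in> K" for x
    using smooth_on_differentiable[OF f] that K(3) frechet_derivative_works by blast
  have "norm (f x - f y) \<le> B * norm (x - y)" if xy: "x \<in> K" "y \<in> K" for x y
  proof (rule differentiable_bound[OF K(2) _ _ xy])
    fix z assume z: "z \<in> K"
    show "(f has_derivative ?D z) (at z within K)"
      using der[OF z] by (rule has_derivative_at_withinI)
    show "onorm (?D z) \<le> B"
    proof (rule onorm_le)
      fix u
      have "\<bar>?D z u\<bar> \<le> (\<Sum>i\<in>Basis. \<bar>?D z i\<bar>) * norm u"
        using der[OF z] by (intro abs_linear_le) (rule has_derivative_linear)
      also have "\<dots> \<le> B * norm u" using B(2)[OF z] by (intro mult_right_mono) auto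
      finally show "norm (?D z u) \<le> B * norm u" by simp
    qed
  qed
  then show ?thesis using B(1) by (intro exI[of _ B]) auto
qed

section \<open>Riemannian metrics on a coordinate domain\<close>

locale coordinate_metric =
  fixes U :: "'e::euclidean_space set" and g :: "'e \<Rightarrow> 'e \<Rightarrow> 'e \<Rightarrow> real"
  assumes open_domain: "open U"
    and g_bilinear: "x \<in> U \<Longrightarrow> bilinear (g x)"
    and g_sym: "x \<in> U \<Longrightarrow> g x v w = g x w v"
    and g_pos: "x \<in> U \<Longrightarrow> v \<noteq> 0 \<Longrightarrow> 0 < g x v v"
    and g_smooth: "smooth_on U (\<lambda>x. g x v w)"
begin

definition dg :: "'e \<Rightarrow> 'e \<Rightarrow> 'e \<Rightarrow> 'e \<Rightarrow> real" where
  "dg x u v w = frechet_derivative (\<lambda>y. g y v w) (at x) u"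

lemma g_has_derivative: "x \<in> U \<Longrightarrow> ((\<lambda>y. g y v w) has_derivative (\<lambda>u. dg x u v w)) (at x)"
  unfolding dg_def using smooth_on_differentiable[OF g_smooth] frechet_derivative_works by blast

lemma dg_eqI:
  assumes "x \<in> U" "\<And>y. y \<in> U \<Longrightarrow> f y = g y v w" "(f has_derivative D) (at x)"
  shows "dg x u v w = D u"
proof -
  have "((\<lambda>y. g y v w) has_derivative D) (at x)"
    by (rule has_derivative_transform_within_open[OF assms(3) open_domain assms(1,2)])
  then show ?thesis using has_derivative_unique[OF g_has_derivative[OF assms(1)]] by metis
qed

lemma dg_sym: "x \<in> U \<Longrightarrow> dg x u v w = dg x u w v"
  by (rule dg_eqI[OF _ _ g_has_derivative]) (auto simp: g_sym)

lemma dg_linear: "x \<in> U \<Longrightarrow> linear (\<lambda>u. dg x u v w)"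
  using g_has_derivative has_derivative_linear by blast

lemma dg_bilinear:
  assumes x: "x \<in> U"
  shows "bilinear (dg x u)"
proof -
  have add: "dg x u (v + v') w = dg x u v w + dg x u v' w" for v v' w
    by (rule dg_eqI[OF x _ has_derivative_add[OF g_has_derivative[OF x] g_has_derivative[OF x]]])
      (simp add: bilinear_ladd[OF g_bilinear])
  have scale: "dg x u (a *\<^sub>R v) w = a * dg x u v w" for a v w
    by (rule dg_eqI[OF x _ has_derivative_mult_right[OF g_has_derivative[OF x]]])
      (simp add: bilinear_lmul[OF g_bilinear])
  have left: "linear (\<lambda>v. dg x u v w)" for w
    using add scale by (auto intro: linearI)
  have "linear (dg x u v)" for v
    using left[of v] by (simp add: dg_sym[OF x, of u _ v])
  then show ?thesis unfolding bilinear_def using left by blast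
qed

lemma dg_smooth: "smooth_on U (\<lambda>x. dg x u v w)"
  unfolding dg_def by (rule smooth_on_directional[OF g_smooth])

text \<open>
  Reduces joint continuity and differentiability in the point and the vectors to the metric
  coefficients, which is all that smoothness of the metric speaks about.
\<close>

lemma g_expand: "x \<in> U \<Longrightarrow> g x v w = (\<Sum>i\<in>Basis. \<Sum>j\<in>Basis. (v \<bullet> i) * (w \<bullet> j) * g x i j)"
proof -
  assume x: "x \<in> U"
  have "g x v w = g x (\<Sum>i\<in>Basis. (v \<bullet> i) *\<^sub>R i) (\<Sum>j\<in>Basis. (w \<bullet> j) *\<^sub>R j)"
    by (simp add: euclidean_representation)
  also have "\<dots> = (\<Sum>(i,j)\<in>Basis\<times>Basis. (v \<bullet> i) * (w \<bullet> j) * g x i j)"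
    by (simp add: bilinear_sum[OF g_bilinear[OF x]] bilinear_lmul[OF g_bilinear[OF x]]
        bilinear_rmul[OF g_bilinear[OF x]] algebra_simps)
  finally show ?thesis by (simp add: sum.cartesian_product)
qed

lemma continuous_on_g:
  "continuous_on (U \<times> UNIV) (\<lambda>(x, v, w). g x v w)"
proof -
  have "continuous_on (U \<times> (UNIV::('e\<times>'e) set)) (\<lambda>p. \<Sum>i\<in>Basis. \<Sum>j\<in>Basis. (fst (snd p) \<bullet> i) * (snd (snd p) \<bullet> j) * g (fst p) i j)"
    by (intro continuous_intros continuous_on_compose2[OF smooth_on_continuous_on[OF g_smooth]]) auto
  then show ?thesis
    by (rule continuous_on_eq) (auto simp: g_expand[symmetric])
qed

lemma continuous_on_g_compose:
  assumes "continuous_on S f" "f ` S \<subseteq> U" "continuous_on S v" "continuous_on S w"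
  shows "continuous_on S (\<lambda>s. g (f s) (v s) (w s))"
proof -
  have "continuous_on S (\<lambda>s. (f s, v s, w s))" using assms by (intro continuous_on_Pair)
  then show ?thesis
    using continuous_on_compose2[OF continuous_on_g, of S "\<lambda>s. (f s, v s, w s)"] assms(2) by auto
qed

lemma g_coercive:
  assumes K: "compact K" "K \<subseteq> U"
  shows "\<exists>c>0. \<forall>x\<in>K. \<forall>v. c * (norm v)\<^sup>2 \<le> g x v v"
proof (cases "K = {}")
  case False
  let ?S = "K \<times> sphere (0::'e) 1"
  have "continuous_on ?S (\<lambda>p. g (fst p) (snd p) (snd p))"
    using K by (intro continuous_on_g_compose continuous_intros) auto
  moreover have "?S \<noteq> {}" using False by (auto intro: vector_choose_size[of 1])
  moreover have "compact ?S" using K by (intro compact_Times) auto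
  ultimately obtain p where p: "p \<in> ?S"
    "\<forall>q\<in>?S. g (fst p) (snd p) (snd p) \<le> g (fst q) (snd q) (snd q)"
    using continuous_attains_inf by blast
  let ?c = "g (fst p) (snd p) (snd p)"
  have "?c > 0" using p(1) K by (intro g_pos) auto
  moreover have "?c * (norm v)\<^sup>2 \<le> g x v v" if x: "x \<in> K" for x v
  proof (cases "v = 0")
    case True
    then show ?thesis using bilinear_lzero[OF g_bilinear] x K by auto
  next
    case False
    define e where "e = v /\<^sub>R norm v"
    have "v = norm v *\<^sub>R e" using False by (simp add: e_def)
    then have "g x v v = g x (norm v *\<^sub>R e) (norm v *\<^sub>R e)" by simp
    also have "\<dots> = (norm v)\<^sup>2 * g x e e"
      using bilinear_lmul[OF g_bilinear] bilinear_rmul[OF g_bilinear] x K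
      by (simp add: power2_eq_square subset_iff)
    finally show ?thesis using bspec[OF p(2), of "(x, e)"] x False
      by (simp add: e_def mult.commute mult_left_mono)
  qed
  ultimately show ?thesis by blast
qed (auto intro: exI[of _ 1])

lemma dg_lipschitz:
  assumes K: "compact K" "convex K" "K \<subseteq> U"
  shows "\<exists>B\<ge>0. \<forall>x\<in>K. \<forall>y\<in>K. \<forall>u v w.
    \<bar>dg x u v w - dg y u v w\<bar> \<le> B * norm (x - y) * norm u * norm v * norm w"
proof -
  have "\<forall>u v w. \<exists>B\<ge>0. \<forall>x\<in>K. \<forall>y\<in>K. \<bar>dg x u v w - dg y u v w\<bar> \<le> B * norm (x - y)"
    using smooth_on_lipschitz_on_compact[OF dg_smooth K] by blast
  then obtain B where B: "\<And>u v w. 0 \<le> B u v w"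
    "\<And>u v w x y. x \<in> K \<Longrightarrow> y \<in> K \<Longrightarrow> \<bar>dg x u v w - dg y u v w\<bar> \<le> B u v w * norm (x - y)"
    by metis
  let ?B = "\<Sum>k\<in>Basis. \<Sum>i\<in>Basis. \<Sum>j\<in>Basis. B k i j"
  have "\<bar>dg x u v w - dg y u v w\<bar> \<le> ?B * norm (x - y) * norm u * norm v * norm w"
    if xy: "x \<in> K" "y \<in> K" for x y u v w
  proof -
    have U: "x \<in> U" "y \<in> U" using xy K by auto
    have "\<bar>dg x u v w - dg y u v w\<bar> \<le> (\<Sum>k\<in>Basis. \<Sum>i\<in>Basis. \<Sum>j\<in>Basis. \<bar>dg x k i j - dg y k i j\<bar>)
        * norm u * norm v * norm w"
      using dg_linear[OF U(1)] dg_linear[OF U(2)] dg_bilinear[OF U(1)] dg_bilinear[OF U(2)]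
      by (intro abs_trilinear_le) (auto simp: bilinear_def intro!: linear_compose_sub)
    also have "\<dots> \<le> (\<Sum>k\<in>Basis. \<Sum>i\<in>Basis. \<Sum>j\<in>Basis. B k i j * norm (x - y)) * norm u * norm v * norm w"
      by (intro mult_right_mono sum_mono B xy) auto
    finally show ?thesis by (simp add: sum_distrib_right)
  qed
  moreover have "?B \<ge> 0" by (intro sum_nonneg B)
  ultimately show ?thesis by blast
qed

lemma dg_bounded:
  assumes K: "compact K" "K \<subseteq> U"
  shows "\<exists>B\<ge>0. \<forall>x\<in>K. \<forall>u v w. \<bar>dg x u v w\<bar> \<le> B * norm u * norm v * norm w"
proof -
  let ?f = "\<lambda>x. \<Sum>k\<in>Basis. \<Sum>i\<in>Basis. \<Sum>j\<in>Basis. \<bar>dg x k i j\<bar>"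
  have "continuous_on K ?f"
    by (intro continuous_intros continuous_on_subset[OF smooth_on_continuous_on[OF dg_smooth] K(2)])
  then obtain B where B: "B > 0" "\<And>x. x \<in> K \<Longrightarrow> ?f x \<le> B"
    using continuous_on_compact_upper_bound[OF _ K(1)] by blast
  have "\<bar>dg x u v w\<bar> \<le> B * norm u * norm v * norm w" if "x \<in> K" for x u v w
  proof -
    have "x \<in> U" using that K by auto
    then have "\<bar>dg x u v w\<bar> \<le> ?f x * norm u * norm v * norm w"
      by (intro abs_trilinear_le dg_linear dg_bilinear)
    also have "\<dots> \<le> B * norm u * norm v * norm w"
      using B(2)[OF that] by (intro mult_right_mono) auto
    finally show ?thesis .
  qed
  then show ?thesis using B(1) by (intro exI[of _ B]) auto
qed

text \<open>
  Uniform ellipticity of the metric on a convex set, together with bounds for its first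
  derivatives and a Lipschitz constant for them. The estimates below depend on the metric only
  through \<open>c\<close> and \<open>C\<close>, hence are uniform over all geodesics in the set.
\<close>

definition controlled :: "'e set \<Rightarrow> real \<Rightarrow> real \<Rightarrow> bool" where
  "controlled K c C \<longleftrightarrow> K \<subseteq> U \<and> convex K \<and> 0 < c \<and> 0 \<le> C \<and>
     (\<forall>x\<in>K. \<forall>v. c * (norm v)\<^sup>2 \<le> g x v v) \<and>
     (\<forall>x\<in>K. \<forall>u v w. \<bar>dg x u v w\<bar> \<le> C * norm u * norm v * norm w) \<and>
     (\<forall>x\<in>K. \<forall>y\<in>K. \<forall>u v w.
        \<bar>dg x u v w - dg y u v w\<bar> \<le> C * norm (x - y) * norm u * norm v * norm w)"

lemma controlled_exists:
  assumes K: "compact K" "convex K" "K \<subseteq> U"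
  shows "\<exists>c C. controlled K c C"
proof -
  obtain c where c: "c > 0" "\<forall>x\<in>K. \<forall>v. c * (norm v)\<^sup>2 \<le> g x v v"
    using g_coercive[OF K(1,3)] by blast
  obtain B1 where B1: "B1 \<ge> 0" "\<forall>x\<in>K. \<forall>u v w. \<bar>dg x u v w\<bar> \<le> B1 * norm u * norm v * norm w"
    using dg_bounded[OF K(1,3)] by blast
  obtain B2 where B2: "B2 \<ge> 0" "\<forall>x\<in>K. \<forall>y\<in>K. \<forall>u v w.
    \<bar>dg x u v w - dg y u v w\<bar> \<le> B2 * norm (x - y) * norm u * norm v * norm w"
    using dg_lipschitz[OF K] by blast
  let ?C = "max B1 B2"
  have le: "B * norm u * norm v * norm w \<le> ?C * norm u * norm v * norm w" if "B \<le> ?C" for B u v w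
    using that by (intro mult_right_mono) auto
  have le': "B2 * norm z * norm u * norm v * norm w \<le> ?C * norm z * norm u * norm v * norm w" for z u v w :: 'e
    by (intro mult_right_mono) auto
  have "controlled K c ?C"
    unfolding controlled_def
  proof (intro conjI ballI allI)
    show "\<bar>dg x u v w\<bar> \<le> ?C * norm u * norm v * norm w" if "x \<in> K" for x u v w
      using B1(2) that le[of B1 u v w] by (meson max.cobounded1 order_trans)
    show "\<bar>dg x u v w - dg y u v w\<bar> \<le> ?C * norm (x - y) * norm u * norm v * norm w"
      if "x \<in> K" "y \<in> K" for x y u v w
      using B2(2) that le'[of "x - y" u v w] by (meson order_trans)
  qed (use K c B1(1) in auto)
  then show ?thesis by blast
qed

end

text \<open>
  The form in which piecewise continuously differentiable curves are handled: finitely many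
  parameters without derivative do no harm.
\<close>

lemma nonneg_derivative_imp_le:
  fixes f :: "real \<Rightarrow> real"
  assumes "a \<le> b" "finite F" "continuous_on {a..b} f"
    and der: "\<And>t. t \<in> {a<..<b} - F \<Longrightarrow> \<exists>d\<ge>0. (f has_real_derivative d) (at t)"
  shows "f a \<le> f b"
proof -
  obtain f' where f': "\<And>t. t \<in> {a<..<b} - F \<Longrightarrow> f' t \<ge> 0 \<and> (f has_real_derivative f' t) (at t)"
    using der by metis
  define d where "d t = (if t \<in> {a<..<b} - F then f' t else 0)" for t
  have "(d has_integral (f b - f a)) {a..b}"
    using f' assms(1-3)
    by (intro fundamental_theorem_of_calculus_interior_strong)
      (auto simp: d_def has_real_derivative_iff_has_vector_derivative)
  moreover have "d t \<ge> 0" for t using f' by (auto simp: d_def)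
  ultimately have "f b - f a \<ge> 0" using has_integral_nonneg by blast
  then show ?thesis by simp
qed

context coordinate_metric
begin

lemmas g_simps =
  bilinear_ladd[OF g_bilinear] bilinear_radd[OF g_bilinear]
  bilinear_lsub[OF g_bilinear] bilinear_rsub[OF g_bilinear]
  bilinear_lmul[OF g_bilinear] bilinear_rmul[OF g_bilinear]
  bilinear_lzero[OF g_bilinear] bilinear_rzero[OF g_bilinear]

lemmas dg_simps =
  bilinear_ladd[OF dg_bilinear] bilinear_radd[OF dg_bilinear]
  bilinear_lsub[OF dg_bilinear] bilinear_rsub[OF dg_bilinear]
  bilinear_lmul[OF dg_bilinear] bilinear_rmul[OF dg_bilinear]
  linear_add[OF dg_linear] linear_diff[OF dg_linear] linear_cmul[OF dg_linear]

lemma dg_expand: "x \<in> U \<Longrightarrow> dg x u v w = (\<Sum>i\<in>Basis. \<Sum>j\<in>Basis. (v \<bullet> i) * (w \<bullet> j) * dg x u i j)"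
proof -
  assume x: "x \<in> U"
  have "dg x u v w = dg x u (\<Sum>i\<in>Basis. (v \<bullet> i) *\<^sub>R i) (\<Sum>j\<in>Basis. (w \<bullet> j) *\<^sub>R j)"
    by (simp add: euclidean_representation)
  also have "\<dots> = (\<Sum>(i,j)\<in>Basis\<times>Basis. (v \<bullet> i) * (w \<bullet> j) * dg x u i j)"
    by (simp add: bilinear_sum[OF dg_bilinear[OF x]] bilinear_lmul[OF dg_bilinear[OF x]]
        bilinear_rmul[OF dg_bilinear[OF x]] algebra_simps)
  finally show ?thesis by (simp add: sum.cartesian_product)
qed

lemma g_along_curve_derivative:
  assumes y: "(y has_vector_derivative y') (at t)" "y t \<in> U"
    and V: "(V has_vector_derivative V') (at t)" and W: "(W has_vector_derivative W') (at t)"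
  shows "((\<lambda>t. g (y t) (V t) (W t)) has_real_derivative
    dg (y t) y' (V t) (W t) + g (y t) V' (W t) + g (y t) (V t) W') (at t)"
proof -
  obtain T where T: "open T" "t \<in> T" "y ` T \<subseteq> U"
  proof -
    have "isCont y t" using y(1) has_vector_derivative_continuous by blast
    then have "\<forall>\<^sub>F s in at t. y s \<in> U" using y(2) open_domain
      by (metis isCont_def topological_tendstoD)
    then obtain T where "open T" "t \<in> T" "\<forall>s\<in>T. s \<noteq> t \<longrightarrow> y s \<in> U"
      unfolding eventually_at_topological by blast
    moreover from this y(2) have "y ` T \<subseteq> U" by (metis image_subsetI)
    ultimately show ?thesis using that by blast
  qed
  have gd: "((\<lambda>s. g (y s) i j) has_real_derivative dg (y t) y' i j) (at t)" for i j
  proof -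
    have "((\<lambda>s. g (y s) i j) has_derivative (\<lambda>a. dg (y t) (a *\<^sub>R y') i j)) (at t)"
      using has_derivative_compose[OF y(1)[unfolded has_vector_derivative_def] g_has_derivative[OF y(2)]] .
    then show ?thesis
      unfolding has_field_derivative_def
      by (rule has_derivative_eq_rhs) (simp add: fun_eq_iff linear_cmul[OF dg_linear[OF y(2)]])
  qed
  have inner: "((\<lambda>s. V s \<bullet> i) has_real_derivative (V' \<bullet> i)) (at t)" "((\<lambda>s. W s \<bullet> i) has_real_derivative (W' \<bullet> i)) (at t)" for i
    using V W unfolding has_real_derivative_iff_has_vector_derivative
    by (auto intro!: bounded_linear.has_vector_derivative[OF bounded_linear_inner_left])
  have "((\<lambda>s. \<Sum>i\<in>Basis. \<Sum>j\<in>Basis. (V s \<bullet> i) * (W s \<bullet> j) * g (y s) i j) has_real_derivative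
     (\<Sum>i\<in>Basis. \<Sum>j\<in>Basis. (V t \<bullet> i) * (W t \<bullet> j) * dg (y t) y' i j + (V' \<bullet> i) * (W t \<bullet> j) * g (y t) i j
       + (V t \<bullet> i) * (W' \<bullet> j) * g (y t) i j)) (at t)"
    by (rule DERIV_sum, rule DERIV_sum)
      (rule derivative_eq_intros gd inner refl | simp add: algebra_simps)+
  also have "(\<Sum>i\<in>Basis. \<Sum>j\<in>Basis. (V t \<bullet> i) * (W t \<bullet> j) * dg (y t) y' i j + (V' \<bullet> i) * (W t \<bullet> j) * g (y t) i j
       + (V t \<bullet> i) * (W' \<bullet> j) * g (y t) i j)
    = dg (y t) y' (V t) (W t) + g (y t) V' (W t) + g (y t) (V t) W'"
    by (simp add: sum.distrib dg_expand[OF y(2), of y' "V t" "W t"]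
      g_expand[OF y(2), of V'] g_expand[OF y(2), of "V t" W'])
  finally show ?thesis
    by (rule has_field_derivative_transform_within_open[OF _ T(1,2)])
      (use T(3) g_expand in auto)
qed

lemma controlledD:
  assumes "controlled K c C"
  shows "K \<subseteq> U" "convex K" "0 < c" "0 \<le> C"
    and "\<And>x v. x \<in> K \<Longrightarrow> c * (norm v)\<^sup>2 \<le> g x v v"
    and "\<And>x u v w. x \<in> K \<Longrightarrow> \<bar>dg x u v w\<bar> \<le> C * norm u * norm v * norm w"
    and "\<And>x y u v w. x \<in> K \<Longrightarrow> y \<in> K \<Longrightarrow>
      \<bar>dg x u v w - dg y u v w\<bar> \<le> C * norm (x - y) * norm u * norm v * norm w"
  using assms unfolding controlled_def by blast+

lemma controlled_norm_le:
  assumes "controlled K c C" "x \<in> K"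
  shows "sqrt c * norm v \<le> sqrt (g x v v)"
proof -
  have "sqrt (c * (norm v)\<^sup>2) \<le> sqrt (g x v v)"
    using controlledD(5)[OF assms] by simp
  then show ?thesis by (simp add: real_sqrt_mult)
qed

lemma controlled_g_lipschitz:
  assumes ctl: "controlled K c C" and xy: "x \<in> K" "y \<in> K"
  shows "\<bar>g x v w - g y v w\<bar> \<le> C * norm (x - y) * norm v * norm w"
proof -
  have K: "convex K" "K \<subseteq> U" using controlledD[OF ctl] by blast+
  have "norm (g x v w - g y v w) \<le> (C * norm v * norm w) * norm (x - y)"
  proof (rule differentiable_bound[where f = "\<lambda>x. g x v w" and f' = "\<lambda>z u. dg z u v w", OF K(1) _ _ xy])
    fix z assume z: "z \<in> K"
    show "((\<lambda>x. g x v w) has_derivative (\<lambda>u. dg z u v w)) (at z within K)"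
      using z K(2) by (auto intro!: has_derivative_at_withinI[OF g_has_derivative])
    show "onorm (\<lambda>u. dg z u v w) \<le> C * norm v * norm w"
      using controlledD(6)[OF ctl z] by (intro onorm_le) (simp add: mult_ac)
  qed
  then show ?thesis by (simp add: mult_ac)
qed

lemma controlled_g_taylor:
  assumes ctl: "controlled K c C" and xy: "x \<in> K" "x + z \<in> K"
  shows "g x v v + dg x z v v - C * (norm z)\<^sup>2 * (norm v)\<^sup>2 \<le> g (x + z) v v"
proof -
  have K: "convex K" "K \<subseteq> U" and C: "C \<ge> 0" using controlledD[OF ctl] by blast+
  let ?S = "closed_segment x (x + z)"
  have S: "?S \<subseteq> K" using K xy by (simp add: closed_segment_subset)
  have "norm (g (x + z) v v - g x v v - dg x (x + z - x) v v) \<le> norm (x + z - x) * (C * norm z * norm v * norm v)"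
  proof (rule differentiable_bound_linearization[where S = ?S and f = "\<lambda>x. g x v v" and f' = "\<lambda>x u. dg x u v v"])
    show "x + t *\<^sub>R (x + z - x) \<in> ?S" if "t \<in> {0..1}" for t
      using that by (auto simp: closed_segment_def algebra_simps)
    show "((\<lambda>x. g x v v) has_derivative (\<lambda>u. dg y u v v)) (at y within ?S)" if "y \<in> ?S" for y
      using that S K(2) by (auto intro!: has_derivative_at_withinI[OF g_has_derivative])
    show "onorm ((\<lambda>u. dg y u v v) - (\<lambda>u. dg x u v v)) \<le> C * norm z * norm v * norm v" if y: "y \<in> ?S" for y
      unfolding fun_diff_def
    proof (rule onorm_le)
      fix u
      have "\<bar>dg y u v v - dg x u v v\<bar> \<le> C * norm (y - x) * norm u * norm v * norm v"
        using controlledD(7)[OF ctl] y S xy(1) by blast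
      also have "norm (y - x) \<le> norm z"
        using segment_bound1[OF y] by simp
      then have "C * norm (y - x) * norm u * norm v * norm v \<le> C * norm z * norm u * norm v * norm v"
        using C by (intro mult_right_mono mult_left_mono) auto
      finally show "norm (dg y u v v - dg x u v v) \<le> C * norm z * norm v * norm v * norm u"
        by (simp add: mult_ac)
    qed
  qed auto
  then show ?thesis by (simp add: power2_eq_square mult_ac abs_le_iff)
qed

section \<open>Short geodesics minimize length\<close>

text \<open>
  The coordinate acceleration of a geodesic through \<open>x\<close> with velocity \<open>v\<close>, that is minus the
  Christoffel term. It is defined by the Euler-Lagrange equation \<open>d/dt g(v, u) = dg(u)(v, v) /
  2\<close> of the energy, tested with constant \<open>u\<close>.
\<close>

definition acc :: "'e \<Rightarrow> 'e \<Rightarrow> 'e" where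
  "acc x v = (THE z. \<forall>u. g x z u = dg x u v v / 2 - dg x v v u)"

lemma riesz:
  assumes x: "x \<in> U" and f: "linear f"
  shows "\<exists>!z. \<forall>u. g x z u = f u"
proof -
  have lin: "linear (\<lambda>z. g x z u)" "linear (g x u)" for u
    using g_bilinear[OF x] by (auto simp: bilinear_def)
  let ?m = "\<lambda>z. \<Sum>i\<in>Basis. g x z i *\<^sub>R i"
  have m: "linear ?m"
    by (rule linearI) (simp_all add: g_simps x scaleR_add_left sum.distrib scaleR_sum_right)
  have eq: "z = z'" if "\<And>u. g x z u = g x z' u" for z z'
  proof (rule ccontr)
    assume "z \<noteq> z'"
    then have "g x (z - z') (z - z') > 0" using g_pos[OF x] by simp
    then show False using that by (simp add: bilinear_lsub[OF g_bilinear[OF x]])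
  qed
  have ext: "g x z u = f u" if "\<And>i. i \<in> Basis \<Longrightarrow> g x z i = f i" for z u
    using linear_eq_stdbasis[OF lin(2) f] that by metis
  have "inj ?m"
  proof (rule injI)
    fix z z' assume "?m z = ?m z'"
    then have "g x z i = g x z' i" if "i \<in> Basis" for i
      using that inner_sum_left_Basis by metis
    then have "g x z = g x z'" using linear_eq_stdbasis[OF lin(2) lin(2)] by blast
    then show "z = z'" using eq by simp
  qed
  then have "surj ?m" using m linear_injective_imp_surjective by blast
  then obtain z where z: "(\<Sum>i\<in>Basis. f i *\<^sub>R i) = ?m z" by (rule surjE)
  have "g x z i = f i" if "i \<in> Basis" for i
    using arg_cong[OF z, of "\<lambda>w. w \<bullet> i"] that by simp
  then have "\<forall>u. g x z u = f u" using ext by blast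
  then show ?thesis using eq by metis
qed

lemma acc_functional_linear: "x \<in> U \<Longrightarrow> linear (\<lambda>u. dg x u v v / 2 - dg x v v u)"
  using dg_linear[of x v v] dg_bilinear[of x v]
  by (auto simp: bilinear_def linear_iff field_simps)

lemma g_acc: "x \<in> U \<Longrightarrow> g x (acc x v) u = dg x u v v / 2 - dg x v v u"
  using theI'[OF riesz[OF _ acc_functional_linear[of x v]], of x] unfolding acc_def by blast

lemma acc_unique: "x \<in> U \<Longrightarrow> (\<And>u. g x z u = dg x u v v / 2 - dg x v v u) \<Longrightarrow> acc x v = z"
  using riesz[OF _ acc_functional_linear[of x v], of x] g_acc by metis

lemma acc_scale: "x \<in> U \<Longrightarrow> acc x (a *\<^sub>R v) = a\<^sup>2 *\<^sub>R acc x v"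
  by (rule acc_unique)
    (auto simp: g_simps dg_simps g_acc power2_eq_square algebra_simps)

text \<open>Test the defining equation of \<open>acc x v\<close> with \<open>acc x v\<close> itself and use coercivity.\<close>

lemma acc_bound:
  assumes ctl: "controlled K c C" and x: "x \<in> K"
  shows "norm (acc x v) \<le> 3 * C / (2 * c) * (norm v)\<^sup>2"
proof (cases "acc x v = 0")
  case False
  let ?a = "acc x v"
  have c: "c > 0" and xU: "x \<in> U" using controlledD[OF ctl] x by blast+
  have "c * (norm ?a)\<^sup>2 \<le> g x ?a ?a" by (rule controlledD(5)[OF ctl x])
  also have "\<dots> = dg x ?a v v / 2 - dg x v v ?a" by (rule g_acc[OF xU])
  also have "\<dots> \<le> (C * norm ?a * norm v * norm v) / 2 + C * norm v * norm v * norm ?a"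
  proof -
    have "\<bar>dg x ?a v v\<bar> \<le> C * norm ?a * norm v * norm v" "\<bar>dg x v v ?a\<bar> \<le> C * norm v * norm v * norm ?a"
      using controlledD(6)[OF ctl x] by blast+
    then show ?thesis by linarith
  qed
  finally have "norm ?a * (c * norm ?a) \<le> norm ?a * (3 * C / 2 * (norm v)\<^sup>2)"
    by (simp add: power2_eq_square algebra_simps)
  then have "c * norm ?a \<le> 3 * C / 2 * (norm v)\<^sup>2" using False by simp
  then show ?thesis using c by (simp add: field_simps)
qed (use controlledD(3,4)[OF ctl] in auto)

text \<open>
  Again coercivity, now applied to \<open>z = acc x v - acc y w\<close>: the defining equations express \<open>g x
  z z\<close> through differences of metric derivatives and of the metric, each of which is Lipschitz
  and carries a factor \<open>norm z\<close>.
\<close>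

lemma acc_lipschitz:
  assumes ctl: "controlled K c C"
  shows "\<exists>D\<ge>0. \<forall>x\<in>K. \<forall>y\<in>K. \<forall>v w. norm v \<le> M \<longrightarrow> norm w \<le> M \<longrightarrow>
    norm (acc x v - acc y w) \<le> D * (norm (x - y) + norm (v - w))"
proof (cases "M \<ge> 0")
  case M: True
  have c: "c > 0" and C: "C \<ge> 0" using controlledD[OF ctl] by blast+
  define B where "B = 3 * C / (2 * c) * M\<^sup>2"
  define D where "D = ((3/2) * (C * M * M + 2 * C * M) + C * B) / c"
  have B: "B \<ge> 0" using c C by (auto simp: B_def)
  have D: "D \<ge> 0" using c C B M by (auto simp: D_def)
  have "norm (acc x v - acc y w) \<le> D * (norm (x - y) + norm (v - w))"
    if xy: "x \<in> K" "y \<in> K" and vw: "norm v \<le> M" "norm w \<le> M" for x y v w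
  proof (cases "acc x v = acc y w")
    case False
    define z where "z = acc x v - acc y w"
    have U: "x \<in> U" "y \<in> U" using controlledD(1)[OF ctl] xy by blast+
    let ?n = "norm z" and ?p = "norm (x - y)" and ?q = "norm (v - w)"
    have dgb: "\<bar>dg p a b e\<bar> \<le> C * norm a * norm b * norm e" if "p \<in> K" for p a b e
      using controlledD(6)[OF ctl that] by blast
    have dgl: "\<bar>dg x a b e - dg y a b e\<bar> \<le> C * ?p * norm a * norm b * norm e" for a b e
      using controlledD(7)[OF ctl xy] by blast
    have nB: "norm (acc y w) \<le> B"
    proof -
      have "norm (acc y w) \<le> 3 * C / (2 * c) * (norm w)\<^sup>2" by (rule acc_bound[OF ctl xy(2)])
      also have "\<dots> \<le> B" unfolding B_def using vw c C by (intro mult_left_mono power_mono) auto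
      finally show ?thesis .
    qed
    have m: "C * t * a * b * e \<le> C * t * M * M * e"
      if "0 \<le> t" "0 \<le> e" "0 \<le> a" "a \<le> M" "0 \<le> b" "b \<le> M" for t a b e
      using that C M by (intro mult_right_mono mult_mono mult_nonneg_nonneg order_refl) auto
    have m': "C * a * b * e \<le> C * a * M * e" if "0 \<le> a" "0 \<le> e" "b \<le> M" for a b e
      using that C M by (intro mult_right_mono mult_left_mono mult_nonneg_nonneg order_refl) auto
    have "dg x v v z - dg y w w z = (dg x v v z - dg y v v z) + dg y (v - w) v z + dg y w (v - w) z"
      using U by (simp add: dg_simps)
    moreover have "\<bar>dg x v v z - dg y v v z\<bar> \<le> C * ?p * M * M * ?n"
      using dgl[of v v z] m[of ?p ?n "norm v" "norm v"] vw by simp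
    moreover have "\<bar>dg y (v - w) v z\<bar> \<le> C * ?q * M * ?n"
      using dgb[OF xy(2), of "v - w" v z] m'[of ?q ?n "norm v"] vw by simp
    moreover have "\<bar>dg y w (v - w) z\<bar> \<le> C * ?q * M * ?n"
      using dgb[OF xy(2), of w "v - w" z] m'[of ?q ?n "norm w"] vw by (simp add: mult_ac)
    ultimately have 1: "\<bar>dg x v v z - dg y w w z\<bar> \<le> C * ?p * M * M * ?n + 2 * (C * ?q * M * ?n)"
      by linarith
    have "dg x z v v - dg y z w w = (dg x z v v - dg y z v v) + dg y z (v - w) v + dg y z w (v - w)"
      using U by (simp add: dg_simps)
    moreover have "\<bar>dg x z v v - dg y z v v\<bar> \<le> C * ?p * M * M * ?n"
      using dgl[of z v v] m[of ?p ?n "norm v" "norm v"] vw by (simp add: mult_ac)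
    moreover have "\<bar>dg y z (v - w) v\<bar> \<le> C * ?q * M * ?n"
      using dgb[OF xy(2), of z "v - w" v] m'[of ?q ?n "norm v"] vw by (simp add: mult_ac)
    moreover have "\<bar>dg y z w (v - w)\<bar> \<le> C * ?q * M * ?n"
      using dgb[OF xy(2), of z w "v - w"] m'[of ?q ?n "norm w"] vw by (simp add: mult_ac)
    ultimately have 2: "\<bar>dg x z v v - dg y z w w\<bar> \<le> C * ?p * M * M * ?n + 2 * (C * ?q * M * ?n)"
      by linarith
    have 3: "\<bar>g x (acc y w) z - g y (acc y w) z\<bar> \<le> C * ?p * B * ?n"
    proof -
      have "C * ?p * norm (acc y w) * ?n \<le> C * ?p * B * ?n"
        using nB C by (intro mult_right_mono mult_left_mono) auto
      then show ?thesis using controlled_g_lipschitz[OF ctl xy, of "acc y w" z] by linarith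
    qed
    have "g x z z = (dg x z v v - dg y z w w) / 2 - (dg x v v z - dg y w w z)
        - (g x (acc y w) z - g y (acc y w) z)"
      using U by (subst (1) z_def) (simp add: g_simps g_acc field_simps)
    moreover have "c * ?n\<^sup>2 \<le> g x z z" by (rule controlledD(5)[OF ctl xy(1)])
    moreover have "a1 / 2 - a2 - a3 \<le> (3/2) * (p + 2 * q) + r"
      if "\<bar>a1\<bar> \<le> p + 2 * q" "\<bar>a2\<bar> \<le> p + 2 * q" "\<bar>a3\<bar> \<le> r" for a1 a2 a3 p q r :: real
    proof -
      have "a1 \<le> p + 2 * q" "- a2 \<le> p + 2 * q" "- a3 \<le> r" using that by auto
      then show ?thesis by argo
    qed
    from this[OF 2 1 3] have "(dg x z v v - dg y z w w) / 2 - (dg x v v z - dg y w w z)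
        - (g x (acc y w) z - g y (acc y w) z)
      \<le> (3/2) * (C * ?p * M * M * ?n + 2 * (C * ?q * M * ?n)) + C * ?p * B * ?n" .
    ultimately have "c * ?n\<^sup>2 \<le> (3/2) * (C * ?p * M * M * ?n + 2 * (C * ?q * M * ?n)) + C * ?p * B * ?n"
      by linarith
    then have "?n * (c * ?n) \<le> ?n * ((3/2) * (C * ?p * M * M + 2 * (C * ?q * M)) + C * ?p * B)"
      by (simp add: power2_eq_square algebra_simps)
    then have "c * ?n \<le> (3/2) * (C * ?p * M * M + 2 * (C * ?q * M)) + C * ?p * B"
      using False by (simp add: z_def)
    also have "\<dots> \<le> (3/2) * (C * (?p + ?q) * M * M + 2 * (C * (?p + ?q) * M)) + C * (?p + ?q) * B"
      using C M B
      by (intro add_mono mult_left_mono mult_right_mono mult_nonneg_nonneg order_refl) auto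
    also have "\<dots> = c * (D * (?p + ?q))" using c by (simp add: D_def field_simps)
    finally show ?thesis using c by (simp add: z_def)
  qed (use D in auto)
  then show ?thesis using D by blast
qed (auto intro!: exI[of _ 0], smt (verit) norm_ge_zero)

text \<open>
  Second order expansion of the energy density of a competitor \<open>y + z\<close> of a geodesic \<open>y\<close>, where
  \<open>r *\<^sub>R V\<close> is the velocity of the (reparametrised) geodesic and \<open>w\<close> the derivative of \<open>z\<close>.
  Along the geodesic the two terms linear in \<open>z\<close> and \<open>w\<close> are \<open>2 * r\<close> times the derivative of \<open>g
  y V z\<close>. The quadratic remainder keeps half of the coercive term; the other half absorbs the
  mixed term \<open>norm z * norm w\<close>.
\<close>

lemma energy_density_bound:
  assumes ctl: "controlled K c C" and y: "y \<in> K" "y + z \<in> K" and V: "g y V V = 1"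
  shows "r\<^sup>2 + r\<^sup>2 * dg y z V V + 2 * r * g y V w + c / 2 * (norm w)\<^sup>2
      - (2 * C\<^sup>2 / c\<^sup>2 + C / c) * r\<^sup>2 * (norm z)\<^sup>2
    \<le> g (y + z) (r *\<^sub>R V + w) (r *\<^sub>R V + w)"
proof -
  have c: "c > 0" and C: "C \<ge> 0" and U: "y \<in> U" "y + z \<in> U" using controlledD[OF ctl] y by blast+
  have V2: "c * (norm V)\<^sup>2 \<le> 1" using controlledD(5)[OF ctl y(1), of V] V by simp
  have 1: "r\<^sup>2 * (1 + dg y z V V - C * (norm z)\<^sup>2 * (norm V)\<^sup>2) \<le> r\<^sup>2 * g (y + z) V V"
    using controlled_g_taylor[OF ctl y, of V] V by (intro mult_left_mono) auto
  have 2: "C * (norm z)\<^sup>2 * (norm V)\<^sup>2 \<le> C / c * (norm z)\<^sup>2"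
  proof -
    have "(C / c * (norm z)\<^sup>2) * (c * (norm V)\<^sup>2) \<le> (C / c * (norm z)\<^sup>2) * 1"
      using V2 C c by (intro mult_left_mono) auto
    then show ?thesis using c by (simp add: mult_ac)
  qed
  have 3: "2 * \<bar>r\<bar> * (C * norm z * norm V * norm w) \<le> c / 2 * (norm w)\<^sup>2 + 2 * C\<^sup>2 / c\<^sup>2 * r\<^sup>2 * (norm z)\<^sup>2"
  proof -
    define b where "b = \<bar>r\<bar> * C * norm z * norm V"
    have "0 \<le> (c / 2 * norm w - b)\<^sup>2 * (2 / c)" using c by simp
    also have "\<dots> = c / 2 * (norm w)\<^sup>2 + 2 / c * b\<^sup>2 - 2 * b * norm w"
      using c by (simp add: power2_eq_square field_simps)
    finally have a: "2 * b * norm w \<le> c / 2 * (norm w)\<^sup>2 + 2 / c * b\<^sup>2" by simp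
    have "2 / c * b\<^sup>2 = (2 * C\<^sup>2 / c\<^sup>2 * r\<^sup>2 * (norm z)\<^sup>2) * (c * (norm V)\<^sup>2)"
      using c by (simp add: b_def power2_eq_square field_simps abs_mult[symmetric])
    also have "\<dots> \<le> (2 * C\<^sup>2 / c\<^sup>2 * r\<^sup>2 * (norm z)\<^sup>2) * 1"
      using V2 by (intro mult_left_mono) auto
    finally show ?thesis using a by (simp add: b_def mult_ac)
  qed
  have 4: "\<bar>2 * r * (g (y + z) V w - g y V w)\<bar> \<le> 2 * \<bar>r\<bar> * (C * norm z * norm V * norm w)"
    using mult_left_mono[OF controlled_g_lipschitz[OF ctl y(2,1), of V w], of "2 * \<bar>r\<bar>"]
    by (simp add: abs_mult)
  have 5: "c * (norm w)\<^sup>2 \<le> g (y + z) w w" by (rule controlledD(5)[OF ctl y(2)])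
  have e: "g (y + z) (r *\<^sub>R V + w) (r *\<^sub>R V + w)
    = r\<^sup>2 * g (y + z) V V + 2 * r * g (y + z) V w + g (y + z) w w"
    using U g_sym[OF U(2), of w V] by (simp add: g_simps power2_eq_square algebra_simps)
  have 6: "r\<^sup>2 * (C * (norm z)\<^sup>2 * (norm V)\<^sup>2) \<le> r\<^sup>2 * (C / c * (norm z)\<^sup>2)"
    using 2 by (rule mult_left_mono) simp
  have 7: "r\<^sup>2 * (1 + dg y z V V - C * (norm z)\<^sup>2 * (norm V)\<^sup>2)
     = r\<^sup>2 + r\<^sup>2 * dg y z V V - r\<^sup>2 * (C * (norm z)\<^sup>2 * (norm V)\<^sup>2)"
    by (simp add: algebra_simps)
  have 8: "(2 * C\<^sup>2 / c\<^sup>2 + C / c) * r\<^sup>2 * (norm z)\<^sup>2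
    = 2 * C\<^sup>2 / c\<^sup>2 * r\<^sup>2 * (norm z)\<^sup>2 + r\<^sup>2 * (C / c * (norm z)\<^sup>2)"
    by (simp add: algebra_simps)
  have 9: "2 * r * (g (y + z) V w - g y V w) = 2 * r * g (y + z) V w - 2 * r * g y V w"
    by (simp add: algebra_simps)
  show ?thesis unfolding e 8 using 1 3 4 5 6 unfolding 7 9 by linarith
qed

text \<open>
  Suppose that the competitor \<open>\<sigma>\<close>, with arc length function \<open>W\<close>, had length \<open>W 1 < h\<close>.
  Reparametrise the geodesic by \<open>\<tau> t = W t + e * t\<close> with \<open>e = h - W 1\<close>, so that both curves are
  traversed at nearly the same speed. Divided by \<open>\<tau>'\<close> and integrated, \<open>energy_density_bound\<close>
  gives \<open>h \<le> W 1\<close>: the linear terms integrate to zero because the difference \<open>z\<close> vanishes at the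
  ends, and the quadratic ones are nonnegative for small \<open>h\<close> since \<open>z\<close>, starting at zero, is
  small compared with its derivative.
\<close>

lemma short_geodesic_minimizes_length:
  assumes ctl: "controlled K c C" and h: "0 < h" "2 * (2 * C\<^sup>2 / c\<^sup>2 + C / c) * h\<^sup>2 \<le> c"
    and xK: "\<And>s. s \<in> {0..h} \<Longrightarrow> x s \<in> K"
    and xv: "\<And>s. s \<in> {0..h} \<Longrightarrow> (x has_vector_derivative v s) (at s)"
    and va: "\<And>s. s \<in> {0..h} \<Longrightarrow> (v has_vector_derivative acc (x s) (v s)) (at s)"
    and unit: "\<And>s. s \<in> {0..h} \<Longrightarrow> g (x s) (v s) (v s) = 1"
    and sK: "\<And>t. t \<in> {0..1} \<Longrightarrow> \<sigma> t \<in> K" and s_cont: "continuous_on {0..1} \<sigma>"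
    and ends: "\<sigma> 0 = x 0" "\<sigma> 1 = x h"
    and F: "finite F"
    and s_der: "\<And>t. t \<in> {0<..<1} - F \<Longrightarrow> (\<sigma> has_vector_derivative \<sigma>' t) (at t)"
    and W_der: "\<And>t. t \<in> {0<..<1} - F \<Longrightarrow>
      (W has_real_derivative sqrt (g (\<sigma> t) (\<sigma>' t) (\<sigma>' t))) (at t)"
    and W_cont: "continuous_on {0..1} W" and W0: "W 0 = 0"
    and W_bounds: "\<And>t. t \<in> {0..1} \<Longrightarrow> 0 \<le> W t \<and> W t \<le> W 1"
  shows "h \<le> W 1"
proof (rule ccontr)
  assume "\<not> h \<le> W 1"
  \<comment> \<open>the normalisation \<open>\<tau> 1 = h\<close> dictates this value\<close>
  define e where "e = h - W 1"
  have e: "e > 0" using \<open>\<not> h \<le> W 1\<close> by (simp add: e_def)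
  define \<kappa> where "\<kappa> = 2 * C\<^sup>2 / c\<^sup>2 + C / c"
  note ctlD = controlledD[OF ctl]
  have \<kappa>: "\<kappa> \<ge> 0" using ctlD(3,4) by (simp add: \<kappa>_def)
  define \<tau> where "\<tau> t = W t + e * t" for t
  have \<tau>: "\<tau> t \<in> {0..h}" if "t \<in> {0..1}" for t
  proof -
    have "0 \<le> e * t" "e * t \<le> e" using that e by (auto simp: mult_left_le)
    then show ?thesis using W_bounds[OF that] by (auto simp: \<tau>_def e_def)
  qed
  have \<tau>01: "\<tau> 0 = 0" "\<tau> 1 = h" by (auto simp: \<tau>_def W0 e_def)
  define y where "y t = x (\<tau> t)" for t
  define V where "V t = v (\<tau> t)" for t
  define z where "z t = \<sigma> t - y t" for t
  have z01: "z 0 = 0" "z 1 = 0" by (auto simp: z_def y_def \<tau>01 ends)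
  have yK: "y t \<in> K" if "t \<in> {0..1}" for t using xK[OF \<tau>[OF that]] by (simp add: y_def)
  have \<tau>_cont: "continuous_on {0..1} \<tau>" unfolding \<tau>_def by (intro continuous_intros W_cont)
  have cont_comp: "continuous_on {0..1} (\<lambda>t. f (\<tau> t))"
    if "\<And>s. s \<in> {0..h} \<Longrightarrow> (f has_vector_derivative f' s) (at s)" for f f' :: "real \<Rightarrow> 'e"
  proof (rule continuous_on_compose2[OF _ \<tau>_cont])
    show "continuous_on {0..h} f"
      using that by (meson continuous_at_imp_continuous_on has_vector_derivative_continuous)
  qed (use \<tau> in auto)
  have y_cont: "continuous_on {0..1} y" unfolding y_def by (rule cont_comp[OF xv])
  have V_cont: "continuous_on {0..1} V" unfolding V_def by (rule cont_comp[OF va])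
  have z_cont: "continuous_on {0..1} z" unfolding z_def by (intro continuous_intros s_cont y_cont)
  define P where "P t = g (y t) (V t) (z t)" for t
  have P01: "P 0 = 0" "P 1 = 0"
    using yK[of 0] yK[of 1] ctlD(1) by (auto simp: P_def z01 subset_iff g_simps)
  have P_cont: "continuous_on {0..1} P" unfolding P_def
    using yK ctlD(1) by (intro continuous_on_g_compose y_cont V_cont z_cont) auto
  obtain tm where tm: "tm \<in> {0..1}" "\<And>t. t \<in> {0..1} \<Longrightarrow> norm (z t) \<le> norm (z tm)"
    using continuous_attains_sup[of "{0..1::real}" "\<lambda>t. norm (z t)"] continuous_on_norm[OF z_cont]
    by auto
  define S where "S = norm (z tm)"
  define u where "u = sgn (z tm)"
  have u: "norm u \<le> 1" "z tm \<bullet> u = S"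
    by (cases "z tm = 0"; simp add: u_def S_def sgn_div_norm power2_norm_eq_inner[symmetric] power2_eq_square)+
  \<comment> \<open>for \<open>a = 0\<close> the integrated comparison without its coercive term; in general the coercive
    term \<open>(norm z')\<^sup>2 / \<tau>'\<close> is replaced by its lower bound \<open>2 * a * (z' \<bullet> u) - a\<^sup>2 * \<tau>'\<close>, which has a primitive\<close>
  define \<Phi> where
    "\<Phi> a t = W t - \<tau> t - 2 * P t + \<kappa> * S\<^sup>2 * \<tau> t - c / 2 * (2 * a * (z t \<bullet> u) - a\<^sup>2 * \<tau> t)" for a t
  have \<Phi>_cont: "continuous_on {0..1} (\<Phi> a)" for a
    unfolding \<Phi>_def by (intro continuous_intros W_cont \<tau>_cont P_cont z_cont)
  have mono: "\<Phi> a p \<le> \<Phi> a q" if a: "0 \<le> a" and pq: "0 \<le> p" "p \<le> q" "q \<le> 1" for a p q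
  proof (rule nonneg_derivative_imp_le[OF pq(2) F])
    show "continuous_on {p..q} (\<Phi> a)" using \<Phi>_cont continuous_on_subset pq by (metis atLeastatMost_subset_iff)
    fix t assume "t \<in> {p<..<q} - F"
    then have t: "t \<in> {0<..<1} - F" "t \<in> {0..1}" using pq by auto
    define w where "w = sqrt (g (\<sigma> t) (\<sigma>' t) (\<sigma>' t))"
    define r where "r = w + e"
    define w' where "w' = \<sigma>' t - r *\<^sub>R V t"
    have st: "\<sigma> t \<in> K" and U: "y t \<in> U" "\<sigma> t \<in> U" using sK yK t(2) ctlD(1) by auto
    have "0 \<le> c * (norm (\<sigma>' t))\<^sup>2" using ctlD(3) by simp
    also have "\<dots> \<le> g (\<sigma> t) (\<sigma>' t) (\<sigma>' t)" by (rule ctlD(5)[OF st])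
    finally have w2: "w\<^sup>2 = g (\<sigma> t) (\<sigma>' t) (\<sigma>' t)" "w \<ge> 0" by (auto simp: w_def)
    have r: "r > 0" using w2 e by (simp add: r_def)
    have W': "(W has_real_derivative w) (at t)" using W_der[OF t(1)] by (simp add: w_def)
    have \<tau>': "(\<tau> has_real_derivative r) (at t)"
      unfolding \<tau>_def r_def by (rule derivative_eq_intros W' refl | simp)+
    have comp: "((\<lambda>t. f (\<tau> t)) has_vector_derivative r *\<^sub>R f') (at t)"
      if "(f has_vector_derivative f') (at (\<tau> t))" for f :: "real \<Rightarrow> 'e" and f'
      using vector_diff_chain_at[of \<tau> r t f f'] that \<tau>'
      by (simp add: o_def has_real_derivative_iff_has_vector_derivative)
    have y': "(y has_vector_derivative r *\<^sub>R V t) (at t)"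
      unfolding y_def V_def by (rule comp[OF xv[OF \<tau>[OF t(2)]]])
    have V': "(V has_vector_derivative r *\<^sub>R acc (y t) (V t)) (at t)"
      unfolding y_def V_def by (rule comp[OF va[OF \<tau>[OF t(2)]]])
    have z': "(z has_vector_derivative w') (at t)"
      unfolding z_def w'_def by (rule has_vector_derivative_diff[OF s_der[OF t(1)] y'])
    have "(P has_real_derivative dg (y t) (r *\<^sub>R V t) (V t) (z t)
        + g (y t) (r *\<^sub>R acc (y t) (V t)) (z t) + g (y t) (V t) w') (at t)"
      unfolding P_def by (rule g_along_curve_derivative[OF y' U(1) V' z'])
    moreover have "dg (y t) (r *\<^sub>R V t) (V t) (z t) + g (y t) (r *\<^sub>R acc (y t) (V t)) (z t)
       = r / 2 * dg (y t) (z t) (V t) (V t)"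
      using U by (simp add: g_simps dg_simps g_acc field_simps)
    ultimately have P': "(P has_real_derivative r / 2 * dg (y t) (z t) (V t) (V t) + g (y t) (V t) w') (at t)"
      by simp
    have zu': "((\<lambda>t. z t \<bullet> u) has_real_derivative w' \<bullet> u) (at t)"
      using z' unfolding has_real_derivative_iff_has_vector_derivative
      by (rule bounded_linear.has_vector_derivative[OF bounded_linear_inner_left])
    define d where "d = w - r - 2 * (r / 2 * dg (y t) (z t) (V t) (V t) + g (y t) (V t) w')
      + \<kappa> * S\<^sup>2 * r - c / 2 * (2 * a * (w' \<bullet> u) - a\<^sup>2 * r)"
    have der: "(\<Phi> a has_real_derivative d) (at t)"
      unfolding \<Phi>_def d_def by (rule derivative_eq_intros W' \<tau>' P' zu' refl | simp)+
    have "r\<^sup>2 + r\<^sup>2 * dg (y t) (z t) (V t) (V t) + 2 * r * g (y t) (V t) w' + c / 2 * (norm w')\<^sup>2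
      - \<kappa> * r\<^sup>2 * (norm (z t))\<^sup>2 \<le> g (y t + z t) (r *\<^sub>R V t + w') (r *\<^sub>R V t + w')"
      unfolding \<kappa>_def
      by (rule energy_density_bound[OF ctl yK[OF t(2)]])
        (use st unit[OF \<tau>[OF t(2)]] in \<open>auto simp: z_def y_def V_def\<close>)
    also have "\<dots> = w\<^sup>2" using w2 by (simp add: z_def w'_def)
    also have "\<dots> \<le> r * w" using w2(2) e unfolding r_def power2_eq_square by (intro mult_right_mono) auto
    finally have 1: "r\<^sup>2 + r\<^sup>2 * dg (y t) (z t) (V t) (V t) + 2 * r * g (y t) (V t) w' + c / 2 * (norm w')\<^sup>2
      - \<kappa> * r\<^sup>2 * (norm (z t))\<^sup>2 \<le> r * w" .
    have 2: "\<kappa> * r\<^sup>2 * (norm (z t))\<^sup>2 \<le> \<kappa> * r\<^sup>2 * S\<^sup>2"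
      using tm(2)[OF t(2)] \<kappa> by (intro mult_left_mono power_mono) (auto simp: S_def)
    have 3: "c / 2 * (2 * (a * r) * (w' \<bullet> u)) \<le> c / 2 * ((norm w')\<^sup>2 + (a * r)\<^sup>2)"
    proof -
      have "w' \<bullet> u \<le> norm w' * norm u" by (rule norm_cauchy_schwarz)
      also have "\<dots> \<le> norm w'" using u(1) by (simp add: mult_left_le)
      finally have "2 * (a * r) * (w' \<bullet> u) \<le> 2 * (a * r) * norm w'"
        using a r by (intro mult_left_mono) auto
      also have "\<dots> \<le> (norm w')\<^sup>2 + (a * r)\<^sup>2"
        using zero_le_power2[of "norm w' - a * r"] by (simp add: power2_eq_square algebra_simps)
      finally show ?thesis using ctlD(3) by (intro mult_left_mono) auto
    qed
    have "r * d = r * w - (r\<^sup>2 + r\<^sup>2 * dg (y t) (z t) (V t) (V t) + 2 * r * g (y t) (V t) w')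
       + \<kappa> * r\<^sup>2 * S\<^sup>2 - c / 2 * (2 * (a * r) * (w' \<bullet> u)) + c / 2 * (a * r)\<^sup>2"
      by (simp add: d_def power2_eq_square algebra_simps)
    moreover have "c / 2 * ((norm w')\<^sup>2 + (a * r)\<^sup>2) = c / 2 * (norm w')\<^sup>2 + c / 2 * (a * r)\<^sup>2"
      by (simp add: algebra_simps)
    ultimately have "0 \<le> r * d" using 1 2 3 by linarith
    then have "0 \<le> d" using r by (simp add: zero_le_mult_iff)
    then show "\<exists>d\<ge>0. (\<Phi> a has_real_derivative d) (at t)" using der by blast
  qed
  \<comment> \<open>this slope makes the bound \<open>2 * l * S - l\<^sup>2 * h\<close> as large as possible\<close>
  define l where "l = S / h"
  have "0 = \<Phi> l 0" by (simp add: \<Phi>_def W0 \<tau>01 P01 z01)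
  also have "\<dots> \<le> \<Phi> l tm" using tm(1) h by (intro mono) (auto simp: l_def S_def)
  also have "\<dots> = \<Phi> 0 tm - c / 2 * (2 * l * S - l\<^sup>2 * \<tau> tm)" by (simp add: \<Phi>_def u(2))
  also have "\<Phi> 0 tm \<le> \<Phi> 0 1" using tm(1) by (intro mono) auto
  also have "\<Phi> 0 1 = W 1 - h + \<kappa> * S\<^sup>2 * h" by (simp add: \<Phi>_def \<tau>01 P01)
  finally have 1: "c / 2 * (2 * l * S - l\<^sup>2 * \<tau> tm) \<le> \<kappa> * S\<^sup>2 * h - e" by (simp add: e_def)
  have "c / 2 * (2 * l * S - l\<^sup>2 * h) \<le> c / 2 * (2 * l * S - l\<^sup>2 * \<tau> tm)"
    using ctlD(3) \<tau>[OF tm(1)] by (intro mult_left_mono diff_left_mono) auto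
  moreover have "2 * l * S - l\<^sup>2 * h = S\<^sup>2 / h"
    using h by (simp add: l_def power2_eq_square field_simps)
  ultimately have 2: "c / 2 * (S\<^sup>2 / h) \<le> \<kappa> * S\<^sup>2 * h - e" using 1 by (metis order_trans)
  have "(S\<^sup>2 / (2 * h)) * (2 * \<kappa> * h\<^sup>2) \<le> (S\<^sup>2 / (2 * h)) * c"
    using h by (intro mult_left_mono) (auto simp: \<kappa>_def)
  then have "\<kappa> * S\<^sup>2 * h \<le> c / 2 * (S\<^sup>2 / h)"
    using h by (simp add: power2_eq_square field_simps)
  then show False using 2 e by linarith
qed

text \<open>The two occurrences of the acceleration cancel the derivative of the metric.\<close>

lemma speed_derivative_zero:
  assumes x: "(x has_vector_derivative v t) (at t)" "x t \<in> U"
    and v: "(v has_vector_derivative acc (x t) (v t)) (at t)"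
  shows "((\<lambda>t. g (x t) (v t) (v t)) has_real_derivative 0) (at t)"
proof -
  have "dg (x t) (v t) (v t) (v t) + g (x t) (acc (x t) (v t)) (v t) + g (x t) (v t) (acc (x t) (v t)) = 0"
    using x(2) by (simp add: g_sym[of "x t" "v t"] g_acc)
  then show ?thesis using g_along_curve_derivative[OF x v v] by simp
qed

end

section \<open>Charts and geodesics\<close>

context riemannian_manifold
begin

lemma chart_facts:
  assumes "c \<in> A"
  shows "open (chart_dom c)" "open (chart_codom c)" "continuous_on (chart_dom c) (chart_map c)"
    "continuous_on (chart_codom c) (chart_inv c)"
    "\<And>p. p \<in> chart_dom c \<Longrightarrow> chart_inv c (chart_map c p) = p"
    "\<And>p. p \<in> chart_dom c \<Longrightarrow> chart_map c p \<in> chart_codom c"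
    "\<And>x. x \<in> chart_codom c \<Longrightarrow> chart_map c (chart_inv c x) = x"
    "\<And>x. x \<in> chart_codom c \<Longrightarrow> chart_inv c x \<in> chart_dom c"
  using charts[OF assms] unfolding is_chart_def homeomorphism_def by auto

lemma coordinate_metric_chart: "c \<in> A \<Longrightarrow> coordinate_metric (chart_codom c) (G c)"
  by unfold_locales
    (auto intro: metric_bilinear metric_sym metric_pos metric_smooth chart_facts)

lemma chart_at: "chart_at p \<in> A" "p \<in> chart_dom (chart_at p)"
proof -
  have "\<exists>c. c \<in> A \<and> p \<in> chart_dom c" using cover by blast
  then have "chart_at p \<in> A \<and> p \<in> chart_dom (chart_at p)"
    unfolding chart_at_def by (rule someI_ex)
  then show "chart_at p \<in> A" "p \<in> chart_dom (chart_at p)" by auto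
qed

text \<open>
  The speed is defined through one chosen chart; by the transformation law of the metric every
  chart gives the same value.
\<close>

lemma speed_in_chart:
  assumes c: "c \<in> A" "\<gamma> t \<in> chart_dom c" and t: "t \<in> S" "at t within S \<noteq> bot"
    and cont: "continuous (at t within S) \<gamma>"
    and v: "((chart_map c \<circ> \<gamma>) has_vector_derivative v) (at t within S)"
  shows "speed \<gamma> S t = sqrt (G c (chart_map c (\<gamma> t)) v v)"
proof -
  define c' where "c' = chart_at (\<gamma> t)"
  have c': "c' \<in> A" "\<gamma> t \<in> chart_dom c'" unfolding c'_def by (rule chart_at)+
  define x where "x = chart_map c (\<gamma> t)"
  define D where "D = frechet_derivative (transition c c') (at x)"
  have "transition c c' differentiable (at x)"
    by (rule smooth_on_differentiable[OF transition_smooth[OF c(1) c'(1)]])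
      (use c(2) c'(2) in \<open>auto simp: x_def\<close>)
  then have D: "(transition c c' has_derivative D) (at x)"
    unfolding D_def by (simp add: frechet_derivative_works)
  have "((\<lambda>s. transition c c' ((chart_map c \<circ> \<gamma>) s)) has_derivative (\<lambda>a. D (a *\<^sub>R v))) (at t within S)"
    by (rule has_derivative_compose[OF v[unfolded has_vector_derivative_def]])
      (use D in \<open>simp add: x_def\<close>)
  moreover have "\<forall>\<^sub>F s in at t within S. transition c c' ((chart_map c \<circ> \<gamma>) s) = (chart_map c' \<circ> \<gamma>) s"
  proof -
    have "\<forall>\<^sub>F s in at t within S. \<gamma> s \<in> chart_dom c"
      using topological_tendstoD[OF _ chart_facts(1)[OF c(1)] c(2)] cont
      by (simp add: continuous_within)
    then show ?thesis
      by eventually_elim (simp add: transition_def chart_facts(5)[OF c(1)])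
  qed
  ultimately have "((chart_map c' \<circ> \<gamma>) has_derivative (\<lambda>a. D (a *\<^sub>R v))) (at t within S)"
    by (rule has_derivative_transform_eventually)
      (use t c(2) in \<open>simp_all add: transition_def chart_facts(5)[OF c(1)]\<close>)
  then have "((chart_map c' \<circ> \<gamma>) has_vector_derivative D v) (at t within S)"
    unfolding has_vector_derivative_def
    using linear_cmul[OF has_derivative_linear[OF D]] by simp
  then have "velocity c' \<gamma> S t = D v"
    unfolding velocity_def by (rule vector_derivative_within[OF t(2)])
  then have "speed \<gamma> S t = sqrt (G c' (chart_map c' (\<gamma> t)) (D v) (D v))"
    unfolding speed_def c'_def[symmetric] Let_def by simp
  also have "G c' (chart_map c' (\<gamma> t)) (D v) (D v) = G c x v v"
    using metric_transition[OF c(1) c'(1) c(2) c'(2), of v v] by (simp add: D_def x_def)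
  finally show ?thesis by (simp add: x_def)
qed

abbreviation acceleration :: "('m, 'e) chart \<Rightarrow> 'e \<Rightarrow> 'e \<Rightarrow> 'e" where
  "acceleration c \<equiv> coordinate_metric.acc (G c)"

lemma christoffel_acceleration:
  assumes c: "c \<in> A" and x: "x \<in> chart_codom c"
  shows "christoffel c x v v = - acceleration c x v"
proof -
  interpret cm: coordinate_metric "chart_codom c" "G c" by (rule coordinate_metric_chart[OF c])
  have c1: "christoffel1 c x v v u = cm.dg x v v u - cm.dg x u v v / 2" for u
    by (simp add: christoffel1_def cm.dg_def field_simps)
  show ?thesis unfolding christoffel_def
  proof (rule the_equality)
    show "\<forall>u. G c x (- cm.acc x v) u = christoffel1 c x v v u"
      by (simp add: c1 bilinear_lneg[OF cm.g_bilinear[OF x]] cm.g_acc[OF x])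
    fix z assume "\<forall>u. G c x z u = christoffel1 c x v v u"
    then have "cm.acc x v = - z"
      by (intro cm.acc_unique[OF x]) (simp add: c1 bilinear_lneg[OF cm.g_bilinear[OF x]])
    then show "z = - cm.acc x v" by simp
  qed
qed

lemma geodesic_in_chart:
  assumes "geodesic \<gamma>" "c \<in> A" "\<gamma> t \<in> chart_dom c"
  shows "((chart_map c \<circ> \<gamma>) has_vector_derivative velocity c \<gamma> UNIV t) (at t)"
    "(velocity c \<gamma> UNIV has_vector_derivative
       acceleration c (chart_map c (\<gamma> t)) (velocity c \<gamma> UNIV t)) (at t)"
proof -
  show "((chart_map c \<circ> \<gamma>) has_vector_derivative velocity c \<gamma> UNIV t) (at t)"
    using assms unfolding geodesic_def by blast
  have "(velocity c \<gamma> UNIV has_vector_derivative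
    - christoffel c (chart_map c (\<gamma> t)) (velocity c \<gamma> UNIV t) (velocity c \<gamma> UNIV t)) (at t)"
    using assms unfolding geodesic_def by blast
  then show "(velocity c \<gamma> UNIV has_vector_derivative
       acceleration c (chart_map c (\<gamma> t)) (velocity c \<gamma> UNIV t)) (at t)"
    unfolding christoffel_acceleration[OF assms(2) chart_facts(6)[OF assms(2,3)]] by simp
qed

lemma geodesic_continuous: "geodesic \<gamma> \<Longrightarrow> continuous_on UNIV \<gamma>"
  by (simp add: geodesic_def)

lemma open_chart_times:
  assumes "continuous_on UNIV \<gamma>" "c \<in> A"
  shows "open {t. \<gamma> t \<in> chart_dom c}"
  using open_vimage[OF chart_facts(1)[OF assms(2)] assms(1)] by (simp add: vimage_def)

text \<open>
  The definition differentiates the total function \<open>velocity\<close>, whose value is arbitrary where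
  the curve has no derivative. Here it is replaced by any function \<open>v\<close> which is known to be the
  derivative of the curve near the parameter.
\<close>

lemma geodesicI:
  assumes cont: "continuous_on UNIV \<gamma>"
    and "\<And>c t. c \<in> A \<Longrightarrow> \<gamma> t \<in> chart_dom c \<Longrightarrow>
      \<exists>T v. open T \<and> t \<in> T \<and> (\<forall>s\<in>T. \<gamma> s \<in> chart_dom c \<longrightarrow> ((chart_map c \<circ> \<gamma>) has_vector_derivative v s) (at s)) \<and>
        (v has_vector_derivative acceleration c (chart_map c (\<gamma> t)) (v t)) (at t)"
  shows "geodesic \<gamma>"
  unfolding geodesic_def
proof (intro conjI cont ballI allI impI)
  fix c t assume c: "c \<in> A" "\<gamma> t \<in> chart_dom c"
  from assms(2)[OF c] obtain T v where T: "open T" "t \<in> T"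
    and x': "\<forall>s\<in>T. \<gamma> s \<in> chart_dom c \<longrightarrow> ((chart_map c \<circ> \<gamma>) has_vector_derivative v s) (at s)"
    and v': "(v has_vector_derivative acceleration c (chart_map c (\<gamma> t)) (v t)) (at t)"
    by (elim exE conjE)
  let ?T = "T \<inter> {t. \<gamma> t \<in> chart_dom c}"
  have oT: "open ?T" using T open_chart_times[OF cont c(1)] by auto
  have vel: "velocity c \<gamma> UNIV s = v s" if "s \<in> ?T" for s
    unfolding velocity_def using x' that by (intro vector_derivative_at) auto
  have tT: "t \<in> ?T" using T c by auto
  show "((chart_map c \<circ> \<gamma>) has_vector_derivative velocity c \<gamma> UNIV t) (at t)"
    using x' T c vel[OF tT] by simp
  show "(velocity c \<gamma> UNIV has_vector_derivative
    - christoffel c (chart_map c (\<gamma> t)) (velocity c \<gamma> UNIV t) (velocity c \<gamma> UNIV t)) (at t)"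
    using has_vector_derivative_transform_within_open[OF v' oT tT vel[symmetric]]
    by (simp add: vel[OF tT] christoffel_acceleration[OF c(1) chart_facts(6)[OF c]])
qed

lemma speed_UNIV_in_chart:
  assumes "c \<in> A" "\<gamma> t \<in> chart_dom c" "isCont \<gamma> t"
    and "((chart_map c \<circ> \<gamma>) has_vector_derivative v) (at t)"
  shows "speed \<gamma> UNIV t = sqrt (G c (chart_map c (\<gamma> t)) v v)"
  using speed_in_chart[of c \<gamma> t UNIV v] assms by simp

lemma geodesic_isCont: "geodesic \<gamma> \<Longrightarrow> isCont \<gamma> t"
  using geodesic_continuous continuous_on_eq_continuous_at open_UNIV by blast

lemma geodesic_speed:
  assumes "geodesic \<gamma>" "c \<in> A" "\<gamma> t \<in> chart_dom c"
  shows "speed \<gamma> UNIV t = sqrt (G c (chart_map c (\<gamma> t)) (velocity c \<gamma> UNIV t) (velocity c \<gamma> UNIV t))"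
  using assms by (intro speed_UNIV_in_chart geodesic_isCont geodesic_in_chart)

lemma metric_nonneg: "c \<in> A \<Longrightarrow> x \<in> chart_codom c \<Longrightarrow> 0 \<le> G c x v v"
  using metric_pos[of c x v] bilinear_lzero[OF metric_bilinear, of c x 0] by (cases "v = 0") auto

lemma speed_nonneg: "0 \<le> speed \<gamma> S t"
  unfolding speed_def Let_def
  using metric_nonneg[OF chart_at(1) chart_facts(6)[OF chart_at]] by simp

lemma geodesic_affine:
  assumes geo: "geodesic \<gamma>"
  shows "geodesic (\<lambda>u. \<gamma> (s + a * u))"
    and "speed (\<lambda>u. \<gamma> (s + a * u)) UNIV u = \<bar>a\<bar> * speed \<gamma> UNIV (s + a * u)"
proof -
  let ?b = "\<lambda>u. \<gamma> (s + a * u)"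
  have cont: "continuous_on UNIV ?b"
  proof (rule continuous_on_compose2[OF geodesic_continuous[OF geo]])
    show "continuous_on UNIV (\<lambda>u. s + a * u)" by (intro continuous_intros)
  qed simp
  have inner: "((\<lambda>u. s + a * u) has_vector_derivative a) (at u)" for u
    by (auto intro!: derivative_eq_intros simp: has_real_derivative_iff_has_vector_derivative[symmetric])
  have x': "((chart_map c \<circ> ?b) has_vector_derivative a *\<^sub>R velocity c \<gamma> UNIV (s + a * u)) (at u)"
    if "c \<in> A" "?b u \<in> chart_dom c" for c u
    using vector_diff_chain_at[OF inner geodesic_in_chart(1)[OF geo that]] by (simp add: o_def)
  show "geodesic ?b"
  proof (rule geodesicI[OF cont])
    fix c u assume c: "c \<in> A" "?b u \<in> chart_dom c"
    interpret cm: coordinate_metric "chart_codom c" "G c" by (rule coordinate_metric_chart[OF c(1)])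
    let ?v = "\<lambda>u. a *\<^sub>R velocity c \<gamma> UNIV (s + a * u)"
    have "((\<lambda>u. velocity c \<gamma> UNIV (s + a * u)) has_vector_derivative
       a *\<^sub>R cm.acc (chart_map c (?b u)) (velocity c \<gamma> UNIV (s + a * u))) (at u)"
      using vector_diff_chain_at[OF inner geodesic_in_chart(2)[OF geo c]] by (simp add: o_def)
    then have "(?v has_vector_derivative
       a *\<^sub>R a *\<^sub>R cm.acc (chart_map c (?b u)) (velocity c \<gamma> UNIV (s + a * u))) (at u)"
      by (rule bounded_linear.has_vector_derivative[OF bounded_linear_scaleR_right])
    then have "(?v has_vector_derivative cm.acc (chart_map c (?b u)) (?v u)) (at u)"
      by (simp add: cm.acc_scale[OF chart_facts(6)[OF c]] power2_eq_square)
    then show "\<exists>T v. open T \<and> u \<in> T \<and> (\<forall>s\<in>T. ?b s \<in> chart_dom c \<longrightarrow>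
        ((chart_map c \<circ> ?b) has_vector_derivative v s) (at s)) \<and>
        (v has_vector_derivative cm.acc (chart_map c (?b u)) (v u)) (at u)"
      using x' c(1) by (intro exI[of _ UNIV] exI[of _ ?v]) auto
  qed
  let ?c = "chart_at (?b u)"
  have c: "?c \<in> A" "?b u \<in> chart_dom ?c" by (rule chart_at)+
  have x: "chart_map ?c (?b u) \<in> chart_codom ?c" by (rule chart_facts(6)[OF c])
  note bl = metric_bilinear[OF c(1) x]
  have "speed ?b UNIV u = sqrt (a\<^sup>2 * G ?c (chart_map ?c (?b u))
     (velocity ?c \<gamma> UNIV (s + a * u)) (velocity ?c \<gamma> UNIV (s + a * u)))"
    using speed_UNIV_in_chart[OF c _ x'[OF c]] cont
    by (simp add: continuous_on_eq_continuous_at bilinear_lmul[OF bl] bilinear_rmul[OF bl] power2_eq_square)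
  also have "\<dots> = \<bar>a\<bar> * speed \<gamma> UNIV (s + a * u)"
    by (simp add: geodesic_speed[OF geo c] real_sqrt_mult)
  finally show "speed ?b UNIV u = \<bar>a\<bar> * speed \<gamma> UNIV (s + a * u)" .
qed

text \<open>In each chart this is conservation of energy, so the squared speed has derivative zero everywhere.\<close>

lemma geodesic_constant_speed:
  assumes geo: "geodesic \<gamma>"
  shows "speed \<gamma> UNIV t = speed \<gamma> UNIV s"
proof -
  have "((\<lambda>t. (speed \<gamma> UNIV t)\<^sup>2) has_real_derivative 0) (at t)" for t
  proof -
    define c where "c = chart_at (\<gamma> t)"
    have c: "c \<in> A" "\<gamma> t \<in> chart_dom c" unfolding c_def by (rule chart_at)+
    interpret cm: coordinate_metric "chart_codom c" "G c" by (rule coordinate_metric_chart[OF c(1)])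
    let ?v = "velocity c \<gamma> UNIV" and ?x = "chart_map c \<circ> \<gamma>"
    have "((\<lambda>t. G c (?x t) (?v t) (?v t)) has_real_derivative 0) (at t)"
      using geodesic_in_chart[OF geo c] chart_facts(6)[OF c] by (intro cm.speed_derivative_zero) (simp_all add: o_def)
    then show ?thesis
    proof (rule has_field_derivative_transform_within_open[OF _ open_chart_times[OF geodesic_continuous[OF geo] c(1)]])
      fix s assume "s \<in> {t. \<gamma> t \<in> chart_dom c}"
      then have s: "\<gamma> s \<in> chart_dom c" by simp
      show "G c (?x s) (?v s) (?v s) = (speed \<gamma> UNIV s)\<^sup>2"
        using geodesic_speed[OF geo c(1) s] metric_nonneg[OF c(1) chart_facts(6)[OF c(1) s]] by simp
    qed (use c in auto)
  qed
  then have "(speed \<gamma> UNIV t)\<^sup>2 = (speed \<gamma> UNIV s)\<^sup>2"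
    by (intro DERIV_isconst_all) auto
  then show ?thesis using speed_nonneg by (simp add: power2_eq_iff_nonneg)
qed

end

section \<open>Arc length of piecewise continuously differentiable curves\<close>

lemma partition_induct:
  fixes \<tau> :: "nat \<Rightarrow> real"
  assumes "\<And>i. i < k \<Longrightarrow> \<tau> i < \<tau> (Suc i) \<and> P (\<tau> i) (\<tau> (Suc i))"
    and "\<And>a. P a a" "\<And>a b c. a \<le> b \<Longrightarrow> b \<le> c \<Longrightarrow> P a b \<Longrightarrow> P b c \<Longrightarrow> P a c"
  shows "\<tau> 0 \<le> \<tau> k \<and> P (\<tau> 0) (\<tau> k)"
  using assms(1)
proof (induction k)
  case (Suc k)
  then have "\<tau> 0 \<le> \<tau> k" "P (\<tau> 0) (\<tau> k)" "\<tau> k < \<tau> (Suc k)" "P (\<tau> k) (\<tau> (Suc k))"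
    by auto
  then show ?case using assms(3)[of "\<tau> 0" "\<tau> k" "\<tau> (Suc k)"] by auto
qed (use assms(2) in auto)

context riemannian_manifold
begin

lemma C1_curve_continuous_speed:
  assumes C1: "C1_curve \<sigma> a b" and "a < b"
  shows "continuous_on {a..b} (speed \<sigma> {a..b})"
  unfolding continuous_on_eq_continuous_within
proof
  fix t assume t: "t \<in> {a..b}"
  define c where "c = chart_at (\<sigma> t)"
  have c: "c \<in> A" "\<sigma> t \<in> chart_dom c" unfolding c_def by (rule chart_at)+
  interpret cm: coordinate_metric "chart_codom c" "G c" by (rule coordinate_metric_chart[OF c(1)])
  have cont: "continuous_on {a..b} \<sigma>" using C1 by (simp add: C1_curve_def)
  let ?X = "{a..b} \<inter> \<sigma> -` chart_dom c"
  let ?v = "velocity c \<sigma> {a..b}"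
  have v: "continuous_on ?X ?v"
    "\<And>s. s \<in> ?X \<Longrightarrow> ((chart_map c \<circ> \<sigma>) has_vector_derivative ?v s) (at s within {a..b})"
    using C1 c(1) unfolding C1_curve_def by blast+
  have x: "continuous_on ?X (\<lambda>s. chart_map c (\<sigma> s))"
    by (rule continuous_on_compose2[OF chart_facts(3)[OF c(1)] continuous_on_subset[OF cont]]) auto
  have "continuous_on ?X (\<lambda>s. sqrt (G c (chart_map c (\<sigma> s)) (?v s) (?v s)))"
    by (intro continuous_on_real_sqrt cm.continuous_on_g_compose x v)
      (use chart_facts(6)[OF c(1)] in auto)
  moreover have "sqrt (G c (chart_map c (\<sigma> s)) (?v s) (?v s)) = speed \<sigma> {a..b} s" if s: "s \<in> ?X" for s
  proof (rule speed_in_chart[symmetric])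
    show "at s within {a..b} \<noteq> bot"
      using s \<open>a < b\<close> by (simp add: trivial_limit_within)
    show "continuous (at s within {a..b}) \<sigma>"
      using cont s by (simp add: continuous_on_eq_continuous_within)
  qed (use c s v in auto)
  ultimately have "continuous_on ?X (speed \<sigma> {a..b})"
    by (rule continuous_on_eq)
  then have *: "continuous (at t within ?X) (speed \<sigma> {a..b})"
    using t c by (simp add: continuous_on_eq_continuous_within)
  obtain T where T: "open T" "?X = {a..b} \<inter> T"
    using continuous_openin_preimage_gen[OF cont chart_facts(1)[OF c(1)]]
    by (auto simp: openin_open)
  have "at t within ?X = at t within {a..b}"
  proof (rule at_within_nhd[OF _ T(1)])
    show "t \<in> T" using T(2) t c by blast
    show "?X \<inter> T - {t} = {a..b} \<inter> T - {t}" using T(2) by blast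
  qed
  then show "continuous (at t within {a..b}) (speed \<sigma> {a..b})" using * by simp
qed

text \<open>The properties at almost all parameters that survive the concatenation of finitely many pieces.\<close>

definition regular_at :: "(real \<Rightarrow> 'm) \<Rightarrow> real \<Rightarrow> bool" where
  "regular_at \<sigma> t \<longleftrightarrow> isCont \<sigma> t \<and> isCont (speed \<sigma> UNIV) t \<and>
     (\<forall>c\<in>A. \<sigma> t \<in> chart_dom c \<longrightarrow>
        ((chart_map c \<circ> \<sigma>) has_vector_derivative velocity c \<sigma> UNIV t) (at t))"

lemma speed_within_interior: "t \<in> {a<..<b} \<Longrightarrow> speed \<sigma> {a..b} t = speed \<sigma> UNIV t"
  by (simp add: speed_def velocity_def at_within_Icc_at)

lemma C1_curve_regular_at:
  assumes C1: "C1_curve \<sigma> a b" and t: "t \<in> {a<..<b}"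
  shows "regular_at \<sigma> t"
  unfolding regular_at_def
proof (intro conjI ballI impI)
  have ab: "a < b" and at: "at t within {a..b} = at t" using t by (auto simp: at_within_Icc_at)
  show "isCont \<sigma> t"
    using C1 t at unfolding C1_curve_def continuous_on_eq_continuous_within
    by (metis atLeastAtMost_iff greaterThanLessThan_iff less_imp_le)
  have "continuous_on {a<..<b} (speed \<sigma> {a..b})"
    by (rule continuous_on_subset[OF C1_curve_continuous_speed[OF C1 ab]]) auto
  then have "continuous_on {a<..<b} (speed \<sigma> UNIV)"
    by (rule continuous_on_eq) (rule speed_within_interior)
  then show "isCont (speed \<sigma> UNIV) t"
    using t continuous_on_eq_continuous_at[OF open_greaterThanLessThan] by blast
  fix c assume c: "c \<in> A" "\<sigma> t \<in> chart_dom c"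
  then have "((chart_map c \<circ> \<sigma>) has_vector_derivative velocity c \<sigma> {a..b} t) (at t within {a..b})"
    using C1 t unfolding C1_curve_def by auto
  then show "((chart_map c \<circ> \<sigma>) has_vector_derivative velocity c \<sigma> UNIV t) (at t)"
    by (simp add: at velocity_def)
qed

lemma piecewise_C1_curve_regular:
  assumes "piecewise_C1_curve \<sigma> a b"
  shows "a \<le> b" "continuous_on {a..b} \<sigma>" "speed \<sigma> UNIV integrable_on {a..b}"
    "\<exists>F. finite F \<and> (\<forall>t\<in>{a<..<b} - F. regular_at \<sigma> t)"
proof -
  obtain k and \<tau> :: "nat \<Rightarrow> real" where \<tau>: "\<tau> 0 = a" "\<tau> k = b"
    and pieces: "\<And>i. i < k \<Longrightarrow> \<tau> i < \<tau> (Suc i) \<and> C1_curve \<sigma> (\<tau> i) (\<tau> (Suc i))"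
    using assms unfolding piecewise_C1_curve_def by blast
  let ?P = "\<lambda>a b. continuous_on {a..b} \<sigma>"
  have "\<tau> 0 \<le> \<tau> k \<and> ?P (\<tau> 0) (\<tau> k)"
  proof (rule partition_induct)
    show "\<tau> i < \<tau> (Suc i) \<and> ?P (\<tau> i) (\<tau> (Suc i))" if "i < k" for i
      using pieces[OF that] by (simp add: C1_curve_def)
    show "?P a c" if "a \<le> b" "b \<le> c" "?P a b" "?P b c" for a b c
      using continuous_on_closed_Un[OF _ _ that(3,4)] that(1,2) ivl_disj_un_two_touch(4)[of a b c] by simp
  qed simp
  then show "a \<le> b" "continuous_on {a..b} \<sigma>" by (auto simp: \<tau>)
  have "\<tau> 0 \<le> \<tau> k \<and> speed \<sigma> UNIV integrable_on {\<tau> 0..\<tau> k}"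
  proof (rule partition_induct)
    show "\<tau> i < \<tau> (Suc i) \<and> speed \<sigma> UNIV integrable_on {\<tau> i..\<tau> (Suc i)}" if "i < k" for i
    proof
      show "\<tau> i < \<tau> (Suc i)" using pieces[OF that] by simp
      have "speed \<sigma> {\<tau> i..\<tau> (Suc i)} integrable_on {\<tau> i..\<tau> (Suc i)}"
        using pieces[OF that] by (intro integrable_continuous_real C1_curve_continuous_speed) auto
      then show "speed \<sigma> UNIV integrable_on {\<tau> i..\<tau> (Suc i)}"
        by (rule integrable_spike_finite[of "{\<tau> i, \<tau> (Suc i)}", rotated 2])
          (auto simp: speed_within_interior)
    qed
    show "speed \<sigma> UNIV integrable_on {a..a}" for a
      by (metis box_real(2) integrable_on_refl)
  qed (auto intro: Henstock_Kurzweil_Integration.integrable_combine)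
  then show "speed \<sigma> UNIV integrable_on {a..b}" by (simp add: \<tau>)
  let ?Q = "\<lambda>a b. \<exists>F. finite F \<and> (\<forall>t\<in>{a<..<b} - F. regular_at \<sigma> t)"
  have "\<tau> 0 \<le> \<tau> k \<and> ?Q (\<tau> 0) (\<tau> k)"
  proof (rule partition_induct)
    show "\<tau> i < \<tau> (Suc i) \<and> ?Q (\<tau> i) (\<tau> (Suc i))" if "i < k" for i
      using pieces[OF that] C1_curve_regular_at[of \<sigma> "\<tau> i" "\<tau> (Suc i)"]
      by (intro conjI exI[of _ "{}"]) blast+
    show "?Q a c" if "?Q a b" "?Q b c" for a b c
    proof -
      from that(1) obtain F1 where F1: "finite F1" "\<forall>t\<in>{a<..<b} - F1. regular_at \<sigma> t" by (elim exE conjE)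
      from that(2) obtain F2 where F2: "finite F2" "\<forall>t\<in>{b<..<c} - F2. regular_at \<sigma> t" by (elim exE conjE)
      have "\<forall>t\<in>{a<..<c} - insert b (F1 \<union> F2). regular_at \<sigma> t"
      proof
        fix t assume t: "t \<in> {a<..<c} - insert b (F1 \<union> F2)"
        then consider "t \<in> {a<..<b} - F1" | "t \<in> {b<..<c} - F2" by force
        then show "regular_at \<sigma> t" using F1(2) F2(2) by cases simp_all
      qed
      then show ?thesis using F1(1) F2(1) by (intro exI[of _ "insert b (F1 \<union> F2)"]) simp
    qed
  qed auto
  then show "?Q a b" by (simp add: \<tau>)
qed

text \<open>
  \<open>W\<close> is an arc length function of \<open>\<sigma>\<close>, differentiable away from the finite set \<open>F\<close>. All length
  estimates are derived from this description instead of integrals.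
\<close>

definition arclength_data :: "(real \<Rightarrow> 'm) \<Rightarrow> real set \<Rightarrow> (real \<Rightarrow> real) \<Rightarrow> bool" where
  "arclength_data \<sigma> F W \<longleftrightarrow> finite F \<and> continuous_on {0..1} \<sigma> \<and> continuous_on {0..1} W \<and> W 0 = 0 \<and>
     (\<forall>s t. 0 \<le> s \<longrightarrow> s \<le> t \<longrightarrow> t \<le> 1 \<longrightarrow> W s \<le> W t) \<and>
     (\<forall>t\<in>{0<..<1} - F. \<forall>c\<in>A. \<sigma> t \<in> chart_dom c \<longrightarrow>
        ((chart_map c \<circ> \<sigma>) has_vector_derivative velocity c \<sigma> UNIV t) (at t) \<and>
        (W has_real_derivative
           sqrt (G c (chart_map c (\<sigma> t)) (velocity c \<sigma> UNIV t) (velocity c \<sigma> UNIV t))) (at t))"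

lemma piecewise_C1_curve_arclength:
  assumes "piecewise_C1_curve \<sigma> 0 1"
  shows "\<exists>F W. arclength_data \<sigma> F W \<and> W 1 = curve_length \<sigma> 0 1"
proof -
  note reg = piecewise_C1_curve_regular[OF assms]
  obtain F where F: "finite F" "\<And>t. t \<in> {0<..<1} - F \<Longrightarrow> regular_at \<sigma> t" using reg(4) by blast
  define W where "W t = integral {0..t} (speed \<sigma> UNIV)" for t
  have "curve_length \<sigma> 0 1 = W 1"
    unfolding curve_length_def W_def
    by (rule integral_spike[of "{0, 1}"]) (auto simp: speed_within_interior)
  moreover have "arclength_data \<sigma> F W"
    unfolding arclength_data_def
  proof (intro conjI allI impI ballI F(1) reg(2))
    show "continuous_on {0..1} W"
      unfolding W_def by (rule indefinite_integral_continuous_1[OF reg(3)])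
    show "W 0 = 0" by (simp add: W_def)
    show "W s \<le> W t" if "0 \<le> s" "s \<le> t" "t \<le> 1" for s t
      unfolding W_def using that
      by (intro integral_subset_le integrable_on_subinterval[OF reg(3)]) (auto simp: speed_nonneg)
    fix t c assume t: "t \<in> {0<..<1} - F" and c: "c \<in> A" "\<sigma> t \<in> chart_dom c"
    have r: "regular_at \<sigma> t" by (rule F(2)[OF t])
    show v: "((chart_map c \<circ> \<sigma>) has_vector_derivative velocity c \<sigma> UNIV t) (at t)"
      using r c by (simp add: regular_at_def)
    have "((\<lambda>u. integral {0..u} (speed \<sigma> UNIV)) has_vector_derivative speed \<sigma> UNIV t) (at t within {0..1} - {})"
    proof (rule integral_has_vector_derivative_continuous_at[OF reg(3)])
      show "continuous (at t within {0..1} - {}) (speed \<sigma> UNIV)"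
        using r by (auto simp: regular_at_def intro: continuous_at_imp_continuous_at_within)
    qed (use t in auto)
    then have "(W has_vector_derivative speed \<sigma> UNIV t) (at t)"
      using t by (simp add: W_def[abs_def] at_within_Icc_at)
    moreover have "speed \<sigma> UNIV t
      = sqrt (G c (chart_map c (\<sigma> t)) (velocity c \<sigma> UNIV t) (velocity c \<sigma> UNIV t))"
      using r by (intro speed_UNIV_in_chart[OF c _ v]) (simp add: regular_at_def)
    ultimately show "(W has_real_derivative
       sqrt (G c (chart_map c (\<sigma> t)) (velocity c \<sigma> UNIV t) (velocity c \<sigma> UNIV t))) (at t)"
      by (simp add: has_real_derivative_iff_has_vector_derivative)
  qed
  ultimately show ?thesis by metis
qed

lemma curve_length_nonneg: "piecewise_C1_curve \<sigma> 0 1 \<Longrightarrow> 0 \<le> curve_length \<sigma> 0 1"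
  using piecewise_C1_curve_arclength[of \<sigma>] unfolding arclength_data_def by (metis order_refl zero_le_one)

lemma geodesic_piecewise_C1:
  assumes geo: "geodesic \<gamma>" and sp: "\<And>t. speed \<gamma> UNIV t = a"
  shows "piecewise_C1_curve \<gamma> 0 1" "curve_length \<gamma> 0 1 = a"
proof -
  have "C1_curve \<gamma> 0 1"
    unfolding C1_curve_def
  proof (intro conjI ballI)
    show "continuous_on {0..1} \<gamma>"
      using geodesic_continuous[OF geo] continuous_on_subset by blast
    fix c assume c: "c \<in> A"
    let ?X = "{0..1} \<inter> \<gamma> -` chart_dom c"
    have vel: "velocity c \<gamma> {0..1} t = velocity c \<gamma> UNIV t" if "t \<in> ?X" for t
      unfolding velocity_def[of c \<gamma> "{0..1}"]
      using that geodesic_in_chart(1)[OF geo c, of t]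
      by (intro vector_derivative_within) (auto simp: trivial_limit_within intro: has_vector_derivative_at_within)
    show "((chart_map c \<circ> \<gamma>) has_vector_derivative velocity c \<gamma> {0..1} t) (at t within {0..1})"
      if "t \<in> ?X" for t
      unfolding vel[OF that] using that geodesic_in_chart(1)[OF geo c, of t]
      by (auto intro: has_vector_derivative_at_within)
    have "continuous_on ?X (velocity c \<gamma> UNIV)"
      using geodesic_in_chart(2)[OF geo c]
      by (intro continuous_at_imp_continuous_on ballI) (auto intro: has_vector_derivative_continuous)
    then show "continuous_on ?X (velocity c \<gamma> {0..1})"
      by (rule continuous_on_eq) (simp add: vel)
  qed
  then show "piecewise_C1_curve \<gamma> 0 1"
    unfolding piecewise_C1_curve_def by (intro exI[of _ 1] exI[of _ real]) auto
  have "curve_length \<gamma> 0 1 = integral {0..1} (\<lambda>t::real. a)"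
    unfolding curve_length_def
    by (rule integral_spike[where S = "{0, 1}" and f = "speed \<gamma> {0..1}" and g = "\<lambda>t::real. a"])
      (auto simp: speed_within_interior sp)
  then show "curve_length \<gamma> 0 1 = a" by simp
qed

definition chart_ball :: "('m, 'e) chart \<Rightarrow> 'e \<Rightarrow> real \<Rightarrow> 'm set" where
  "chart_ball c x r = {p \<in> chart_dom c. norm (chart_map c p - x) < r}"

lemma open_chart_ball:
  assumes "c \<in> A"
  shows "open (chart_ball c x r)"
proof -
  have "open (chart_dom c \<inter> chart_map c -` ball x r)"
    using continuous_open_preimage[OF chart_facts(3,1)[OF assms] open_ball] .
  also have "chart_dom c \<inter> chart_map c -` ball x r = chart_ball c x r"
    by (auto simp: chart_ball_def dist_norm norm_minus_commute)
  finally show ?thesis .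
qed

lemma closed_chart_cball:
  assumes "c \<in> A" "cball x r \<subseteq> chart_codom c"
  shows "closed {p \<in> chart_dom c. norm (chart_map c p - x) \<le> r}"
proof -
  have "compact (chart_inv c ` cball x r)"
    by (intro compact_continuous_image continuous_on_subset[OF chart_facts(4)[OF assms(1)] assms(2)]) simp
  also have "chart_inv c ` cball x r = {p \<in> chart_dom c. norm (chart_map c p - x) \<le> r}"
  proof (intro equalityI subsetI)
    fix p assume "p \<in> {p \<in> chart_dom c. norm (chart_map c p - x) \<le> r}"
    then show "p \<in> chart_inv c ` cball x r"
      using chart_facts(5)[OF assms(1), of p]
      by (intro image_eqI[of _ _ "chart_map c p"]) (auto simp: dist_norm norm_minus_commute)
  next
    fix p assume "p \<in> chart_inv c ` cball x r"
    then obtain y where y: "y \<in> cball x r" "p = chart_inv c y" by blast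
    then have "y \<in> chart_codom c" using assms(2) by blast
    then show "p \<in> {p \<in> chart_dom c. norm (chart_map c p - x) \<le> r}"
      using y chart_facts(7,8)[OF assms(1), of y] by (auto simp: dist_norm norm_minus_commute)
  qed
  finally show ?thesis by (rule compact_imp_closed)
qed

abbreviation controlled_ball :: "('m, 'e) chart \<Rightarrow> 'e \<Rightarrow> real \<Rightarrow> real \<Rightarrow> real \<Rightarrow> bool" where
  "controlled_ball c x r m C \<equiv> coordinate_metric.controlled (chart_codom c) (G c) (cball x r) m C"

text \<open>
  Compare derivatives: the component of the coordinate velocity in the direction of the total
  displacement is at most the Riemannian speed divided by \<open>sqrt m\<close>.
\<close>

lemma coordinate_displacement_le_length:
  assumes c: "c \<in> A" and ctl: "controlled_ball c x r m C" and W: "arclength_data \<sigma> F W"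
    and q: "q \<in> {0..1}" and inside: "\<And>t. t \<in> {0..q} \<Longrightarrow> \<sigma> t \<in> chart_ball c x r"
  shows "sqrt m * norm (chart_map c (\<sigma> q) - chart_map c (\<sigma> 0)) \<le> W q"
proof -
  interpret cm: coordinate_metric "chart_codom c" "G c" by (rule coordinate_metric_chart[OF c])
  define z where "z = chart_map c (\<sigma> q) - chart_map c (\<sigma> 0)"
  define u where "u = sgn z"
  have u: "norm u \<le> 1" "z \<bullet> u = norm z"
    by (cases "z = 0"; simp add: u_def sgn_div_norm power2_norm_eq_inner[symmetric] power2_eq_square)+
  define f where "f t = W t - sqrt m * ((chart_map c (\<sigma> t) - chart_map c (\<sigma> 0)) \<bullet> u)" for t
  have W': "finite F" "continuous_on {0..1} \<sigma>" "continuous_on {0..1} W" "W 0 = 0"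
    "\<And>t. t \<in> {0<..<1} - F \<Longrightarrow> \<sigma> t \<in> chart_dom c \<Longrightarrow>
        ((chart_map c \<circ> \<sigma>) has_vector_derivative velocity c \<sigma> UNIV t) (at t)"
    "\<And>t. t \<in> {0<..<1} - F \<Longrightarrow> \<sigma> t \<in> chart_dom c \<Longrightarrow>
        (W has_real_derivative
           sqrt (G c (chart_map c (\<sigma> t)) (velocity c \<sigma> UNIV t) (velocity c \<sigma> UNIV t))) (at t)"
    using W c unfolding arclength_data_def by blast+
  have "f 0 \<le> f q"
  proof (rule nonneg_derivative_imp_le[where f = f and F = F])
    show "0 \<le> q" "finite F" using q W' by auto
    have "continuous_on {0..q} (\<lambda>t. chart_map c (\<sigma> t))"
      by (rule continuous_on_compose2[OF chart_facts(3)[OF c] continuous_on_subset[OF W'(2)]])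
        (use q inside in \<open>auto simp: chart_ball_def\<close>)
    then show "continuous_on {0..q} f"
      unfolding f_def using q
      by (intro continuous_intros continuous_on_subset[OF W'(3)]) auto
    fix t assume t: "t \<in> {0<..<q} - F"
    then have t': "t \<in> {0<..<1} - F" and tin: "\<sigma> t \<in> chart_ball c x r" using q inside by auto
    then have d: "\<sigma> t \<in> chart_dom c" by (simp add: chart_ball_def)
    let ?v = "velocity c \<sigma> UNIV t"
    have "((\<lambda>t. chart_map c (\<sigma> t) - chart_map c (\<sigma> 0)) has_vector_derivative ?v) (at t)"
      using has_vector_derivative_diff[OF W'(5)[OF t' d] has_vector_derivative_const] by (simp add: o_def)
    then have "((\<lambda>t. (chart_map c (\<sigma> t) - chart_map c (\<sigma> 0)) \<bullet> u) has_real_derivative ?v \<bullet> u) (at t)"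
      unfolding has_real_derivative_iff_has_vector_derivative
      by (rule bounded_linear.has_vector_derivative[OF bounded_linear_inner_left])
    then have "(f has_real_derivative sqrt (G c (chart_map c (\<sigma> t)) ?v ?v) - sqrt m * (?v \<bullet> u)) (at t)"
      unfolding f_def using W'(6)[OF t' d]
      by (intro DERIV_diff DERIV_cmult)
    moreover have "sqrt m * (?v \<bullet> u) \<le> sqrt (G c (chart_map c (\<sigma> t)) ?v ?v)"
    proof -
      have "?v \<bullet> u \<le> norm ?v * norm u" by (rule norm_cauchy_schwarz)
      also have "\<dots> \<le> norm ?v" using u by (simp add: mult_left_le)
      finally have "sqrt m * (?v \<bullet> u) \<le> sqrt m * norm ?v"
        using cm.controlledD(3)[OF ctl] by (intro mult_left_mono) auto
      also have "\<dots> \<le> sqrt (G c (chart_map c (\<sigma> t)) ?v ?v)"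
        using tin by (intro cm.controlled_norm_le[OF ctl]) (auto simp: chart_ball_def dist_norm norm_minus_commute)
      finally show ?thesis .
    qed
    ultimately show "\<exists>d\<ge>0. (f has_real_derivative d) (at t)" by (intro exI conjI) auto
  qed
  then show ?thesis using u(2) W'(4) by (simp add: f_def z_def)
qed

text \<open>
  Up to the first exit parameter \<open>q\<close> the displacement estimate confines the curve to a strictly
  smaller ball, whose closure in the manifold is still inside the chart; so the curve cannot be
  outside at \<open>q\<close>. Compactness of the coordinate ball is what excludes leaving the chart domain
  without approaching the boundary of the ball.
\<close>

lemma short_curve_stays_in_chart_ball:
  assumes c: "c \<in> A" and ctl: "controlled_ball c x r m C" and W: "arclength_data \<sigma> F W"
    and start: "\<sigma> 0 \<in> chart_dom c"
    and short: "W 1 < sqrt m * (r - norm (chart_map c (\<sigma> 0) - x))"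
    and t: "t \<in> {0..1}"
  shows "\<sigma> t \<in> chart_ball c x r"
proof (rule ccontr)
  assume "\<sigma> t \<notin> chart_ball c x r"
  interpret cm: coordinate_metric "chart_codom c" "G c" by (rule coordinate_metric_chart[OF c])
  have W': "continuous_on {0..1} \<sigma>" "W 0 = 0" "\<And>s t. 0 \<le> s \<Longrightarrow> s \<le> t \<Longrightarrow> t \<le> 1 \<Longrightarrow> W s \<le> W t"
    using W unfolding arclength_data_def by blast+
  have m: "m > 0" and sub: "cball x r \<subseteq> chart_codom c" using cm.controlledD[OF ctl] by auto
  let ?x0 = "chart_map c (\<sigma> 0)"
  define r' where "r' = norm (?x0 - x) + W 1 / sqrt m"
  have r': "r' < r" using short m by (simp add: r'_def field_simps)
  have "0 \<le> W 1" using W'(3)[of 0 1] W'(2) by simp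
  then have x0: "norm (?x0 - x) \<le> r'" using m by (simp add: r'_def)
  define B where "B = {s \<in> {0..1}. \<sigma> s \<in> - chart_ball c x r}"
  have "closed B"
    unfolding B_def using continuous_closed_preimage[OF W'(1) closed_atLeastAtMost, of "- chart_ball c x r"]
      open_chart_ball[OF c] by (simp add: vimage_def Int_def closed_Compl)
  moreover have "B \<subseteq> {0..1}" by (auto simp: B_def)
  then have "bounded B" by (rule bounded_subset[OF bounded_closed_interval])
  ultimately have "compact B" by (simp add: compact_eq_bounded_closed)
  moreover have "B \<noteq> {}" using t \<open>\<sigma> t \<notin> _\<close> by (auto simp: B_def)
  ultimately obtain q where q: "q \<in> B" "\<forall>s\<in>B. q \<le> s"
    using compact_attains_inf[of B] by auto
  have "\<sigma> 0 \<in> chart_ball c x r" using start x0 r' by (simp add: chart_ball_def)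
  then have q0: "0 < q" "q \<le> 1" using q(1) by (auto simp: B_def order.order_iff_strict)
  have before: "\<sigma> s \<in> chart_ball c x r" if "0 \<le> s" "s < q" for s
    using bspec[OF q(2), of s] that q0 by (auto simp: B_def)
  define D where "D = {p \<in> chart_dom c. norm (chart_map c p - x) \<le> r'}"
  have D: "closed D" unfolding D_def
    by (rule closed_chart_cball[OF c]) (use sub r' in auto)
  have inD: "\<sigma> s \<in> D" if s: "0 \<le> s" "s < q" for s
  proof -
    have "sqrt m * norm (chart_map c (\<sigma> s) - ?x0) \<le> W s"
      by (rule coordinate_displacement_le_length[OF c ctl W]) (use s q0 before in auto)
    also have "W s \<le> W 1" using W'(3)[of s 1] s q0 by simp
    finally have "norm (chart_map c (\<sigma> s) - ?x0) \<le> W 1 / sqrt m" using m by (simp add: field_simps)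
    then have "norm (chart_map c (\<sigma> s) - x) \<le> r'"
      using norm_triangle_ineq[of "chart_map c (\<sigma> s) - ?x0" "?x0 - x"] by (simp add: r'_def)
    then show ?thesis using before[OF s] by (simp add: D_def chart_ball_def)
  qed
  have "closed {s \<in> {0..1}. \<sigma> s \<in> D}"
    using continuous_closed_preimage[OF W'(1) closed_atLeastAtMost D] by (simp add: vimage_def Int_def)
  moreover have "{0..<q} \<subseteq> {s \<in> {0..1}. \<sigma> s \<in> D}" using inD q0 by auto
  ultimately have "closure {0..<q} \<subseteq> {s \<in> {0..1}. \<sigma> s \<in> D}" by (intro closure_minimal)
  then have "\<sigma> q \<in> D" using q0 by (auto simp: subset_iff)
  then have "\<sigma> q \<in> chart_ball c x r" using r' by (auto simp: D_def chart_ball_def)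
  then show False using q(1) by (simp add: B_def)
qed

end

section \<open>Short geodesics realize the distance\<close>

context riemannian_manifold
begin

lemma controlled_ball_exists:
  assumes c: "c \<in> A" "p \<in> chart_dom c" and U: "open U" "p \<in> U"
  shows "\<exists>R m C. 0 < R \<and> controlled_ball c (chart_map c p) R m C \<and> chart_ball c (chart_map c p) R \<subseteq> U"
proof -
  interpret cm: coordinate_metric "chart_codom c" "G c" by (rule coordinate_metric_chart[OF c(1)])
  let ?x = "chart_map c p"
  let ?V = "chart_codom c \<inter> chart_inv c -` U"
  have "open ?V"
    using continuous_open_preimage[OF chart_facts(4,2)[OF c(1)] U(1)] .
  moreover have "?x \<in> ?V" using chart_facts(5,6)[OF c] U by simp
  ultimately obtain R where R: "R > 0" "cball ?x R \<subseteq> ?V" using open_contains_cball by blast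
  obtain m C where "cm.controlled (cball ?x R) m C"
    using cm.controlled_exists[of "cball ?x R"] R(2) by auto
  moreover have "chart_ball c ?x R \<subseteq> U"
  proof
    fix q assume q: "q \<in> chart_ball c ?x R"
    then have "chart_map c q \<in> cball ?x R" by (auto simp: chart_ball_def dist_norm norm_minus_commute)
    then have "chart_inv c (chart_map c q) \<in> U" using R(2) by blast
    then show "q \<in> U" using q chart_facts(5)[OF c(1)] by (simp add: chart_ball_def)
  qed
  ultimately show ?thesis using R(1) by blast
qed

text \<open>
  The topology of the manifold is controlled by lengths of curves, locally uniformly in the
  starting point.
\<close>

lemma short_curves_stay_near:
  assumes "open U" "p \<in> U"
  obtains N r where "open N" "p \<in> N" "0 < r"
    "\<And>\<sigma>. piecewise_C1_curve \<sigma> 0 1 \<Longrightarrow> \<sigma> 0 \<in> N \<Longrightarrow> curve_length \<sigma> 0 1 < r \<Longrightarrow> \<sigma> 1 \<in> U"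
proof -
  define c where "c = chart_at p"
  have c: "c \<in> A" "p \<in> chart_dom c" unfolding c_def by (rule chart_at)+
  interpret cm: coordinate_metric "chart_codom c" "G c" by (rule coordinate_metric_chart[OF c(1)])
  let ?x = "chart_map c p"
  from controlled_ball_exists[OF c assms] obtain R m C where
    R: "0 < R" "controlled_ball c ?x R m C" "chart_ball c ?x R \<subseteq> U" by (elim exE conjE)
  have m: "m > 0" by (rule cm.controlledD(3)[OF R(2)])
  show ?thesis
  proof (rule that[of "chart_ball c ?x (R/2)" "sqrt m * (R / 2)"])
    show "open (chart_ball c ?x (R / 2))" by (rule open_chart_ball[OF c(1)])
    show "p \<in> chart_ball c ?x (R / 2)" using c R(1) by (simp add: chart_ball_def)
    show "0 < sqrt m * (R / 2)" using m R(1) by simp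
    fix \<sigma> assume \<sigma>: "piecewise_C1_curve \<sigma> 0 1" "\<sigma> 0 \<in> chart_ball c ?x (R / 2)"
      "curve_length \<sigma> 0 1 < sqrt m * (R / 2)"
    from piecewise_C1_curve_arclength[OF \<sigma>(1)] obtain F W where
      W: "arclength_data \<sigma> F W" "W 1 = curve_length \<sigma> 0 1" by (elim exE conjE)
    have "sqrt m * (R / 2) \<le> sqrt m * (R - norm (chart_map c (\<sigma> 0) - ?x))"
      using \<sigma>(2) m by (intro mult_left_mono) (auto simp: chart_ball_def)
    then have "\<sigma> 1 \<in> chart_ball c ?x R"
      using \<sigma> W by (intro short_curve_stays_in_chart_ball[OF c(1) R(2) W(1)]) (auto simp: chart_ball_def)
    then show "\<sigma> 1 \<in> U" using R(3) by blast
  qed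
qed

lemma geodesic_segment:
  assumes geo: "geodesic \<gamma>" and sp: "\<And>t. speed \<gamma> UNIV t = a"
  shows "piecewise_C1_curve (\<lambda>u. \<gamma> (s + h * u)) 0 1" "curve_length (\<lambda>u. \<gamma> (s + h * u)) 0 1 = \<bar>h\<bar> * a"
  using geodesic_piecewise_C1[OF geodesic_affine(1)[OF geo]] geodesic_affine(2)[OF geo] sp by simp_all

lemma geodesic_zero_speed_constant:
  assumes geo: "geodesic \<gamma>" and sp: "\<And>t. speed \<gamma> UNIV t = 0"
  shows "\<gamma> t = \<gamma> s"
proof (rule ccontr)
  assume "\<gamma> t \<noteq> \<gamma> s"
  then obtain U where U: "open U" "\<gamma> s \<in> U" "\<gamma> t \<notin> U" using separation_t1 by metis
  obtain N r where N: "open N" "\<gamma> s \<in> N" "0 < r"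
    "\<And>\<sigma>. piecewise_C1_curve \<sigma> 0 1 \<Longrightarrow> \<sigma> 0 \<in> N \<Longrightarrow> curve_length \<sigma> 0 1 < r \<Longrightarrow> \<sigma> 1 \<in> U"
    using short_curves_stay_near[OF U(1,2)] by metis
  have "\<gamma> t \<in> U"
    using N(4)[of "\<lambda>u. \<gamma> (s + (t - s) * u)"] geodesic_segment[OF geo sp, of s "t - s"] N(2,3) by simp
  then show False using U(3) by simp
qed

definition unit_geodesic :: "(real \<Rightarrow> 'm) \<Rightarrow> bool" where
  "unit_geodesic \<gamma> \<longleftrightarrow> geodesic \<gamma> \<and> (\<forall>t. speed \<gamma> UNIV t = 1)"

lemma unit_geodesic_segment:
  assumes "unit_geodesic \<gamma>"
  shows "piecewise_C1_curve (\<lambda>u. \<gamma> (s + h * u)) 0 1" "curve_length (\<lambda>u. \<gamma> (s + h * u)) 0 1 = \<bar>h\<bar>"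
  using geodesic_segment[of \<gamma> 1 s h] assms by (simp_all add: unit_geodesic_def)

lemma unit_geodesic_affine: "unit_geodesic \<gamma> \<Longrightarrow> \<bar>a\<bar> = 1 \<Longrightarrow> unit_geodesic (\<lambda>u. \<gamma> (s + a * u))"
  using geodesic_affine[of \<gamma> s a] by (simp add: unit_geodesic_def)

lemma unit_geodesic_stays_in_chart_ball:
  assumes c: "c \<in> A" and ctl: "controlled_ball c x R m C" and geo: "unit_geodesic \<gamma>"
    and s: "\<gamma> s \<in> chart_ball c x (R / 2)" and h: "\<bar>h\<bar> < sqrt m * (R / 2)"
  shows "\<gamma> (s + h) \<in> chart_ball c x R"
proof -
  interpret cm: coordinate_metric "chart_codom c" "G c" by (rule coordinate_metric_chart[OF c])
  let ?\<sigma> = "\<lambda>u. \<gamma> (s + h * u)"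
  note seg = unit_geodesic_segment[OF geo, of s h]
  from piecewise_C1_curve_arclength[OF seg(1)] obtain F W where
    W: "arclength_data ?\<sigma> F W" "W 1 = curve_length ?\<sigma> 0 1" by (elim exE conjE)
  have "sqrt m * (R / 2) \<le> sqrt m * (R - norm (chart_map c (\<gamma> s) - x))"
    using s cm.controlledD(3)[OF ctl] by (intro mult_left_mono) (auto simp: chart_ball_def)
  then have "?\<sigma> 1 \<in> chart_ball c x R"
    using W(2) seg(2) s h
    by (intro short_curve_stays_in_chart_ball[OF c ctl W(1)]) (auto simp: chart_ball_def)
  then show ?thesis by simp
qed

lemma riem_dist_le: "piecewise_C1_curve \<sigma> 0 1 \<Longrightarrow> riem_dist (\<sigma> 0) (\<sigma> 1) \<le> curve_length \<sigma> 0 1"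
  unfolding riem_dist_def
  by (rule cInf_lower) (auto simp: bdd_below_def intro!: exI[of _ 0] curve_length_nonneg)

text \<open>
  The curve \<open>\<beta>\<close> guarantees that the infimum is taken over a nonempty set.
\<close>

lemma riem_dist_lessE:
  assumes "riem_dist p q < r" "piecewise_C1_curve \<beta> 0 1" "\<beta> 0 = p" "\<beta> 1 = q"
  obtains \<sigma> where "piecewise_C1_curve \<sigma> 0 1" "\<sigma> 0 = p" "\<sigma> 1 = q" "curve_length \<sigma> 0 1 < r"
proof -
  let ?S = "{curve_length \<gamma> 0 1 |\<gamma>. piecewise_C1_curve \<gamma> 0 1 \<and> \<gamma> 0 = p \<and> \<gamma> 1 = q}"
  have "?S \<noteq> {}" using assms by blast
  then obtain l where "l \<in> ?S" "l < r"
    using assms(1) unfolding riem_dist_def by (meson cInf_lessD)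
  then show ?thesis using that by blast
qed

lemma unit_geodesic_dist_le:
  assumes "unit_geodesic \<gamma>"
  shows "riem_dist (\<gamma> s) (\<gamma> t) \<le> \<bar>t - s\<bar>"
  using riem_dist_le[OF unit_geodesic_segment(1)[OF assms, of s "t - s"]]
    unit_geodesic_segment(2)[OF assms, of s "t - s"] by simp

lemma unit_geodesic_dist_lessE:
  assumes "unit_geodesic \<gamma>" "riem_dist (\<gamma> s) (\<gamma> t) < r"
  obtains \<sigma> where "piecewise_C1_curve \<sigma> 0 1" "\<sigma> 0 = \<gamma> s" "\<sigma> 1 = \<gamma> t" "curve_length \<sigma> 0 1 < r"
  using riem_dist_lessE[OF assms(2) unit_geodesic_segment(1)[OF assms(1), of s "t - s"]] by auto

text \<open>
  A curve shorter than the geodesic segment cannot leave the chart ball, and inside the ball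
  \<open>short_geodesic_minimizes_length\<close> applies.
\<close>

lemma unit_geodesic_locally_minimizing:
  obtains N e where "open N" "p \<in> N" "0 < e"
    "\<And>\<gamma> h. unit_geodesic \<gamma> \<Longrightarrow> \<gamma> 0 \<in> N \<Longrightarrow> 0 < h \<Longrightarrow> h < e \<Longrightarrow> riem_dist (\<gamma> 0) (\<gamma> h) = h"
proof -
  define c where "c = chart_at p"
  have c: "c \<in> A" "p \<in> chart_dom c" unfolding c_def by (rule chart_at)+
  interpret cm: coordinate_metric "chart_codom c" "G c" by (rule coordinate_metric_chart[OF c(1)])
  let ?x = "chart_map c p"
  from controlled_ball_exists[OF c open_UNIV UNIV_I] obtain R m C where
    R: "0 < R" "controlled_ball c ?x R m C" by (elim exE conjE)
  have m: "m > 0" and C: "C \<ge> 0" using cm.controlledD[OF R(2)] by auto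
  define \<kappa> where "\<kappa> = 2 * C\<^sup>2 / m\<^sup>2 + C / m"
  have \<kappa>: "0 \<le> \<kappa>" using m C by (simp add: \<kappa>_def)
  \<comment> \<open>the first bound keeps short curves in the ball, the second makes the quadratic terms nonnegative\<close>
  define e where "e = min (sqrt m * (R / 2)) (sqrt (m / (2 * \<kappa> + 1)))"
  have e: "0 < e" using m R(1) \<kappa> by (simp add: e_def)
  have ball: "q \<in> chart_ball c ?x R \<Longrightarrow> chart_map c q \<in> cball ?x R" for q
    by (auto simp: chart_ball_def dist_norm norm_minus_commute)
  show ?thesis
  proof (rule that[of "chart_ball c ?x (R/2)" e])
    show "open (chart_ball c ?x (R / 2))" by (rule open_chart_ball[OF c(1)])
    show "p \<in> chart_ball c ?x (R / 2)" using c R(1) by (simp add: chart_ball_def)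
    show "0 < e" by (rule e)
    fix \<gamma> h assume geo: "unit_geodesic \<gamma>" and start: "\<gamma> 0 \<in> chart_ball c ?x (R / 2)"
      and h: "0 < h" "h < e"
    have geo': "geodesic \<gamma>" using geo by (simp add: unit_geodesic_def)
    have stay: "\<gamma> s \<in> chart_ball c ?x R" if "s \<in> {0..h}" for s
      using unit_geodesic_stays_in_chart_ball[OF c(1) R(2) geo start, of s] that h by (simp add: e_def)
    have dom: "\<gamma> s \<in> chart_dom c" if "s \<in> {0..h}" for s using stay[OF that] by (simp add: chart_ball_def)
    have h2: "2 * (2 * C\<^sup>2 / m\<^sup>2 + C / m) * h\<^sup>2 \<le> m"
    proof -
      have "h\<^sup>2 \<le> (sqrt (m / (2 * \<kappa> + 1)))\<^sup>2" using h by (intro power_mono) (auto simp: e_def)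
      also have "\<dots> = m / (2 * \<kappa> + 1)" using m \<kappa> by simp
      finally have "(2 * \<kappa> + 1) * h\<^sup>2 \<le> m" using \<kappa> by (simp add: field_simps)
      moreover have "(2 * \<kappa> + 1) * h\<^sup>2 = 2 * \<kappa> * h\<^sup>2 + h\<^sup>2" by (simp add: algebra_simps)
      ultimately have "2 * \<kappa> * h\<^sup>2 \<le> m" using zero_le_power2[of h] by linarith
      then show ?thesis by (simp add: \<kappa>_def)
    qed
    have lower: "h \<le> curve_length \<sigma> 0 1"
      if \<sigma>: "piecewise_C1_curve \<sigma> 0 1" "\<sigma> 0 = \<gamma> 0" "\<sigma> 1 = \<gamma> h" for \<sigma>
    proof (rule ccontr)
      assume short: "\<not> h \<le> curve_length \<sigma> 0 1"
      from piecewise_C1_curve_arclength[OF \<sigma>(1)] obtain F W where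
        W: "arclength_data \<sigma> F W" "W 1 = curve_length \<sigma> 0 1" by (elim exE conjE)
      have W': "finite F" "continuous_on {0..1} \<sigma>" "continuous_on {0..1} W" "W 0 = 0"
        "\<And>s t. 0 \<le> s \<Longrightarrow> s \<le> t \<Longrightarrow> t \<le> 1 \<Longrightarrow> W s \<le> W t"
        "\<And>t. t \<in> {0<..<1} - F \<Longrightarrow> \<sigma> t \<in> chart_dom c \<Longrightarrow>
            ((chart_map c \<circ> \<sigma>) has_vector_derivative velocity c \<sigma> UNIV t) (at t)"
        "\<And>t. t \<in> {0<..<1} - F \<Longrightarrow> \<sigma> t \<in> chart_dom c \<Longrightarrow>
            (W has_real_derivative
               sqrt (G c (chart_map c (\<sigma> t)) (velocity c \<sigma> UNIV t) (velocity c \<sigma> UNIV t))) (at t)"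
        using W c(1) unfolding arclength_data_def by blast+
      have "sqrt m * (R / 2) \<le> sqrt m * (R - norm (chart_map c (\<sigma> 0) - ?x))"
        using start \<sigma>(2) m by (intro mult_left_mono) (auto simp: chart_ball_def)
      then have \<sigma>in: "\<sigma> t \<in> chart_ball c ?x R" if "t \<in> {0..1}" for t
        using that dom[of 0] \<sigma>(2) short h W(2)
        by (intro short_curve_stays_in_chart_ball[OF c(1) R(2) W(1)]) (auto simp: e_def)
      have \<sigma>dom: "\<sigma> t \<in> chart_dom c" if "t \<in> {0..1}" for t using \<sigma>in[OF that] by (simp add: chart_ball_def)
      have "h \<le> W 1"
      proof (rule cm.short_geodesic_minimizes_length[OF R(2) h(1) h2,
            where x = "chart_map c \<circ> \<gamma>" and v = "velocity c \<gamma> UNIV" and \<sigma> = "chart_map c \<circ> \<sigma>"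
              and \<sigma>' = "velocity c \<sigma> UNIV" and F = F])
        fix s assume s: "s \<in> {0..h}"
        show "(chart_map c \<circ> \<gamma>) s \<in> cball ?x R" using ball[OF stay[OF s]] by simp
        show "((chart_map c \<circ> \<gamma>) has_vector_derivative velocity c \<gamma> UNIV s) (at s)"
          by (rule geodesic_in_chart(1)[OF geo' c(1) dom[OF s]])
        show "(velocity c \<gamma> UNIV has_vector_derivative
            cm.acc ((chart_map c \<circ> \<gamma>) s) (velocity c \<gamma> UNIV s)) (at s)"
          using geodesic_in_chart(2)[OF geo' c(1) dom[OF s]] by simp
        have "sqrt (G c (chart_map c (\<gamma> s)) (velocity c \<gamma> UNIV s) (velocity c \<gamma> UNIV s)) = 1"
          using geodesic_speed[OF geo' c(1) dom[OF s]] geo by (simp add: unit_geodesic_def)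
        then show "G c ((chart_map c \<circ> \<gamma>) s) (velocity c \<gamma> UNIV s) (velocity c \<gamma> UNIV s) = 1"
          by simp
      next
        show "continuous_on {0..1} (chart_map c \<circ> \<sigma>)"
          unfolding o_def
          by (rule continuous_on_compose2[OF chart_facts(3)[OF c(1)] W'(2)]) (use \<sigma>dom in auto)
        show "(chart_map c \<circ> \<sigma>) t \<in> cball ?x R" if "t \<in> {0..1}" for t
          using ball[OF \<sigma>in[OF that]] by simp
        show "0 \<le> W t \<and> W t \<le> W 1" if "t \<in> {0..1}" for t
          using W'(4) W'(5)[of 0 t] W'(5)[of t 1] that by simp
        fix t assume t: "t \<in> {0<..<1} - F"
        then have d: "\<sigma> t \<in> chart_dom c" by (intro \<sigma>dom) auto
        show "((chart_map c \<circ> \<sigma>) has_vector_derivative velocity c \<sigma> UNIV t) (at t)"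
          by (rule W'(6)[OF t d])
        show "(W has_real_derivative
           sqrt (G c ((chart_map c \<circ> \<sigma>) t) (velocity c \<sigma> UNIV t) (velocity c \<sigma> UNIV t))) (at t)"
          using W'(7)[OF t d] by simp
      qed (use W' \<sigma> in auto)
      then show False using short W(2) by simp
    qed
    show "riem_dist (\<gamma> 0) (\<gamma> h) = h"
    proof (rule antisym)
      show "riem_dist (\<gamma> 0) (\<gamma> h) \<le> h" using unit_geodesic_dist_le[OF geo, of 0 h] h by simp
      show "h \<le> riem_dist (\<gamma> 0) (\<gamma> h)"
      proof (rule ccontr)
        assume "\<not> h \<le> riem_dist (\<gamma> 0) (\<gamma> h)"
        then have "riem_dist (\<gamma> 0) (\<gamma> h) < h" by simp
        from unit_geodesic_dist_lessE[OF geo this] lower show False by (metis not_less)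
      qed
    qed
  qed
qed

end

context closed_riemannian_manifold
begin

lemma unit_geodesic_minimizing_uniform:
  obtains e where "0 < e"
    "\<And>\<gamma> s h. unit_geodesic \<gamma> \<Longrightarrow> h \<noteq> 0 \<Longrightarrow> \<bar>h\<bar> < e \<Longrightarrow> riem_dist (\<gamma> s) (\<gamma> (s + h)) = \<bar>h\<bar>"
proof -
  have "\<forall>p. \<exists>N e. open N \<and> p \<in> N \<and> 0 < e \<and> (\<forall>\<gamma> h. unit_geodesic \<gamma> \<longrightarrow> \<gamma> 0 \<in> N \<longrightarrow> 0 < h \<longrightarrow> h < e \<longrightarrow>
    riem_dist (\<gamma> 0) (\<gamma> h) = h)" (is "\<forall>p. \<exists>N e. ?P p N e")
  proof
    fix p
    obtain N e where "open N" "p \<in> N" "0 < e"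
      "\<And>\<gamma> h. unit_geodesic \<gamma> \<Longrightarrow> \<gamma> 0 \<in> N \<Longrightarrow> 0 < h \<Longrightarrow> h < e \<Longrightarrow> riem_dist (\<gamma> 0) (\<gamma> h) = h"
      by (rule unit_geodesic_locally_minimizing[of p]) blast
    then show "\<exists>N e. ?P p N e" by (intro exI[of _ N] exI[of _ e]) simp
  qed
  then obtain N e where Ne: "\<forall>p. ?P p (N p) (e p)" unfolding choice_iff by (elim exE)
  have N: "open (N p)" "p \<in> N p" "0 < e p" for p using Ne by simp_all
  have "UNIV \<subseteq> (\<Union>p\<in>UNIV. N p)" using N(2) by auto
  then obtain D where D: "finite D" "UNIV \<subseteq> (\<Union>p\<in>D. N p)"
    using compactE_image[OF compact_manifold, of UNIV N] N(1) by auto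
  have "D \<noteq> {}" using D(2) by auto
  define e0 where "e0 = Min (e ` D)"
  have e0: "0 < e0" unfolding e0_def using D(1) \<open>D \<noteq> {}\<close> N(3) by simp
  have pos: "riem_dist (\<gamma> 0) (\<gamma> h) = h" if geo: "unit_geodesic \<gamma>" and h: "0 < h" "h < e0" for \<gamma> h
  proof -
    obtain p where p: "p \<in> D" "\<gamma> 0 \<in> N p" using D(2) by blast
    have "e0 \<le> e p" unfolding e0_def using D(1) p(1) by simp
    then show ?thesis using spec[OF Ne, of p] geo h p(2) by simp
  qed
  show ?thesis
  proof (rule that[OF e0])
    fix \<gamma> s h assume geo: "unit_geodesic \<gamma>" and h: "h \<noteq> 0" "\<bar>h\<bar> < e0"
    have "unit_geodesic (\<lambda>u. \<gamma> (s + sgn h * u))"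
      using h by (intro unit_geodesic_affine[OF geo]) (simp add: sgn_if)
    from pos[OF this, of "\<bar>h\<bar>"] h show "riem_dist (\<gamma> s) (\<gamma> (s + h)) = \<bar>h\<bar>"
      by (simp add: sgn_mult_abs)
  qed
qed

end

section \<open>Pointwise limits of geodesics\<close>

text \<open>
  A substitute for convergent subsequences that also works in compact spaces which are not
  sequentially compact, such as the space of all functions from the reals to the manifold.
\<close>

lemma cluster_subfilter:
  assumes K: "compact K" and F: "F \<noteq> bot" "\<forall>\<^sub>F n in F. f n \<in> K"
  shows "\<exists>l\<in>K. \<exists>H. H \<le> F \<and> H \<noteq> bot \<and> (f \<longlongrightarrow> l) H"
proof -
  have "filtermap f F \<noteq> bot" "\<forall>\<^sub>F y in filtermap f F. y \<in> K"
    using F by (auto simp: filtermap_bot_iff eventually_filtermap)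
  then obtain l where l: "l \<in> K" "inf (nhds l) (filtermap f F) \<noteq> bot"
    using K unfolding compact_filter by blast
  define H where "H = inf F (filtercomap f (nhds l))"
  have "(f \<longlongrightarrow> l) (filtercomap f (nhds l))" by (rule filterlim_filtercomap)
  then have "(f \<longlongrightarrow> l) H" unfolding H_def by (rule tendsto_mono[rotated]) simp
  moreover have "H \<noteq> bot"
  proof
    assume "H = bot"
    then have "\<forall>\<^sub>F n in H. False" by simp
    then obtain P Q where PQ: "eventually P F" "eventually Q (nhds l)" "\<And>n. P n \<Longrightarrow> \<not> Q (f n)"
      unfolding H_def eventually_inf eventually_filtercomap by blast
    have "\<forall>\<^sub>F y in filtermap f F. \<not> Q y"
      unfolding eventually_filtermap using PQ(1) by eventually_elim (rule PQ(3))
    then have "\<forall>\<^sub>F y in inf (nhds l) (filtermap f F). False"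
      unfolding eventually_inf using PQ(2) by blast
    then show False using l(2) by (simp add: trivial_limit_def)
  qed
  ultimately show ?thesis using l(1) by (intro bexI[of _ l] exI[of _ H]) (auto simp: H_def)
qed

lemma has_vector_derivative_if_quadratic:
  fixes f :: "real \<Rightarrow> 'a::real_normed_vector"
  assumes I: "open I" "s \<in> I"
    and q: "\<And>t. t \<in> I \<Longrightarrow> norm (f t - f s - (t - s) *\<^sub>R l) \<le> B * \<bar>t - s\<bar>\<^sup>2"
  shows "(f has_vector_derivative l) (at s)"
proof -
  obtain e where e: "e > 0" "ball s e \<subseteq> I" using I open_contains_ball by blast
  show ?thesis unfolding has_vector_derivative_def
  proof (rule has_derivativeI_sandwich[OF e(1), where H = "\<lambda>t. B * \<bar>t - s\<bar>"])
    show "bounded_linear (\<lambda>a. a *\<^sub>R l)" by (rule bounded_linear_scaleR_left)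
    show "((\<lambda>t. B * \<bar>t - s\<bar>) \<longlongrightarrow> 0) (at s)"
      by (auto intro!: tendsto_eq_intros)
    fix t assume t: "t \<noteq> s" "dist t s < e"
    then have "norm (f t - f s - (t - s) *\<^sub>R l) \<le> B * \<bar>t - s\<bar>\<^sup>2"
      using e by (intro q) (auto simp: dist_commute)
    then show "norm (f t - f s - (t - s) *\<^sub>R l) / norm (t - s) \<le> B * \<bar>t - s\<bar>"
      using t by (simp add: divide_le_eq power2_eq_square mult_ac)
  qed
qed

lemma norm_increment_le:
  fixes f :: "real \<Rightarrow> 'a::real_normed_vector"
  assumes der: "\<And>u. u \<in> closed_segment s t \<Longrightarrow> (f has_vector_derivative f' u) (at u)"
    and B: "\<And>u. u \<in> closed_segment s t \<Longrightarrow> norm (f' u - f' s) \<le> B"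
  shows "norm (f t - f s - (t - s) *\<^sub>R f' s) \<le> \<bar>t - s\<bar> * B"
  using vector_differentiable_bound_linearization[of "closed_segment s t" f f' s t s B] assms
  by (auto intro: has_vector_derivative_at_within)

text \<open>
  Splitting off the linear term of \<open>norm_increment_le\<close> costs a factor 3, where the mean value
  inequality would give 1.
\<close>

lemma norm_increment_le':
  fixes f :: "real \<Rightarrow> 'a::real_normed_vector"
  assumes der: "\<And>u. u \<in> closed_segment s t \<Longrightarrow> (f has_vector_derivative f' u) (at u)"
    and B: "\<And>u. u \<in> closed_segment s t \<Longrightarrow> norm (f' u) \<le> B"
  shows "norm (f t - f s) \<le> 3 * B * \<bar>t - s\<bar>"
proof -
  have "norm (f t - f s - (t - s) *\<^sub>R f' s) \<le> \<bar>t - s\<bar> * (2 * B)"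
  proof (rule norm_increment_le[OF der])
    fix u assume "u \<in> closed_segment s t"
    then show "norm (f' u - f' s) \<le> 2 * B"
      using B[of u] B[of s] norm_triangle_ineq4[of "f' u" "f' s"] by simp
  qed
  moreover have "norm ((t - s) *\<^sub>R f' s) \<le> \<bar>t - s\<bar> * B"
    using B[of s] by (simp add: mult_left_mono)
  moreover have "norm (f t - f s) \<le> norm (f t - f s - (t - s) *\<^sub>R f' s) + norm ((t - s) *\<^sub>R f' s)"
    using norm_triangle_ineq[of "f t - f s - (t - s) *\<^sub>R f' s" "(t - s) *\<^sub>R f' s"] by simp
  ultimately show ?thesis by (simp add: algebra_simps)
qed

context coordinate_metric
begin

definition unit_geodesic_on :: "'e set \<Rightarrow> real set \<Rightarrow> (real \<Rightarrow> 'e) \<Rightarrow> (real \<Rightarrow> 'e) \<Rightarrow> bool" where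
  "unit_geodesic_on K I x v \<longleftrightarrow> (\<forall>s\<in>I. x s \<in> K \<and> (x has_vector_derivative v s) (at s) \<and>
     (v has_vector_derivative acc (x s) (v s)) (at s) \<and> g (x s) (v s) (v s) = 1)"

text \<open>
  Taylor estimates whose constants are common to all unit speed geodesics in \<open>K\<close>. Being
  inequalities between values of \<open>x\<close>, \<open>v\<close> and the acceleration, they are inherited by pointwise
  limits.
\<close>

lemma unit_geodesic_estimates:
  assumes ctl: "controlled K c C" and I: "convex I"
  obtains M B E where
    "\<And>x v s. unit_geodesic_on K I x v \<Longrightarrow> s \<in> I \<Longrightarrow> norm (v s) \<le> M"
    "\<And>x v s t. unit_geodesic_on K I x v \<Longrightarrow> s \<in> I \<Longrightarrow> t \<in> I \<Longrightarrow>
       norm (x t - x s - (t - s) *\<^sub>R v s) \<le> B * \<bar>t - s\<bar>\<^sup>2"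
    "\<And>x v s t. unit_geodesic_on K I x v \<Longrightarrow> s \<in> I \<Longrightarrow> t \<in> I \<Longrightarrow>
       norm (v t - v s - (t - s) *\<^sub>R acc (x s) (v s)) \<le> E * \<bar>t - s\<bar>\<^sup>2"
proof -
  have c: "c > 0" and C: "C \<ge> 0" using controlledD[OF ctl] by auto
  define M where "M = 1 / sqrt c"
  define B0 where "B0 = 3 * C / (2 * c) * M\<^sup>2"
  define B where "B = 3 * B0"
  from acc_lipschitz[OF ctl, of M] obtain D where D: "0 \<le> D"
    "\<forall>x\<in>K. \<forall>y\<in>K. \<forall>v w. norm v \<le> M \<longrightarrow> norm w \<le> M \<longrightarrow>
      norm (acc x v - acc y w) \<le> D * (norm (x - y) + norm (v - w))" by (elim exE conjE)
  define E where "E = D * (3 * M + B)"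
  have M0: "0 \<le> M" using c by (simp add: M_def)
  have B0: "0 \<le> B" using c C by (simp add: B_def B0_def)
  have seg: "closed_segment s t \<subseteq> I" if "s \<in> I" "t \<in> I" for s t
    using I that by (simp add: closed_segment_subset)
  have geoD: "x s \<in> K" "(x has_vector_derivative v s) (at s)"
    "(v has_vector_derivative acc (x s) (v s)) (at s)" "g (x s) (v s) (v s) = 1"
    if "unit_geodesic_on K I x v" "s \<in> I" for x v s
    using that unfolding unit_geodesic_on_def by blast+
  have M: "norm (v s) \<le> M" if "unit_geodesic_on K I x v" "s \<in> I" for x v s
    using controlled_norm_le[OF ctl geoD(1)[OF that], of "v s"] geoD(4)[OF that] c
    by (simp add: M_def field_simps)
  have aB: "norm (acc (x s) (v s)) \<le> B0" if "unit_geodesic_on K I x v" "s \<in> I" for x v s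
  proof -
    have "norm (acc (x s) (v s)) \<le> 3 * C / (2 * c) * (norm (v s))\<^sup>2"
      by (rule acc_bound[OF ctl geoD(1)[OF that]])
    also have "\<dots> \<le> B0"
      unfolding B0_def using M[OF that] c C by (intro mult_left_mono power_mono) auto
    finally show ?thesis .
  qed
  have vlip: "norm (v t - v s) \<le> B * \<bar>t - s\<bar>"
    if geo: "unit_geodesic_on K I x v" and st: "s \<in> I" "t \<in> I" for x v s t
    unfolding B_def
  proof (rule norm_increment_le')
    fix u assume "u \<in> closed_segment s t"
    then have u: "u \<in> I" using seg[OF st] by blast
    show "(v has_vector_derivative acc (x u) (v u)) (at u)" by (rule geoD(3)[OF geo u])
    show "norm (acc (x u) (v u)) \<le> B0" by (rule aB[OF geo u])
  qed
  have xlip: "norm (x t - x s) \<le> 3 * M * \<bar>t - s\<bar>"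
    if geo: "unit_geodesic_on K I x v" and st: "s \<in> I" "t \<in> I" for x v s t
  proof (rule norm_increment_le')
    fix u assume "u \<in> closed_segment s t"
    then have u: "u \<in> I" using seg[OF st] by blast
    show "(x has_vector_derivative v u) (at u)" by (rule geoD(2)[OF geo u])
    show "norm (v u) \<le> M" by (rule M[OF geo u])
  qed
  have within: "\<bar>u - s\<bar> \<le> \<bar>t - s\<bar>" if "u \<in> closed_segment s t" for u s t :: real
    using segment_bound1[OF that] by simp
  show ?thesis
  proof (rule that[of M B E])
    show "norm (v s) \<le> M" if "unit_geodesic_on K I x v" "s \<in> I" for x v s by (rule M[OF that])
    show "norm (x t - x s - (t - s) *\<^sub>R v s) \<le> B * \<bar>t - s\<bar>\<^sup>2"
      if geo: "unit_geodesic_on K I x v" and st: "s \<in> I" "t \<in> I" for x v s t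
    proof -
      have "norm (x t - x s - (t - s) *\<^sub>R v s) \<le> \<bar>t - s\<bar> * (B * \<bar>t - s\<bar>)"
      proof (rule norm_increment_le)
        fix u assume us: "u \<in> closed_segment s t"
        then have u: "u \<in> I" using seg[OF st] by blast
        show "(x has_vector_derivative v u) (at u)" by (rule geoD(2)[OF geo u])
        have "norm (v u - v s) \<le> B * \<bar>u - s\<bar>" by (rule vlip[OF geo st(1) u])
        also have "\<dots> \<le> B * \<bar>t - s\<bar>" using within[OF us] B0 by (rule mult_left_mono)
        finally show "norm (v u - v s) \<le> B * \<bar>t - s\<bar>" .
      qed
      then show ?thesis by (simp add: power2_eq_square mult_ac)
    qed
    show "norm (v t - v s - (t - s) *\<^sub>R acc (x s) (v s)) \<le> E * \<bar>t - s\<bar>\<^sup>2"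
      if geo: "unit_geodesic_on K I x v" and st: "s \<in> I" "t \<in> I" for x v s t
    proof -
      have "norm (v t - v s - (t - s) *\<^sub>R acc (x s) (v s)) \<le> \<bar>t - s\<bar> * (E * \<bar>t - s\<bar>)"
      proof (rule norm_increment_le[where f' = "\<lambda>u. acc (x u) (v u)"])
        fix u assume us: "u \<in> closed_segment s t"
        then have u: "u \<in> I" using seg[OF st] by blast
        show "(v has_vector_derivative acc (x u) (v u)) (at u)" by (rule geoD(3)[OF geo u])
        have "norm (acc (x u) (v u) - acc (x s) (v s)) \<le> D * (norm (x u - x s) + norm (v u - v s))"
          using D(2) geoD(1)[OF geo u] geoD(1)[OF geo st(1)] M[OF geo u] M[OF geo st(1)] by blast
        also have "\<dots> \<le> D * (3 * M * \<bar>t - s\<bar> + B * \<bar>t - s\<bar>)"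
        proof (intro mult_left_mono add_mono D(1))
          show "norm (x u - x s) \<le> 3 * M * \<bar>t - s\<bar>"
            using xlip[OF geo st(1) u] mult_left_mono[OF within[OF us], of "3 * M"] M0 by linarith
          show "norm (v u - v s) \<le> B * \<bar>t - s\<bar>"
            using vlip[OF geo st(1) u] mult_left_mono[OF within[OF us], of B] B0 by linarith
        qed
        also have "\<dots> = E * \<bar>t - s\<bar>" by (simp add: E_def algebra_simps)
        finally show "norm (acc (x u) (v u) - acc (x s) (v s)) \<le> E * \<bar>t - s\<bar>" .
      qed
      then show ?thesis by (simp add: power2_eq_square mult_ac)
    qed
  qed
qed

text \<open>
  Only the curves are assumed to converge. Their velocities are bounded, hence have cluster
  points, and by the first Taylor estimate every cluster point at \<open>s\<close> is the derivative of the
  limit curve at \<open>s\<close>. Thus the velocities of the limit are known along a subfilter chosen for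
  any one or two parameters, and the second Taylor estimate passes to the limit and contains the
  geodesic equation.
\<close>

lemma unit_geodesic_on_pointwise_limit:
  assumes ctl: "controlled K c C" and K: "closed K" and I: "convex I" "open I"
    and F: "F \<noteq> bot" and ev: "\<forall>\<^sub>F n in F. unit_geodesic_on K I (X n) (V n)"
    and lim: "\<And>s. s \<in> I \<Longrightarrow> ((\<lambda>n. X n s) \<longlongrightarrow> x s) F"
  shows "\<exists>v. unit_geodesic_on K I x v"
proof -
  obtain M B E where est:
    "\<And>x v s. unit_geodesic_on K I x v \<Longrightarrow> s \<in> I \<Longrightarrow> norm (v s) \<le> M"
    "\<And>x v s t. unit_geodesic_on K I x v \<Longrightarrow> s \<in> I \<Longrightarrow> t \<in> I \<Longrightarrow>
       norm (x t - x s - (t - s) *\<^sub>R v s) \<le> B * \<bar>t - s\<bar>\<^sup>2"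
    "\<And>x v s t. unit_geodesic_on K I x v \<Longrightarrow> s \<in> I \<Longrightarrow> t \<in> I \<Longrightarrow>
       norm (v t - v s - (t - s) *\<^sub>R acc (x s) (v s)) \<le> E * \<bar>t - s\<bar>\<^sup>2"
    by (rule unit_geodesic_estimates[OF ctl I(1)]) blast
  from acc_lipschitz[OF ctl, of M] obtain D where D: "0 \<le> D"
    "\<forall>x\<in>K. \<forall>y\<in>K. \<forall>v w. norm v \<le> M \<longrightarrow> norm w \<le> M \<longrightarrow>
      norm (acc x v - acc y w) \<le> D * (norm (x - y) + norm (v - w))" by (elim exE conjE)
  have XK: "\<forall>\<^sub>F n in F. X n s \<in> K" if "s \<in> I" for s
    using ev by eventually_elim (use that in \<open>simp add: unit_geodesic_on_def\<close>)
  have xK: "x s \<in> K" if "s \<in> I" for s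
    by (rule Lim_in_closed_set[OF K XK[OF that] F lim[OF that]])
  have VM: "\<forall>\<^sub>F n in F. norm (V n s) \<le> M" if "s \<in> I" for s
    using ev by eventually_elim (rule est(1)[OF _ that])
  define v where "v s = vector_derivative x (at s)" for s
  have main: "(x has_vector_derivative v s) (at s) \<and> norm (v s) \<le> M \<and>
      (\<exists>H'. H' \<le> H \<and> H' \<noteq> bot \<and> ((\<lambda>n. V n s) \<longlongrightarrow> v s) H')"
    if s: "s \<in> I" and H: "H \<le> F" "H \<noteq> bot" for s H
  proof -
    have "\<forall>\<^sub>F n in H. V n s \<in> cball 0 M"
      using filter_leD[OF H(1) VM[OF s]] by simp
    from cluster_subfilter[OF compact_cball H(2) this] obtain l H' where
      l: "l \<in> cball 0 M" and H': "H' \<le> H" "H' \<noteq> bot" "((\<lambda>n. V n s) \<longlongrightarrow> l) H'"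
      by (elim bexE exE conjE)
    have H'F: "H' \<le> F" using H H' by simp
    have "norm (x t - x s - (t - s) *\<^sub>R l) \<le> B * \<bar>t - s\<bar>\<^sup>2" if t: "t \<in> I" for t
    proof (rule Lim_norm_ubound[OF H'(2)])
      show "((\<lambda>n. X n t - X n s - (t - s) *\<^sub>R V n s) \<longlongrightarrow> x t - x s - (t - s) *\<^sub>R l) H'"
        by (intro tendsto_intros H' tendsto_mono[OF H'F] lim s t)
      show "\<forall>\<^sub>F n in H'. norm (X n t - X n s - (t - s) *\<^sub>R V n s) \<le> B * \<bar>t - s\<bar>\<^sup>2"
        using filter_leD[OF H'F ev] by eventually_elim (rule est(2)[OF _ s t])
    qed
    then have xl: "(x has_vector_derivative l) (at s)"
      by (rule has_vector_derivative_if_quadratic[OF I(2) s])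
    then have "v s = l" unfolding v_def by (rule vector_derivative_at)
    then show ?thesis using xl l H' by auto
  qed
  have xv: "(x has_vector_derivative v s) (at s)" and vM: "norm (v s) \<le> M" if "s \<in> I" for s
    using main[OF that order_refl F] by blast+
  have vq: "norm (v t - v s - (t - s) *\<^sub>R acc (x s) (v s)) \<le> E * \<bar>t - s\<bar>\<^sup>2"
    if s: "s \<in> I" and t: "t \<in> I" for s t
  proof -
    from main[OF s order_refl F] obtain H1 where
      H1: "H1 \<le> F" "H1 \<noteq> bot" "((\<lambda>n. V n s) \<longlongrightarrow> v s) H1" by (elim exE conjE)
    from main[OF t H1(1,2)] obtain H where
      H: "H \<le> H1" "H \<noteq> bot" "((\<lambda>n. V n t) \<longlongrightarrow> v t) H" by (elim exE conjE)
    have HF: "H \<le> F" using H H1 by simp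
    have Vs: "((\<lambda>n. V n s) \<longlongrightarrow> v s) H" by (rule tendsto_mono[OF H(1) H1(3)])
    have Xs: "((\<lambda>n. X n s) \<longlongrightarrow> x s) H" by (rule tendsto_mono[OF HF lim[OF s]])
    have "((\<lambda>n. acc (X n s) (V n s) - acc (x s) (v s)) \<longlongrightarrow> 0) H"
    proof (rule Lim_null_comparison)
      show "\<forall>\<^sub>F n in H. norm (acc (X n s) (V n s) - acc (x s) (v s))
          \<le> D * (norm (X n s - x s) + norm (V n s - v s))"
        using filter_leD[OF HF XK[OF s]] filter_leD[OF HF VM[OF s]]
        by eventually_elim (use D(2) xK[OF s] vM[OF s] in blast)
      have "((\<lambda>n. D * (norm (X n s - x s) + norm (V n s - v s))) \<longlongrightarrow>
          D * (norm (x s - x s) + norm (v s - v s))) H"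
        by (intro tendsto_intros Xs Vs)
      then show "((\<lambda>n. D * (norm (X n s - x s) + norm (V n s - v s))) \<longlongrightarrow> 0) H" by simp
    qed
    then have acc: "((\<lambda>n. acc (X n s) (V n s)) \<longlongrightarrow> acc (x s) (v s)) H"
      by (rule LIM_zero_cancel)
    show ?thesis
    proof (rule Lim_norm_ubound[OF H(2)])
      show "((\<lambda>n. V n t - V n s - (t - s) *\<^sub>R acc (X n s) (V n s)) \<longlongrightarrow>
          v t - v s - (t - s) *\<^sub>R acc (x s) (v s)) H"
        by (intro tendsto_intros H(3) Vs acc)
      show "\<forall>\<^sub>F n in H. norm (V n t - V n s - (t - s) *\<^sub>R acc (X n s) (V n s)) \<le> E * \<bar>t - s\<bar>\<^sup>2"
        using filter_leD[OF HF ev] by eventually_elim (rule est(3)[OF _ s t])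
    qed
  qed
  have unit: "g (x s) (v s) (v s) = 1" if s: "s \<in> I" for s
  proof -
    from main[OF s order_refl F] obtain H where
      H: "H \<le> F" "H \<noteq> bot" "((\<lambda>n. V n s) \<longlongrightarrow> v s) H" by (elim exE conjE)
    have Xs: "((\<lambda>n. X n s) \<longlongrightarrow> x s) H" by (rule tendsto_mono[OF H(1) lim[OF s]])
    have "((\<lambda>n. case (X n s, V n s, V n s) of (x, v, w) \<Rightarrow> g x v w) \<longlongrightarrow>
      (case (x s, v s, v s) of (x, v, w) \<Rightarrow> g x v w)) H"
    proof (rule continuous_on_tendsto_compose[OF continuous_on_g])
      show "((\<lambda>n. (X n s, V n s, V n s)) \<longlongrightarrow> (x s, v s, v s)) H"
        by (intro tendsto_Pair Xs H)
      show "(x s, v s, v s) \<in> U \<times> UNIV" using xK[OF s] controlledD(1)[OF ctl] by auto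
      show "\<forall>\<^sub>F n in H. (X n s, V n s, V n s) \<in> U \<times> UNIV"
        using filter_leD[OF H(1) XK[OF s]]
        by eventually_elim (use controlledD(1)[OF ctl] in auto)
    qed
    then have "((\<lambda>n. g (X n s) (V n s) (V n s)) \<longlongrightarrow> g (x s) (v s) (v s)) H" by simp
    moreover have "\<forall>\<^sub>F n in H. g (X n s) (V n s) (V n s) = 1"
      using filter_leD[OF H(1) ev] by eventually_elim (use s in \<open>simp add: unit_geodesic_on_def\<close>)
    then have "((\<lambda>n. g (X n s) (V n s) (V n s)) \<longlongrightarrow> 1) H" by (rule tendsto_eventually)
    ultimately show ?thesis by (rule tendsto_unique[OF H(2)])
  qed
  have "(v has_vector_derivative acc (x s) (v s)) (at s)" if "s \<in> I" for s
    by (rule has_vector_derivative_if_quadratic[OF I(2) that vq[OF that]])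
  then have "unit_geodesic_on K I x v"
    unfolding unit_geodesic_on_def using xK xv unit by blast
  then show ?thesis by blast
qed

end

context riemannian_manifold
begin

text \<open>
  The geodesics stay in one chart ball during a time that is the same for all of them, which
  reduces the claim to the coordinate version.
\<close>

lemma unit_geodesic_pointwise_limit:
  assumes F: "F \<noteq> bot" and geo: "\<And>n. unit_geodesic (\<Gamma> n)"
    and lim: "\<And>t. ((\<lambda>n. \<Gamma> n t) \<longlongrightarrow> \<gamma> t) F"
  shows "unit_geodesic \<gamma>"
proof -
  have local: "isCont \<gamma> t0 \<and> (\<exists>T v. open T \<and> t0 \<in> T \<and>
      (\<forall>s\<in>T. ((chart_map c \<circ> \<gamma>) has_vector_derivative v s) (at s)) \<and>
      (v has_vector_derivative acceleration c (chart_map c (\<gamma> t0)) (v t0)) (at t0) \<and>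
      G c (chart_map c (\<gamma> t0)) (v t0) (v t0) = 1)"
    if c: "c \<in> A" "\<gamma> t0 \<in> chart_dom c" for c t0
  proof -
    interpret cm: coordinate_metric "chart_codom c" "G c" by (rule coordinate_metric_chart[OF c(1)])
    let ?p = "chart_map c (\<gamma> t0)"
    from controlled_ball_exists[OF c open_UNIV UNIV_I] obtain R m C where
      R: "0 < R" "controlled_ball c ?p R m C" by (elim exE conjE)
    have m: "m > 0" and sub: "cball ?p R \<subseteq> chart_codom c" using cm.controlledD[OF R(2)] by auto
    define h where "h = sqrt m * (R / 2)"
    have h: "h > 0" using m R by (simp add: h_def)
    define I where "I = {t0 - h<..<t0 + h}"
    have I: "open I" "convex I" "t0 \<in> I" using h by (auto simp: I_def)
    have "\<gamma> t0 \<in> chart_ball c ?p (R / 2)" using c R(1) by (simp add: chart_ball_def)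
    then have "\<forall>\<^sub>F n in F. \<Gamma> n t0 \<in> chart_ball c ?p (R / 2)"
      using topological_tendstoD[OF lim open_chart_ball[OF c(1)]] by blast
    then have ev: "\<forall>\<^sub>F n in F. \<forall>s\<in>I. \<Gamma> n s \<in> chart_ball c ?p R"
    proof eventually_elim
      case (elim n)
      show ?case
      proof
        fix s assume "s \<in> I"
        then have "\<bar>s - t0\<bar> < h" by (auto simp: I_def)
        then have "\<bar>s - t0\<bar> < sqrt m * (R / 2)" unfolding h_def .
        from unit_geodesic_stays_in_chart_ball[OF c(1) R(2) geo elim this]
        show "\<Gamma> n s \<in> chart_ball c ?p R" by simp
      qed
    qed
    define D where "D = {p \<in> chart_dom c. norm (chart_map c p - ?p) \<le> R}"
    have D: "closed D" unfolding D_def by (rule closed_chart_cball[OF c(1) sub])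
    have \<gamma>D: "\<gamma> s \<in> D" if s: "s \<in> I" for s
    proof (rule Lim_in_closed_set[OF D _ F lim])
      show "\<forall>\<^sub>F n in F. \<Gamma> n s \<in> D"
        using ev by eventually_elim (use s in \<open>auto simp: D_def chart_ball_def\<close>)
    qed
    have limx: "((\<lambda>n. (chart_map c \<circ> \<Gamma> n) s) \<longlongrightarrow> (chart_map c \<circ> \<gamma>) s) F" if s: "s \<in> I" for s
      unfolding o_def
    proof (rule continuous_on_tendsto_compose[OF chart_facts(3)[OF c(1)] lim])
      show "\<gamma> s \<in> chart_dom c" using \<gamma>D[OF s] by (simp add: D_def)
      show "\<forall>\<^sub>F n in F. \<Gamma> n s \<in> chart_dom c"
        using ev by eventually_elim (use s in \<open>auto simp: chart_ball_def\<close>)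
    qed
    have "\<forall>\<^sub>F n in F. cm.unit_geodesic_on (cball ?p R) I (chart_map c \<circ> \<Gamma> n) (velocity c (\<Gamma> n) UNIV)"
      using ev
    proof eventually_elim
      case (elim n)
      have geo': "geodesic (\<Gamma> n)" using geo by (simp add: unit_geodesic_def)
      show ?case unfolding cm.unit_geodesic_on_def
      proof (intro ballI conjI)
        fix s assume "s \<in> I"
        then have s: "\<Gamma> n s \<in> chart_ball c ?p R" using elim by blast
        then have d: "\<Gamma> n s \<in> chart_dom c" by (simp add: chart_ball_def)
        show "(chart_map c \<circ> \<Gamma> n) s \<in> cball ?p R"
          using s by (auto simp: chart_ball_def dist_norm norm_minus_commute)
        show "((chart_map c \<circ> \<Gamma> n) has_vector_derivative velocity c (\<Gamma> n) UNIV s) (at s)"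
          by (rule geodesic_in_chart(1)[OF geo' c(1) d])
        show "(velocity c (\<Gamma> n) UNIV has_vector_derivative
            cm.acc ((chart_map c \<circ> \<Gamma> n) s) (velocity c (\<Gamma> n) UNIV s)) (at s)"
          using geodesic_in_chart(2)[OF geo' c(1) d] by simp
        have "sqrt (G c (chart_map c (\<Gamma> n s)) (velocity c (\<Gamma> n) UNIV s) (velocity c (\<Gamma> n) UNIV s)) = 1"
          using geodesic_speed[OF geo' c(1) d] geo[of n] by (simp add: unit_geodesic_def)
        then show "G c ((chart_map c \<circ> \<Gamma> n) s) (velocity c (\<Gamma> n) UNIV s) (velocity c (\<Gamma> n) UNIV s) = 1"
          by simp
      qed
    qed
    then have "\<exists>v. cm.unit_geodesic_on (cball ?p R) I (chart_map c \<circ> \<gamma>) v"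
      by (rule cm.unit_geodesic_on_pointwise_limit[OF R(2) closed_cball I(2,1) F _ limx])
    then obtain v where v: "cm.unit_geodesic_on (cball ?p R) I (chart_map c \<circ> \<gamma>) v" by (elim exE)
    have vD: "((chart_map c \<circ> \<gamma>) has_vector_derivative v s) (at s)" if "s \<in> I" for s
      using v that unfolding cm.unit_geodesic_on_def by blast
    have cont: "isCont (chart_map c \<circ> \<gamma>) t0" using vD[OF I(3)] has_vector_derivative_continuous by blast
    have "isCont (\<lambda>s. chart_inv c ((chart_map c \<circ> \<gamma>) s)) t0"
    proof (rule isCont_o2[OF cont])
      show "isCont (chart_inv c) ((chart_map c \<circ> \<gamma>) t0)"
        using continuous_on_interior[OF chart_facts(4)[OF c(1)]]
          interior_open[OF chart_facts(2)[OF c(1)]] chart_facts(6)[OF c] by simp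
    qed
    moreover have "\<forall>\<^sub>F s in nhds t0. chart_inv c ((chart_map c \<circ> \<gamma>) s) = \<gamma> s"
      using eventually_nhds_in_open[OF I(1,3)]
      by eventually_elim (use \<gamma>D chart_facts(5)[OF c(1)] in \<open>auto simp: D_def\<close>)
    ultimately have "isCont \<gamma> t0" by (rule iffD1[OF isCont_cong, rotated])
    moreover have "(v has_vector_derivative acceleration c (chart_map c (\<gamma> t0)) (v t0)) (at t0)"
      "G c (chart_map c (\<gamma> t0)) (v t0) (v t0) = 1"
      using v I(3) unfolding cm.unit_geodesic_on_def o_def by blast+
    ultimately show ?thesis using I vD by (intro conjI exI[of _ I] exI[of _ v]) auto
  qed
  have isCont: "isCont \<gamma> t" for t using local[OF chart_at] by blast
  then have cont: "continuous_on UNIV \<gamma>" by (simp add: continuous_at_imp_continuous_on)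
  have "geodesic \<gamma>"
  proof (rule geodesicI[OF cont])
    fix c t assume c: "c \<in> A" "\<gamma> t \<in> chart_dom c"
    from local[OF c] obtain T v where "open T" "t \<in> T"
      "\<forall>s\<in>T. ((chart_map c \<circ> \<gamma>) has_vector_derivative v s) (at s)"
      "(v has_vector_derivative acceleration c (chart_map c (\<gamma> t)) (v t)) (at t)" by (elim exE conjE)
    then show "\<exists>T v. open T \<and> t \<in> T \<and>
        (\<forall>s\<in>T. \<gamma> s \<in> chart_dom c \<longrightarrow> ((chart_map c \<circ> \<gamma>) has_vector_derivative v s) (at s)) \<and>
        (v has_vector_derivative acceleration c (chart_map c (\<gamma> t)) (v t)) (at t)"
      by (intro exI[of _ T] exI[of _ v]) simp
  qed
  moreover have "speed \<gamma> UNIV t = 1" for t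
  proof -
    from local[OF chart_at(1,2)[of "\<gamma> t"]] obtain T v where T: "t \<in> T"
      "\<forall>s\<in>T. ((chart_map (chart_at (\<gamma> t)) \<circ> \<gamma>) has_vector_derivative v s) (at s)"
      "G (chart_at (\<gamma> t)) (chart_map (chart_at (\<gamma> t)) (\<gamma> t)) (v t) (v t) = 1" by (elim exE conjE)
    then show ?thesis
      using speed_UNIV_in_chart[OF chart_at(1,2)[of "\<gamma> t"] isCont, of "v t"] by simp
  qed
  ultimately show ?thesis by (simp add: unit_geodesic_def)
qed

end

section \<open>Uniform separation along simple geodesics\<close>

text \<open>Tychonoff's theorem for the topology of pointwise convergence.\<close>

lemma compact_UNIV_fun:
  assumes "compact (UNIV :: 'b::topological_space set)"
  shows "compact (UNIV :: ('a \<Rightarrow> 'b) set)"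
proof -
  have "compact_space (euclidean :: 'b topology)"
    using assms by (simp add: compact_space_def)
  then have "compact_space (product_topology (\<lambda>_::'a. euclidean :: 'b topology) UNIV)"
    by (simp add: compact_space_product_topology)
  then show ?thesis by (simp add: euclidean_product_topology compact_space_def)
qed

context closed_riemannian_manifold
begin

text \<open>
  Otherwise geodesics \<open>\<Gamma> n\<close> return arbitrarily closely at times \<open>\<theta> n\<close>. A pointwise cluster point
  \<open>\<gamma>\<close> of the \<open>\<Gamma> n\<close> is a unit speed geodesic with \<open>\<gamma> t = \<gamma> 0\<close>, where \<open>t\<close> is a cluster point of
  the \<open>\<theta> n\<close>.
\<close>

lemma simple_geodesics_uniformly_separated:
  assumes simple: "\<And>\<gamma>. unit_geodesic \<gamma> \<Longrightarrow> inj_on \<gamma> {0..<L}" and ab: "0 < a" "b < L"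
  shows "\<exists>d>0. \<forall>\<gamma>. unit_geodesic \<gamma> \<longrightarrow> (\<forall>t\<in>{a..b}. d \<le> riem_dist (\<gamma> 0) (\<gamma> t))"
proof (rule ccontr)
  assume neg: "\<not> ?thesis"
  have "\<forall>n::nat. \<exists>\<gamma> t. unit_geodesic \<gamma> \<and> t \<in> {a..b} \<and> riem_dist (\<gamma> 0) (\<gamma> t) < inverse (real (Suc n))"
  proof
    fix n :: nat
    have "0 < inverse (real (Suc n))" by simp
    then show "\<exists>\<gamma> t. unit_geodesic \<gamma> \<and> t \<in> {a..b} \<and> riem_dist (\<gamma> 0) (\<gamma> t) < inverse (real (Suc n))"
      using neg by (meson not_le)
  qed
  then obtain \<Gamma> \<theta> where "\<forall>n. unit_geodesic (\<Gamma> n) \<and> \<theta> n \<in> {a..b} \<and>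
      riem_dist (\<Gamma> n 0) (\<Gamma> n (\<theta> n)) < inverse (real (Suc n))"
    unfolding choice_iff by (elim exE)
  then have geo: "unit_geodesic (\<Gamma> n)" and \<theta>: "\<theta> n \<in> {a..b}"
    and close: "riem_dist (\<Gamma> n 0) (\<Gamma> n (\<theta> n)) < inverse (real (Suc n))" for n
    by simp_all
  have "\<exists>t\<in>{a..b}. \<exists>H. H \<le> sequentially \<and> H \<noteq> bot \<and> (\<theta> \<longlongrightarrow> t) H"
    by (rule cluster_subfilter) (use \<theta> in auto)
  then obtain t H1 where t: "t \<in> {a..b}" and
    H1: "H1 \<le> sequentially" "H1 \<noteq> bot" "(\<theta> \<longlongrightarrow> t) H1" by (elim bexE exE conjE)
  have "\<exists>\<gamma>\<in>UNIV. \<exists>H. H \<le> H1 \<and> H \<noteq> bot \<and> (\<Gamma> \<longlongrightarrow> \<gamma>) H"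
    by (rule cluster_subfilter[OF compact_UNIV_fun[OF compact_manifold] H1(2)]) simp
  then obtain \<gamma> H where H: "H \<le> H1" "H \<noteq> bot" "(\<Gamma> \<longlongrightarrow> \<gamma>) H" by (elim bexE exE conjE)
  have lim: "((\<lambda>n. \<Gamma> n s) \<longlongrightarrow> \<gamma> s) H" for s
    by (rule continuous_on_tendsto_compose[OF continuous_on_product_coordinates H(3)]) auto
  have \<gamma>: "unit_geodesic \<gamma>" by (rule unit_geodesic_pointwise_limit[OF H(2) geo lim])
  have "\<gamma> 0 = \<gamma> t"
  proof (rule ccontr)
    assume "\<gamma> 0 \<noteq> \<gamma> t"
    then obtain U V where UV: "open U" "open V" "\<gamma> 0 \<in> U" "\<gamma> t \<in> V" "U \<inter> V = {}"
      using hausdorff by metis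
    obtain N r where N: "open N" "\<gamma> 0 \<in> N" "0 < r"
      "\<And>\<sigma>. piecewise_C1_curve \<sigma> 0 1 \<Longrightarrow> \<sigma> 0 \<in> N \<Longrightarrow> curve_length \<sigma> 0 1 < r \<Longrightarrow> \<sigma> 1 \<in> U"
      using short_curves_stay_near[OF UV(1,3)] by metis
    obtain N' r' where N': "open N'" "\<gamma> t \<in> N'" "0 < r'"
      "\<And>\<sigma>. piecewise_C1_curve \<sigma> 0 1 \<Longrightarrow> \<sigma> 0 \<in> N' \<Longrightarrow> curve_length \<sigma> 0 1 < r' \<Longrightarrow> \<sigma> 1 \<in> V"
      using short_curves_stay_near[OF UV(2,4)] by metis
    have "\<forall>\<^sub>F n in sequentially. inverse (real (Suc n)) < r"
      using order_tendstoD(2)[OF LIMSEQ_inverse_real_of_nat N(3)] .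
    then have e1: "\<forall>\<^sub>F n in H. inverse (real (Suc n)) < r"
      using H(1) H1(1) by (meson filter_leD)
    have e2: "\<forall>\<^sub>F n in H. \<Gamma> n 0 \<in> N" by (rule topological_tendstoD[OF lim N(1,2)])
    have e3: "\<forall>\<^sub>F n in H. \<Gamma> n t \<in> N'" by (rule topological_tendstoD[OF lim N'(1,2)])
    have "\<forall>\<^sub>F n in H1. dist (\<theta> n) t < r'" by (rule tendstoD[OF H1(3) N'(3)])
    then have e4: "\<forall>\<^sub>F n in H. \<bar>\<theta> n - t\<bar> < r'" using filter_leD[OF H(1)] by (simp add: dist_real_def)
    have "\<forall>\<^sub>F n in H. False"
      using e1 e2 e3 e4
    proof eventually_elim
      case (elim n)
      have "riem_dist (\<Gamma> n 0) (\<Gamma> n (\<theta> n)) < r" using close[of n] elim(1) by simp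
      from unit_geodesic_dist_lessE[OF geo this] obtain \<sigma> where
        "piecewise_C1_curve \<sigma> 0 1" "\<sigma> 0 = \<Gamma> n 0" "\<sigma> 1 = \<Gamma> n (\<theta> n)" "curve_length \<sigma> 0 1 < r" .
      then have "\<Gamma> n (\<theta> n) \<in> U" using N(4)[of \<sigma>] elim(2) by simp
      \<comment> \<open>the segment of \<open>\<Gamma> n\<close> from \<open>t\<close> to \<open>\<theta> n\<close> is a short curve\<close>
      moreover have "\<Gamma> n (\<theta> n) \<in> V"
        using N'(4)[of "\<lambda>u. \<Gamma> n (t + (\<theta> n - t) * u)"] unit_geodesic_segment[OF geo, of n t "\<theta> n - t"]
          elim(3,4) by simp
      ultimately show False using UV(5) by blast
    qed
    then show False using H(2) by (simp add: trivial_limit_def)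
  qed
  then have "0 = t" using inj_onD[OF simple[OF \<gamma>]] t ab by simp
  then show False using t ab by simp
qed

end

section \<open>Nearest neighbours in arithmetic progressions on a circle\<close>

text \<open>
  The distance of \<open>x\<close> to the lattice of integer multiples of \<open>L\<close>: \<open>round\<close> picks a nearest
  multiple.
\<close>

definition circle_norm :: "real \<Rightarrow> real \<Rightarrow> real" where
  "circle_norm L x = \<bar>x - L * of_int (round (x / L))\<bar>"

lemma circle_norm_le:
  assumes "L > 0"
  shows "circle_norm L x \<le> \<bar>x - L * of_int m\<bar>"
proof -
  have eq: "\<bar>x - L * of_int k\<bar> = L * \<bar>x / L - of_int k\<bar>" for k :: int
  proof -
    have "x - L * of_int k = L * (x / L - of_int k)" using assms by (simp add: algebra_simps)
    then show ?thesis using assms by (simp add: abs_mult)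
  qed
  show ?thesis unfolding circle_norm_def eq
    using assms by (intro mult_left_mono round_diff_minimal) auto
qed

lemma circle_norm_le_half:
  assumes "L > 0"
  shows "circle_norm L x \<le> L / 2"
proof -
  have "x - L * of_int (round (x / L)) = L * (x / L - of_int (round (x / L)))"
    using assms by (simp add: algebra_simps)
  then have "circle_norm L x = L * \<bar>of_int (round (x / L)) - x / L\<bar>"
    using assms by (simp add: circle_norm_def abs_mult abs_minus_commute)
  also have "\<dots> \<le> L * (1 / 2)"
    using assms by (intro mult_left_mono of_int_round_abs_le) auto
  finally show ?thesis by simp
qed

lemma circle_norm_uminus:
  assumes "L > 0"
  shows "circle_norm L (- x) = circle_norm L x"
proof -
  have "circle_norm L (- y) \<le> circle_norm L y" for y
    using circle_norm_le[OF assms, of "- y" "- round (y / L)"] by (simp add: circle_norm_def)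
  from this[of x] this[of "- x"] show ?thesis by simp
qed

lemma circle_norm_periodic:
  assumes "L > 0"
  shows "circle_norm L (x + L * of_int m) = circle_norm L x"
proof -
  have "circle_norm L (y + L * of_int k) \<le> circle_norm L y" for y and k :: int
    using circle_norm_le[OF assms, of "y + L * of_int k" "round (y / L) + k"]
    by (simp add: circle_norm_def algebra_simps)
  from this[of x m] this[of "x + L * of_int m" "- m"] show ?thesis by simp
qed

lemma circle_norm_diff_abs:
  assumes "L > 0"
  shows "circle_norm L (real j * T - real i * T) = circle_norm L (real (nat \<bar>int j - int i\<bar>) * T)"
proof (cases "i \<le> j")
  case True
  then have "nat \<bar>int j - int i\<bar> = j - i" by linarith
  then show ?thesis using True by (simp add: left_diff_distrib of_nat_diff)
next
  case False
  then have "nat \<bar>int j - int i\<bar> = i - j" by linarith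
  then have "real (nat \<bar>int j - int i\<bar>) * T = - (real j * T - real i * T)"
    using False by (simp add: left_diff_distrib of_nat_diff)
  then show ?thesis using circle_norm_uminus[OF assms] by metis
qed

text \<open>
  A nearest neighbour of a point is reached by a step of \<open>k\<close> with \<open>1 \<le> k \<le> n\<close>, and every point
  admits all steps up to \<open>m0\<close>, which is half of \<open>n\<close> rounded up in the application, in one of the
  two directions; this explains the hypotheses on a value \<open>v\<close>. Such a value either is the
  minimum over the steps up to \<open>m0\<close>, or is attained by a longer step that beats all of these.
  Two longer steps differ by at most \<open>m0\<close>. If their signed residues \<open>r k\<close> had the same sign, the
  difference step would beat them, unless both have the same value. So there is at most one
  further value for each sign.
\<close>

lemma record_values_bound:
  fixes n m0 :: nat and T :: real
  assumes L: "L > 0" and n: "n \<le> 2 * m0"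
  defines "\<nu> \<equiv> \<lambda>k. circle_norm L (real k * T)"
  assumes attained: "\<And>v. v \<in> V \<Longrightarrow> \<exists>k\<in>{1..n}. \<nu> k \<noteq> 0 \<and> v = \<nu> k"
    and minimal: "\<And>v k. v \<in> V \<Longrightarrow> k \<in> {1..m0} \<Longrightarrow> \<nu> k \<noteq> 0 \<Longrightarrow> v \<le> \<nu> k"
  shows "finite V \<and> card V \<le> 3"
proof -
  define r where "r k = real k * T - L * of_int (round (real k * T / L))" for k
  have \<nu>r: "\<nu> k = \<bar>r k\<bar>" for k by (simp add: \<nu>_def r_def circle_norm_def)
  define S where "S = {k \<in> {1..m0}. \<nu> k \<noteq> 0}"
  define Q where "Q = {k \<in> {m0<..n}. \<nu> k \<noteq> 0 \<and> (\<forall>k'\<in>S. \<nu> k < \<nu> k')}"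
  define P1 where "P1 = {k \<in> Q. r k > 0}"
  define P2 where "P2 = {k \<in> Q. r k < 0}"
  have fin: "finite P1" "finite P2" "finite S" by (auto simp: P1_def P2_def Q_def S_def)
  have key: "\<nu> k = \<nu> k'" if k: "k \<in> Q" "k' \<in> Q" and less: "k < k'" and same: "0 < r k * r k'" for k k'
  proof (cases "\<nu> (k' - k) = 0")
    case True
    let ?m = "round (real (k' - k) * T / L)"
    have "real (k' - k) * T = L * of_int ?m" using True by (simp add: \<nu>_def circle_norm_def)
    then have "real k' * T = real k * T + L * of_int ?m"
      using less by (simp add: of_nat_diff left_diff_distrib)
    then show ?thesis unfolding \<nu>_def using circle_norm_periodic[OF L] by metis
  next
    case False
    have "k' - k \<in> {1..m0}" using k less n by (auto simp: Q_def)
    then have S: "k' - k \<in> S" using False by (simp add: S_def)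
    have "\<nu> (k' - k) \<le> \<bar>real (k' - k) * T - L * of_int (round (real k' * T / L) - round (real k * T / L))\<bar>"
      unfolding \<nu>_def by (rule circle_norm_le[OF L])
    also have "real (k' - k) * T - L * of_int (round (real k' * T / L) - round (real k * T / L)) = r k' - r k"
      using less by (simp add: r_def of_nat_diff algebra_simps)
    also have "\<bar>r k' - r k\<bar> \<le> max (\<nu> k) (\<nu> k')"
      using same unfolding \<nu>r by (auto simp: zero_less_mult_iff)
    also have "\<dots> < \<nu> (k' - k)" using k S by (auto simp: Q_def)
    finally show ?thesis by simp
  qed
  have single: "card (\<nu> ` P) \<le> 1" if P: "finite P" "P \<subseteq> Q"
    and same: "\<And>k k'. k \<in> P \<Longrightarrow> k' \<in> P \<Longrightarrow> 0 < r k * r k'" for P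
  proof -
    have eq: "\<nu> k = \<nu> k'" if "k \<in> P" "k' \<in> P" for k k'
      using key[of k k'] key[of k' k] P(2) same that by (metis linorder_neqE_nat subsetD)
    have "\<forall>a\<in>\<nu> ` P. \<forall>b\<in>\<nu> ` P. a = b" using eq by blast
    then show ?thesis
      unfolding One_nat_def card_le_Suc0_iff_eq[OF finite_imageI[OF P(1)]] .
  qed
  have c1: "card (\<nu> ` P1) \<le> 1" by (rule single[OF fin(1)]) (auto simp: P1_def)
  have c2: "card (\<nu> ` P2) \<le> 1" by (rule single[OF fin(2)]) (auto simp: P2_def mult_neg_neg)
  let ?B = "insert (Min (\<nu> ` S)) (\<nu> ` P1 \<union> \<nu> ` P2)"
  have sub: "V \<subseteq> ?B"
  proof
    fix v assume v: "v \<in> V"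
    from attained[OF v] obtain k where k: "k \<in> {1..n}" "\<nu> k \<noteq> 0" "v = \<nu> k" by (elim bexE conjE)
    have le: "v \<le> \<nu> k'" if "k' \<in> S" for k' using minimal[OF v] that by (simp add: S_def)
    show "v \<in> ?B"
    proof (cases "\<exists>k'\<in>S. \<nu> k' \<le> v")
      case True
      then obtain k' where "k' \<in> S" "\<nu> k' \<le> v" by blast
      then have "v = \<nu> k'" using le by force
      then have "Min (\<nu> ` S) = v" using \<open>k' \<in> S\<close> le fin(3) by (intro Min_eqI) auto
      then show ?thesis by simp
    next
      case False
      then have less: "\<And>k'. k' \<in> S \<Longrightarrow> v < \<nu> k'" by force
      have "k \<notin> S" using less[of k] k(3) by auto
      then have "k \<in> {m0<..n}" using k by (auto simp: S_def)
      then have "k \<in> Q" using k less by (auto simp: Q_def)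
      moreover have "r k > 0 \<or> r k < 0" using k(2) unfolding \<nu>r by auto
      ultimately show ?thesis using k(3) by (auto simp: P1_def P2_def)
    qed
  qed
  have "card V \<le> card ?B" using fin by (intro card_mono[OF _ sub]) auto
  also have "\<dots> \<le> Suc (card (\<nu> ` P1 \<union> \<nu> ` P2))" by (rule card_insert_le_m1) simp_all
  also have "\<dots> \<le> Suc (card (\<nu> ` P1) + card (\<nu> ` P2))" using card_Un_le by simp
  also have "\<dots> \<le> 3" using c1 c2 by simp
  finally show ?thesis using finite_subset[OF sub] fin by auto
qed

text \<open>
  Here \<open>d\<close> agrees with the distance along the circle only below the threshold \<open>\<delta>\<close>. The set \<open>Z\<close>
  collects the points with a neighbour below the threshold, whose nearest neighbour distances
  are those of the circle; the points of \<open>Y\<close> are \<open>\<delta>\<close>-separated on the circle, so each interval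
  of length \<open>\<delta>\<close> contains at most one of them.
\<close>

lemma nearest_neighbour_values_bound:
  fixes p :: "nat \<Rightarrow> 'm" and d :: "'m \<Rightarrow> 'm \<Rightarrow> real"
  assumes L: "L > 0" and \<delta>: "\<delta> > 0"
    and eq: "\<And>i j. p i = p j \<longleftrightarrow> circle_norm L (real j * T - real i * T) = 0"
    and near: "\<And>i j. p i \<noteq> p j \<Longrightarrow> circle_norm L (real j * T - real i * T) < \<delta> \<Longrightarrow>
      d (p i) (p j) = circle_norm L (real j * T - real i * T)"
    and far: "\<And>i j. \<delta> \<le> circle_norm L (real j * T - real i * T) \<Longrightarrow> \<delta> \<le> d (p i) (p j)"
    and X: "X = p ` {0..n}" "2 \<le> card X"
  shows "card ((\<lambda>x. Min (d x ` (X - {x}))) ` X) \<le> nat \<lfloor>L / \<delta>\<rfloor> + 4"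
proof -
  define D where "D x = Min (d x ` (X - {x}))" for x
  define \<nu> where "\<nu> k = circle_norm L (real k * T)" for k
  have finX: "finite X" using X(1) by simp
  have ne: "d x ` (X - {x}) \<noteq> {}" for x
  proof -
    have "X - {x} \<noteq> {}"
    proof
      assume "X - {x} = {}"
      then have "card X \<le> card {x}" by (intro card_mono) auto
      then show False using X(2) by simp
    qed
    then show ?thesis by blast
  qed
  have D_in: "\<exists>y\<in>X - {x}. D x = d x y" for x
    using Min_in[OF _ ne[of x]] finX unfolding D_def by auto
  have D_le: "D x \<le> d x y" if "y \<in> X" "y \<noteq> x" for x y
    unfolding D_def using that finX by (intro Min_le) auto
  define Z where "Z = {x \<in> X. D x < \<delta>}"
  define Y where "Y = {x \<in> X. \<delta> \<le> D x}"
  have "card Y \<le> nat \<lfloor>L / \<delta>\<rfloor> + 1"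
  proof -
    define i where "i x = (SOME k. k \<in> {0..n} \<and> x = p k)" for x
    have i: "i x \<in> {0..n}" "x = p (i x)" if "x \<in> Y" for x
    proof -
      have "\<exists>k. k \<in> {0..n} \<and> x = p k" using that X(1) by (auto simp: Y_def)
      from someI_ex[OF this] show "i x \<in> {0..n}" "x = p (i x)" unfolding i_def by blast+
    qed
    define w where "w x = \<lfloor>real (i x) * T / L\<rfloor>" for x
    define u where "u x = real (i x) * T - L * of_int (w x)" for x
    have u: "0 \<le> u x" "u x < L" for x
    proof -
      have "of_int (w x) \<le> real (i x) * T / L" "real (i x) * T / L < of_int (w x) + 1"
        unfolding w_def by linarith+
      then show "0 \<le> u x" "u x < L" using L by (simp_all add: u_def field_simps)
    qed
    define q where "q x = \<lfloor>u x / \<delta>\<rfloor>" for x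
    have "inj_on q Y"
    proof (rule inj_onI, rule ccontr)
      fix x y assume xy: "x \<in> Y" "y \<in> Y" "q x = q y" "x \<noteq> y"
      have "\<bar>u y / \<delta> - u x / \<delta>\<bar> < 1" using xy(3) unfolding q_def by linarith
      then have "\<bar>u y - u x\<bar> < \<delta>" using \<delta> by (simp add: diff_divide_distrib[symmetric] field_simps)
      moreover have "circle_norm L (real (i y) * T - real (i x) * T) \<le> \<bar>u y - u x\<bar>"
        using circle_norm_le[OF L, of "real (i y) * T - real (i x) * T" "w y - w x"]
        by (simp add: u_def algebra_simps)
      ultimately have "circle_norm L (real (i y) * T - real (i x) * T) < \<delta>" by simp
      moreover from this have "d x y = circle_norm L (real (i y) * T - real (i x) * T)"
        using near[of "i x" "i y"] i(2)[OF xy(1)] i(2)[OF xy(2)] xy(4) by metis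
      ultimately have "d x y < \<delta>" by simp
      then show False using D_le[of y x] xy by (auto simp: Y_def)
    qed
    moreover have "q ` Y \<subseteq> {0..\<lfloor>L / \<delta>\<rfloor>}"
    proof (rule image_subsetI)
      fix x
      have "0 \<le> u x / \<delta>" "u x / \<delta> \<le> L / \<delta>"
        using u[of x] \<delta> by (simp_all add: divide_right_mono)
      then show "q x \<in> {0..\<lfloor>L / \<delta>\<rfloor>}" unfolding q_def by (simp add: floor_mono)
    qed
    ultimately have "card Y \<le> card {0..\<lfloor>L / \<delta>\<rfloor>}" by (intro card_inj_on_le) auto
    also have "\<dots> = nat \<lfloor>L / \<delta>\<rfloor> + 1" using L \<delta> by (simp add: nat_add_distrib)
    finally show ?thesis .
  qed
  then have cY: "card (D ` Y) \<le> nat \<lfloor>L / \<delta>\<rfloor> + 1"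
    using card_image_le[of Y D] finX by (simp add: Y_def)
  have "finite (D ` Z) \<and> card (D ` Z) \<le> 3"
  proof (rule record_values_bound[OF L, where n = n and ?m0.0 = "(n + 1) div 2" and T = T, folded \<nu>_def])
    show "n \<le> 2 * ((n + 1) div 2)" by linarith
  next
    fix v assume "v \<in> D ` Z"
    then obtain x where x: "x \<in> X" "D x < \<delta>" "v = D x" by (auto simp: Z_def)
    from D_in[of x] obtain y where y: "y \<in> X" "y \<noteq> x" "D x = d x y" by blast
    obtain i j where ij: "i \<le> n" "x = p i" "j \<le> n" "y = p j" using x y X(1) by auto
    have "d (p i) (p j) < \<delta>" using x(2) y(3) ij by simp
    then have "\<not> \<delta> \<le> circle_norm L (real j * T - real i * T)"
      using far[of j i] by auto
    then have "d x y = circle_norm L (real j * T - real i * T)"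
      using near[of i j] y ij by auto
    also have "\<dots> = \<nu> (nat \<bar>int j - int i\<bar>)" unfolding \<nu>_def by (rule circle_norm_diff_abs[OF L])
    finally have v: "v = \<nu> (nat \<bar>int j - int i\<bar>)" using x y by simp
    have "i \<noteq> j" using y ij by auto
    then have "nat \<bar>int j - int i\<bar> \<in> {1..n}" using ij by auto
    moreover have "\<nu> (nat \<bar>int j - int i\<bar>) \<noteq> 0"
      using eq[of i j] y ij unfolding \<nu>_def by (simp add: circle_norm_diff_abs[OF L])
    ultimately show "\<exists>k\<in>{1..n}. \<nu> k \<noteq> 0 \<and> v = \<nu> k" using v by blast
  next
    fix v k assume v: "v \<in> D ` Z" and k: "k \<in> {1..(n + 1) div 2}" "\<nu> k \<noteq> 0"
    then obtain x where x: "x \<in> X" "D x < \<delta>" "v = D x" by (auto simp: Z_def)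
    obtain i where i: "i \<le> n" "x = p i" using x X(1) by auto
    obtain j where j: "j \<le> n" "nat \<bar>int j - int i\<bar> = k"
    proof (cases "i + k \<le> n")
      case True
      then show ?thesis by (intro that[of "i + k"]) auto
    next
      case False
      then have "k \<le> i" using k(1) by auto
      then show ?thesis using i by (intro that[of "i - k"]) (auto simp: of_nat_diff)
    qed
    have \<nu>: "circle_norm L (real j * T - real i * T) = \<nu> k"
      unfolding \<nu>_def j(2)[symmetric] by (rule circle_norm_diff_abs[OF L])
    then have neq: "p i \<noteq> p j" using eq[of i j] k(2) by simp
    show "v \<le> \<nu> k"
    proof (cases "\<nu> k < \<delta>")
      case True
      then have "d x (p j) = \<nu> k" using near[OF neq] \<nu> i by simp
      moreover have "D x \<le> d x (p j)" using neq i j X(1) by (intro D_le) auto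
      ultimately show ?thesis using x by simp
    qed (use x in auto)
  qed
  then have cZ: "card (D ` Z) \<le> 3" by simp
  have "X = Y \<union> Z" by (auto simp: Y_def Z_def)
  then have "D ` X = D ` Y \<union> D ` Z" by blast
  then have "card (D ` X) \<le> card (D ` Y) + card (D ` Z)" by (simp add: card_Un_le)
  then show ?thesis using cY cZ by (simp add: D_def[abs_def])
qed

section \<open>Bounded geodesic combinatorics\<close>

context SC_manifold
begin

text \<open>
  The constants \<open>e\<close> and \<open>d\<close> combine to the threshold \<open>\<delta> = min d (e / 2)\<close> below which distances
  in the manifold are arc lengths along the closed geodesic.
\<close>

lemma bounded_combinatorics: "bounded_geodesic_combinatorics"
proof -
  from geodesics_simple_periodic obtain L where
    "\<forall>\<gamma>. geodesic \<gamma> \<and> (\<forall>t. speed \<gamma> UNIV t = 1) \<longrightarrow> least_period \<gamma> L \<and> inj_on \<gamma> {0..<L}" by (elim exE)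
  then have simple: "inj_on \<gamma> {0..<L}" and Lpos: "L > 0" and per: "\<gamma> (t + L) = \<gamma> t"
    if "unit_geodesic \<gamma>" for \<gamma> t
    using that by (simp_all add: unit_geodesic_def least_period_def)
  obtain e where e: "0 < e"
    "\<And>\<gamma> s h. unit_geodesic \<gamma> \<Longrightarrow> h \<noteq> 0 \<Longrightarrow> \<bar>h\<bar> < e \<Longrightarrow> riem_dist (\<gamma> s) (\<gamma> (s + h)) = \<bar>h\<bar>"
    by (rule unit_geodesic_minimizing_uniform) blast
  have K: "\<exists>K. \<forall>\<gamma>. unit_geodesic \<gamma> \<longrightarrow> (\<forall>T n. card (NND ((\<lambda>i. \<gamma> (real i * T)) ` {0..n})) \<le> K)"
  proof (cases "L > 0")
    case False
    then show ?thesis using Lpos by blast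
  next
    case L: True
    have "\<exists>d>0. \<forall>\<gamma>. unit_geodesic \<gamma> \<longrightarrow> (\<forall>t\<in>{e / 2..L / 2}. d \<le> riem_dist (\<gamma> 0) (\<gamma> t))"
      by (rule simple_geodesics_uniformly_separated[OF simple]) (use e L in auto)
    then obtain d where d: "d > 0"
      "\<forall>\<gamma>. unit_geodesic \<gamma> \<longrightarrow> (\<forall>t\<in>{e / 2..L / 2}. d \<le> riem_dist (\<gamma> 0) (\<gamma> t))" by (elim exE conjE)
    \<comment> \<open>arcs of length in the overlap from \<open>e / 2\<close> to \<open>e\<close> are covered by both estimates\<close>
    define \<delta> where "\<delta> = min d (e / 2)"
    have \<delta>: "\<delta> > 0" "\<delta> \<le> d" "\<delta> \<le> e / 2" using d e by (auto simp: \<delta>_def)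
    have "card (NND ((\<lambda>i. \<gamma> (real i * T)) ` {0..n})) \<le> nat \<lfloor>L / \<delta>\<rfloor> + 4"
      if geo: "unit_geodesic \<gamma>" for \<gamma> T n
    proof -
      have per_int: "\<gamma> (t + L * of_int m) = \<gamma> t" for t m
      proof -
        have nat: "\<gamma> (t + L * real k) = \<gamma> t" for t k
        proof (induction k)
          case (Suc k)
          have "t + L * real (Suc k) = (t + L * real k) + L" by (simp add: algebra_simps)
          then show ?case using Suc per[OF geo] by metis
        qed simp
        show ?thesis
        proof (cases "m \<ge> 0")
          case True
          then show ?thesis using nat[of t "nat m"] by simp
        next
          case False
          then show ?thesis using nat[of "t + L * of_int m" "nat (- m)"] by (simp add: of_nat_nat)
        qed
      qed
      have shift: "\<exists>h. \<bar>h\<bar> = circle_norm L (t - s) \<and> \<gamma> t = \<gamma> (s + h)" for s t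
      proof (intro exI conjI)
        let ?m = "round ((t - s) / L)"
        show "\<bar>t - s - L * of_int ?m\<bar> = circle_norm L (t - s)" by (simp add: circle_norm_def)
        show "\<gamma> t = \<gamma> (s + (t - s - L * of_int ?m))"
          using per_int[of t "- ?m"] by simp
      qed
      have far: "\<delta> \<le> riem_dist (\<gamma> s) (\<gamma> t)" if far: "\<delta> \<le> circle_norm L (t - s)" for s t
      proof -
        from shift[of t s] obtain h where h: "\<bar>h\<bar> = circle_norm L (t - s)" "\<gamma> t = \<gamma> (s + h)"
          by (elim exE conjE)
        show ?thesis
        proof (cases "\<bar>h\<bar> < e")
          case True
          then show ?thesis using e(2)[OF geo, of h s] h far \<delta>(1) by auto
        next
          case False
          have "unit_geodesic (\<lambda>u. \<gamma> (s + sgn h * u))"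
            using h(1) far \<delta>(1) by (intro unit_geodesic_affine[OF geo]) (auto simp: sgn_if)
          moreover have "\<bar>h\<bar> \<in> {e / 2..L / 2}"
            using False e(1) h(1) circle_norm_le_half[OF L] by simp
          ultimately have "d \<le> riem_dist (\<gamma> (s + sgn h * 0)) (\<gamma> (s + sgn h * \<bar>h\<bar>))"
            using d(2) by blast
          then show ?thesis using h(2) \<delta>(2) by (simp add: sgn_mult_abs)
        qed
      qed
      have near: "riem_dist (\<gamma> s) (\<gamma> t) = circle_norm L (t - s)"
        if "\<gamma> s \<noteq> \<gamma> t" "circle_norm L (t - s) < \<delta>" for s t
      proof -
        from shift[of t s] obtain h where h: "\<bar>h\<bar> = circle_norm L (t - s)" "\<gamma> t = \<gamma> (s + h)"
          by (elim exE conjE)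
        have "h \<noteq> 0" using h(2) that(1) by auto
        then show ?thesis using e(2)[OF geo, of h s] h that(2) \<delta>(3) e(1) by simp
      qed
      have eq: "\<gamma> s = \<gamma> t \<longleftrightarrow> circle_norm L (t - s) = 0" for s t
      proof
        assume eq: "\<gamma> s = \<gamma> t"
        define w where "w x = x + L * of_int (- \<lfloor>x / L\<rfloor>)" for x
        have "w x \<in> {0..<L}" for x
          using floor_divide_lower[OF L, of x] floor_divide_upper[OF L, of x]
          by (simp add: w_def algebra_simps)
        moreover have "\<gamma> (w s) = \<gamma> (w t)" using eq per_int by (simp only: w_def)
        ultimately have "w s = w t" using simple[OF geo] by (meson inj_onD)
        then have "t - s = 0 + L * of_int (\<lfloor>t / L\<rfloor> - \<lfloor>s / L\<rfloor>)"
          by (simp add: w_def algebra_simps)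
        then have "circle_norm L (t - s) = circle_norm L 0"
          using circle_norm_periodic[OF L] by metis
        then show "circle_norm L (t - s) = 0" by (simp add: circle_norm_def)
      next
        assume "circle_norm L (t - s) = 0"
        with shift[of t s] show "\<gamma> s = \<gamma> t" by auto
      qed
      let ?X = "(\<lambda>i. \<gamma> (real i * T)) ` {0..n}"
      show ?thesis
      proof (cases "2 \<le> card ?X")
        case True
        have "card ((\<lambda>x. Min (riem_dist x ` (?X - {x}))) ` ?X) \<le> nat \<lfloor>L / \<delta>\<rfloor> + 4"
          by (rule nearest_neighbour_values_bound[OF L \<delta>(1), where p = "\<lambda>i. \<gamma> (real i * T)" and T = T and n = n])
            (use eq near far True in auto)
        then show ?thesis using True by (simp add: NND_def nnd_def)
      qed (simp add: NND_def)
    qed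
    then show ?thesis by blast
  qed
  then obtain K where K: "\<And>\<gamma> T n. unit_geodesic \<gamma> \<Longrightarrow> card (NND ((\<lambda>i. \<gamma> (real i * T)) ` {0..n})) \<le> K"
    by blast
  have "card (NND ((\<lambda>i. \<gamma> (real i * T)) ` {0..n})) \<le> K" if geo: "geodesic \<gamma>" for \<gamma> T n
  proof (cases "speed \<gamma> UNIV 0 = 0")
    case True
    then have "\<gamma> t = \<gamma> 0" for t
      using geodesic_constant_speed[OF geo, of _ 0] by (intro geodesic_zero_speed_constant[OF geo]) simp
    then have "(\<lambda>i. \<gamma> (real i * T)) ` {0..n} \<subseteq> {\<gamma> 0}" by blast
    then have "card ((\<lambda>i. \<gamma> (real i * T)) ` {0..n}) \<le> 1"
      using card_mono[of "{\<gamma> 0}"] by fastforce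
    then show ?thesis by (simp add: NND_def)
  next
    case False
    define a where "a = speed \<gamma> UNIV 0"
    have a: "a > 0" using False speed_nonneg[of \<gamma> UNIV 0] by (simp add: a_def)
    have sp: "speed \<gamma> UNIV t = a" for t using geodesic_constant_speed[OF geo] by (simp add: a_def)
    have "unit_geodesic (\<lambda>u. \<gamma> (0 + (1 / a) * u))"
      unfolding unit_geodesic_def using geodesic_affine[OF geo, of 0 "1 / a"] sp a by simp
    from K[OF this, of "a * T" n] show ?thesis using a by simp
  qed
  then show ?thesis
    unfolding bounded_geodesic_combinatorics_def K_bounded_geodesic_combinatorics_def by blast
qed

end

theorem proposition2:
  fixes A :: "('m::{t2_space, second_countable_topology}, 'e::euclidean_space) chart set"
    and G :: "('m, 'e) chart \<Rightarrow> 'e \<Rightarrow> 'e \<Rightarrow> 'e \<Rightarrow> real"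
  assumes "SC_manifold A G"
  shows "riemannian_manifold.bounded_geodesic_combinatorics A G"
  using SC_manifold.bounded_combinatorics[OF assms] .

end
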